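(* Let $d,k\in\mathbb{N}$, let $G\subset\mathbb{R}^d$ be a bounded domain, and let $\tau>0$. Let $\mathbf{F}\colon\mathbb{R}^{k\times d}\to\mathcal{S}_{\ge 0}(\mathbb{R}^{k\times d})$ be weakly differentiable such that $\mathbf{F}$ together with its weak Jacobian are essentially bounded by a number $c>0$. Let $T>0$, and let $(\mathbf{u}_1,\mathbf{H}_1)^T$, $(\mathbf{u}_2,\mathbf{H}_2)^T$ be two weak solutions on $[0,T]$, with possibly different initial data in $\mathcal{H}\times L^\infty(G,\mathcal{S}(\mathbb{R}^{k\times d}))$, of $$\partial_t\mathbf{u}+\mathcal{A}(\mathbf{H})\mathbf{u}=0\ \text{ in } L^2(0,T;\mathcal{V}'),$$ $$\tau\partial_t\mathbf{H}+\mathbf{H}-\mathbf{F}(\nabla\mathbf{u})=0\ \text{ in } L^2\big(0,T;L^\infty(G,\mathcal{S}(\mathbb{R}^{k\times d}))\big)$$ such that $\nabla\mathbf{u}_1,\nabla\mathbf{u}_2\in L^\infty\big((0,T)\times G,\mathbb{R}^{k\times d}\big)$. Then there exists a constant $\tilde C>0$ such that $$\max_{0\le t\le T}\Big(\|\mathbf{u}_1(t,\cdot)-\mathbf{u}_2(t,\cdot)\|_{L^2(G,\mathbb{R}^k)}^2+\|\mathbf{H}_1(t,\cdot)-\mathbf{H}_2(t,\cdot)\|_{L^2(G,\mathbb{R}^{(k\times d)\times(k\times d)})}^2\Big)$$ $$\le\tilde C\Big(\|\mathbf{u}_1(0,\cdot)-\mathbf{u}_2(0,\cdot)\|_{L^2(G,\mathbb{R}^k)}^2+\|\mathbf{H}_1(0,\cdot)-\mathbf{H}_2(0,\cdot)\|_{L^2(G,\mathbb{R}^{(k\times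 d)\times(k\times d)})}^2\Big).$$
   Context: $\mathbb{R}^{k\times d}$ carries the Frobenius scalar product $\mathbf{D}:\hat{\mathbf{D}}=\sum_{i,j}D_{ij}\hat D_{ij}$. A fourth-order tensor $\mathbf{H}=(H_{ijIJ})\in\mathbb{R}^{(k\times d)\times(k\times d)}$ ($i,I=1,\dots,k$; $j,J=1,\dots,d$) acts on $\mathbf{D}\in\mathbb{R}^{k\times d}$ by $(\mathbf{H}\mathbf{D})_{ij}=\sum_{I=1}^k\sum_{J=1}^d H_{ijIJ}D_{IJ}$; the space of tensors carries the Frobenius norm. $\mathcal{S}(\mathbb{R}^{k\times d})$ is the space of symmetric tensors ($H_{ijIJ}=H_{IJij}$), and for $\kappa\ge 0$, $\mathcal{S}_{\ge\kappa}(\mathbb{R}^{k\times d})$ is the set of $\mathbf{H}\in\mathcal{S}(\mathbb{R}^{k\times d})$ with smallest eigenvalue $\ge\kappa$, i.e. $(\mathbf{H}\mathbf{D}):\mathbf{D}\ge\kappa\,\mathbf{D}:\mathbf{D}$ for all $\mathbf{D}$. $L^\infty(G,\mathcal{S}_{\ge\kappa}(\mathbb{R}^{k\times d}))$ is the set of $\mathbf{H}\in L^\infty(G,\mathcal{S}(\mathbb{R}^{k\times d}))$ with $\mathbf{H}(\mathbf{x})\in\mathcal{S}_{\ge\kappa}(\mathbb{R}^{k\times d})$ for a.e. $\mathbf{x}\in G$. $\mathcal{H}:=\{\mathbf{u}\in L^2(G,\mathbb{R}^k)\mid\int_G\mathbf{u}\,\mathrm{d}\mathbf{x}=\mathbf{0}\}$,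 $\mathcal{V}:=H^1(G,\mathbb{R}^k)\cap\mathcal{H}$, and $\mathcal{V}'$ is the dual of $\mathcal{V}$ in the Gelfand triple $(\mathcal{V},\mathcal{H},\mathcal{V}')$. For $\mathbf{H}\in L^\infty(G,\mathcal{S}_{\ge\kappa}(\mathbb{R}^{k\times d}))$ with $\kappa>0$, the operator $\mathcal{A}(\mathbf{H})\colon\mathcal{V}\to\mathcal{V}'$ is given by $\langle\mathcal{A}(\mathbf{H})\mathbf{u},\mathbf{v}\rangle_{\mathcal{V}';\mathcal{V}}=\int_G(\mathbf{H}\nabla\mathbf{u}):(\nabla\mathbf{v})\,\mathrm{d}\mathbf{x}$, with $\nabla\mathbf{u}=(\partial_{x_j}u_i)_{ij}$ the Jacobian. $\mathbf{F}$ is identified with its Lipschitz continuous representative. Weak solution on $[0,T]$ (with given initial data): a pair $(\mathbf{u},\mathbf{H})^T$ for which there is a number $\kappa>0$ with $\mathbf{H}\in\mathcal{S}_{\ge\kappa}(\mathbb{R}^{k\times d})$ a.e. in $(0,T)\times G$, with $$\mathbf{u}\in H^1(0,T;\mathcal{V}')\cap L^2(0,T;\mathcal{V}),\qquad \mathbf{H}\in H^1\big(0,T;L^\infty(G,\mathcal{S}(\mathbb{R}^{k\times d}))\big),$$ fulfilling the two differential equations and the prescribed initial conditions for $\mathbf{u}(0,\cdot)\in\mathcal{H}$ and $\mathbf{H}(0,\cdot)\in L^\infty(G,\mathcal{S}(\mathbb{R}^{k\times d}))$, pointwise values in time of $\mathbf{u}$ being understood via the embedding $L^2(0,T;\mathcal{V})\cap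 H^1(0,T;\mathcal{V}')\hookrightarrow C^0([0,T],\mathcal{H})$, and those of $\mathbf{H}$ via its continuous representative. *)

theory Defs
  imports "HOL-Analysis.Analysis" "HOL-Probability.Essential_Supremum"
begin

section \<open>Tensors\<close>

text \<open>
  A matrix with k rows and d columns has type \<open>real^'d^'k\<close>, so that its entries are
  \<open>D $ i $ j\<close>; a fourth-order tensor has type \<open>real^'d^'k^'d^'k\<close>, with entries
  \<open>H $ i $ j $ I $ J\<close>. On these types the library's \<open>norm\<close> and \<open>\<bullet>\<close> are
  the Frobenius norm and the Frobenius scalar product.
\<close>

definition tensor_app :: "real^'d^'k^'d^'k \<Rightarrow> real^'d^'k \<Rightarrow> real^'d^'k" where
  "tensor_app H D = (\<chi> i j. \<Sum>I\<in>UNIV. \<Sum>J\<in>UNIV. H $ i $ j $ I $ J * D $ I $ J)"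

definition sym_tensors :: "(real^'d^'k^'d^'k) set" where
  "sym_tensors = {H. \<forall>i j I J. H $ i $ j $ I $ J = H $ I $ J $ i $ j}"

definition sym_tensors_ge :: "real \<Rightarrow> (real^'d^'k^'d^'k) set" where
  "sym_tensors_ge \<kappa> = {H \<in> sym_tensors. \<forall>D. \<kappa> * (D \<bullet> D) \<le> tensor_app H D \<bullet> D}"


section \<open>Test functions and weak derivatives\<close>

definition partial_deriv :: "'a::euclidean_space \<Rightarrow> ('a \<Rightarrow> real) \<Rightarrow> 'a \<Rightarrow> real" where
  "partial_deriv b f x = frechet_derivative f (at x) b"

fun times_continuously_diff :: "nat \<Rightarrow> ('a::euclidean_space \<Rightarrow> real) \<Rightarrow> bool" where
  "times_continuously_diff 0 f \<longleftrightarrow> continuous_on UNIV f"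
| "times_continuously_diff (Suc n) f \<longleftrightarrow>
     f differentiable_on UNIV \<and> (\<forall>b\<in>Basis. times_continuously_diff n (partial_deriv b f))"

definition test_function :: "'a::euclidean_space set \<Rightarrow> ('a \<Rightarrow> real) \<Rightarrow> bool" where
  "test_function \<Omega> \<phi> \<longleftrightarrow> (\<forall>n. times_continuously_diff n \<phi>) \<and>
     compact (closure {x. \<phi> x \<noteq> 0}) \<and> closure {x. \<phi> x \<noteq> 0} \<subseteq> \<Omega>"

definition locally_integrable ::
    "'a::euclidean_space set \<Rightarrow> ('a \<Rightarrow> 'b::euclidean_space) \<Rightarrow> bool" where
  "locally_integrable \<Omega> f \<longleftrightarrow> (\<forall>K. compact K \<and> K \<subseteq> \<Omega> \<longrightarrow> set_integrable lebesgue K f)"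

definition is_weak_partial ::
    "'a::euclidean_space set \<Rightarrow> 'a \<Rightarrow> ('a \<Rightarrow> 'b::euclidean_space) \<Rightarrow> ('a \<Rightarrow> 'b) \<Rightarrow> bool" where
  "is_weak_partial \<Omega> b f g \<longleftrightarrow> locally_integrable \<Omega> f \<and> locally_integrable \<Omega> g \<and>
     (\<forall>\<phi>. test_function \<Omega> \<phi> \<longrightarrow>
        (LINT x|lebesgue_on \<Omega>. partial_deriv b \<phi> x *\<^sub>R f x) =
        - (LINT x|lebesgue_on \<Omega>. \<phi> x *\<^sub>R g x))"

text \<open>The j-th column of the Jacobian is the partial derivative in direction \<open>axis j 1\<close>.\<close>

definition is_weak_jacobian ::
    "(real^'d) set \<Rightarrow> (real^'d \<Rightarrow> real^'k) \<Rightarrow> (real^'d \<Rightarrow> real^'d^'k) \<Rightarrow> bool" where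
  "is_weak_jacobian G u g \<longleftrightarrow> (\<forall>j. is_weak_partial G (axis j 1) u (\<lambda>x. \<chi> i. g x $ i $ j))"

text \<open>An arbitrary representative; the weak Jacobian is unique up to null sets.\<close>

definition weak_jacobian ::
    "(real^'d) set \<Rightarrow> (real^'d \<Rightarrow> real^'k) \<Rightarrow> real^'d \<Rightarrow> real^'d^'k" where
  "weak_jacobian G u = (SOME g. is_weak_jacobian G u g)"

text \<open>
  For a tensor-valued function on the matrix space, \<open>J D $ a $ b\<close> is the tensor of partial
  derivatives with respect to the matrix entry (a, b).
\<close>

definition is_weak_tensor_jacobian ::
    "(real^'d^'k \<Rightarrow> real^'d^'k^'d^'k) \<Rightarrow> (real^'d^'k \<Rightarrow> real^'d^'k^'d^'k^'d^'k) \<Rightarrow> bool" where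
  "is_weak_tensor_jacobian F J \<longleftrightarrow>
     (\<forall>a b. is_weak_partial UNIV (axis a (axis b 1)) F (\<lambda>D. J D $ a $ b))"


section \<open>Function spaces on the domain\<close>

text \<open>
  Elements of Lebesgue and Sobolev spaces are represented by functions, so that each space is a
  carrier set together with a seminorm whose kernel consists of the functions vanishing almost
  everywhere. The seminorms are meaningful on the respective carrier only.
\<close>

definition L2_space :: "'a::euclidean_space set \<Rightarrow> ('a \<Rightarrow> 'b::euclidean_space) set" where
  "L2_space G = {f. f \<in> borel_measurable (lebesgue_on G) \<and>
                    integrable (lebesgue_on G) (\<lambda>x. (norm (f x))\<^sup>2)}"

definition L2_norm :: "'a::euclidean_space set \<Rightarrow> ('a \<Rightarrow> 'b::euclidean_space) \<Rightarrow> real" where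
  "L2_norm G f = sqrt (LINT x|lebesgue_on G. (norm (f x))\<^sup>2)"

definition Linf_space :: "'a::euclidean_space set \<Rightarrow> ('a \<Rightarrow> 'b::euclidean_space) set" where
  "Linf_space G = {f. f \<in> borel_measurable (lebesgue_on G) \<and>
                      (\<exists>M. AE x in lebesgue_on G. norm (f x) \<le> M)}"

definition Linf_norm :: "'a::euclidean_space set \<Rightarrow> ('a \<Rightarrow> 'b::euclidean_space) \<Rightarrow> real" where
  "Linf_norm G f = real_of_ereal (esssup (lebesgue_on G) (\<lambda>x. ereal (norm (f x))))"

definition Linf_sym :: "(real^'d) set \<Rightarrow> (real^'d \<Rightarrow> real^'d^'k^'d^'k) set" where
  "Linf_sym G = {H \<in> Linf_space G. AE x in lebesgue_on G. H x \<in> sym_tensors}"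

definition H1_space :: "(real^'d) set \<Rightarrow> (real^'d \<Rightarrow> real^'k) set" where
  "H1_space G = {u \<in> L2_space G. \<exists>g\<in>L2_space G. is_weak_jacobian G u g}"

definition H1_norm :: "(real^'d) set \<Rightarrow> (real^'d \<Rightarrow> real^'k) \<Rightarrow> real" where
  "H1_norm G u = sqrt ((L2_norm G u)\<^sup>2 + (L2_norm G (weak_jacobian G u))\<^sup>2)"

definition space_H :: "(real^'d) set \<Rightarrow> (real^'d \<Rightarrow> real^'k) set" where
  "space_H G = {u \<in> L2_space G. (LINT x|lebesgue_on G. u x) = 0}"

definition space_V :: "(real^'d) set \<Rightarrow> (real^'d \<Rightarrow> real^'k) set" where
  "space_V G = H1_space G \<inter> space_H G"

text \<open>
  Functionals on V are total functions of which only the values on V matter; boundedness makes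
  them respect equality almost everywhere.
\<close>

definition dual_V :: "(real^'d) set \<Rightarrow> ((real^'d \<Rightarrow> real^'k) \<Rightarrow> real) set" where
  "dual_V G = {l.
     (\<forall>v\<in>space_V G. \<forall>w\<in>space_V G. l (\<lambda>x. v x + w x) = l v + l w) \<and>
     (\<forall>a. \<forall>v\<in>space_V G. l (\<lambda>x. a *\<^sub>R v x) = a * l v) \<and>
     (\<exists>M. \<forall>v\<in>space_V G. \<bar>l v\<bar> \<le> M * H1_norm G v)}"

definition dual_norm :: "(real^'d) set \<Rightarrow> ((real^'d \<Rightarrow> real^'k) \<Rightarrow> real) \<Rightarrow> real" where
  "dual_norm G l = Sup {\<bar>l v\<bar> | v. v \<in> space_V G \<and> H1_norm G v \<le> 1}"

text \<open>The embedding of H into the dual of V in the Gelfand triple.\<close>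

definition embed_H :: "(real^'d) set \<Rightarrow> (real^'d \<Rightarrow> real^'k) \<Rightarrow> (real^'d \<Rightarrow> real^'k) \<Rightarrow> real" where
  "embed_H G u v = (LINT x|lebesgue_on G. u x \<bullet> v x)"

definition op_A :: "(real^'d) set \<Rightarrow> (real^'d \<Rightarrow> real^'d^'k^'d^'k) \<Rightarrow>
    (real^'d \<Rightarrow> real^'k) \<Rightarrow> (real^'d \<Rightarrow> real^'k) \<Rightarrow> real" where
  "op_A G H u v =
     (LINT x|lebesgue_on G. tensor_app (H x) (weak_jacobian G u x) \<bullet> weak_jacobian G v x)"


section \<open>Bochner spaces\<close>

text \<open>
  All spaces above consist of functions, hence Bochner spaces over (0,T) are defined for a carrier
  \<open>X\<close> of functions with a seminorm \<open>N\<close>; the linear operations are pointwise.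
  The library's Bochner integral does not apply, as it requires a separable Banach space as a type.
\<close>

definition simple_curve ::
    "real \<Rightarrow> ('p \<Rightarrow> 'q::real_vector) set \<Rightarrow> (real \<Rightarrow> 'p \<Rightarrow> 'q) \<Rightarrow> bool" where
  "simple_curve T X s \<longleftrightarrow> simple_function (lebesgue_on {0<..<T}) s \<and> (\<forall>t\<in>{0<..<T}. s t \<in> X)"

definition strongly_measurable :: "real \<Rightarrow> ('p \<Rightarrow> 'q::real_vector) set \<Rightarrow>
    (('p \<Rightarrow> 'q) \<Rightarrow> real) \<Rightarrow> (real \<Rightarrow> 'p \<Rightarrow> 'q) \<Rightarrow> bool" where
  "strongly_measurable T X N f \<longleftrightarrow>
     (AE t in lebesgue_on {0<..<T}. f t \<in> X) \<and>
     (\<exists>s. (\<forall>n. simple_curve T X (s n)) \<and>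
          (AE t in lebesgue_on {0<..<T}. (\<lambda>n. N (\<lambda>p. f t p - s n t p)) \<longlonglongrightarrow> 0))"

definition bochner_L2 :: "real \<Rightarrow> ('p \<Rightarrow> 'q::real_vector) set \<Rightarrow>
    (('p \<Rightarrow> 'q) \<Rightarrow> real) \<Rightarrow> (real \<Rightarrow> 'p \<Rightarrow> 'q) set" where
  "bochner_L2 T X N = {f. strongly_measurable T X N f \<and>
     (\<integral>\<^sup>+t. ennreal ((N (f t))\<^sup>2) \<partial>lebesgue_on {0<..<T}) < \<infinity>}"

definition simple_curve_integral :: "real \<Rightarrow> (real \<Rightarrow> 'p \<Rightarrow> 'q::real_vector) \<Rightarrow> 'p \<Rightarrow> 'q" where
  "simple_curve_integral T s = (\<lambda>p. \<Sum>a\<in>s ` {0<..<T}.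
     measure lebesgue {t\<in>{0<..<T}. s t = a} *\<^sub>R a p)"

text \<open>\<open>y\<close> is (a representative of) the Bochner integral of \<open>f\<close> over (0,T).\<close>

definition is_bochner_integral :: "real \<Rightarrow> ('p \<Rightarrow> 'q::real_vector) set \<Rightarrow>
    (('p \<Rightarrow> 'q) \<Rightarrow> real) \<Rightarrow> (real \<Rightarrow> 'p \<Rightarrow> 'q) \<Rightarrow> ('p \<Rightarrow> 'q) \<Rightarrow> bool" where
  "is_bochner_integral T X N f y \<longleftrightarrow> strongly_measurable T X N f \<and> y \<in> X \<and>
     (\<exists>s. (\<forall>n. simple_curve T X (s n)) \<and>
          (\<lambda>n. \<integral>\<^sup>+t. ennreal (N (\<lambda>p. f t p - s n t p)) \<partial>lebesgue_on {0<..<T}) \<longlonglongrightarrow> 0 \<and>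
          (\<lambda>n. N (\<lambda>p. y p - simple_curve_integral T (s n) p))
            \<longlonglongrightarrow> 0)"

definition is_weak_time_deriv :: "real \<Rightarrow> ('p \<Rightarrow> 'q::real_vector) set \<Rightarrow>
    (('p \<Rightarrow> 'q) \<Rightarrow> real) \<Rightarrow> (real \<Rightarrow> 'p \<Rightarrow> 'q) \<Rightarrow> (real \<Rightarrow> 'p \<Rightarrow> 'q) \<Rightarrow> bool" where
  "is_weak_time_deriv T X N f f' \<longleftrightarrow>
     (\<forall>\<phi>. test_function {0<..<T} \<phi> \<longrightarrow>
        (\<exists>y. is_bochner_integral T X N (\<lambda>t p. deriv \<phi> t *\<^sub>R f t p) y \<and>
             is_bochner_integral T X N (\<lambda>t p. - (\<phi> t *\<^sub>R f' t p)) y))"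

text \<open>\<open>f\<close> lies in the Bochner-Sobolev space of order one, with weak derivative \<open>f'\<close>.\<close>

definition bochner_H1 :: "real \<Rightarrow> ('p \<Rightarrow> 'q::real_vector) set \<Rightarrow>
    (('p \<Rightarrow> 'q) \<Rightarrow> real) \<Rightarrow> (real \<Rightarrow> 'p \<Rightarrow> 'q) \<Rightarrow> (real \<Rightarrow> 'p \<Rightarrow> 'q) \<Rightarrow> bool" where
  "bochner_H1 T X N f f' \<longleftrightarrow>
     f \<in> bochner_L2 T X N \<and> f' \<in> bochner_L2 T X N \<and> is_weak_time_deriv T X N f f'"

definition continuous_curve :: "real \<Rightarrow> ('p \<Rightarrow> 'q::real_vector) set \<Rightarrow>
    (('p \<Rightarrow> 'q) \<Rightarrow> real) \<Rightarrow> (real \<Rightarrow> 'p \<Rightarrow> 'q) \<Rightarrow> bool" where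
  "continuous_curve T X N f \<longleftrightarrow>
     (\<forall>t\<in>{0..T}. f t \<in> X \<and>
        ((\<lambda>s. N (\<lambda>p. f s p - f t p)) \<longlongrightarrow> 0) (at t within {0..T}))"


section \<open>Weak solutions\<close>

text \<open>
  The two continuity clauses do not restrict the solutions: they fix \<open>u\<close> and \<open>H\<close>
  to be the continuous representatives (with values in H and in the space of essentially bounded
  symmetric tensor fields), through which values at a single time are understood.
\<close>

definition weak_solution ::
    "(real^'d) set \<Rightarrow> (real^'d^'k \<Rightarrow> real^'d^'k^'d^'k) \<Rightarrow> real \<Rightarrow> real \<Rightarrow>
     (real^'d \<Rightarrow> real^'k) \<Rightarrow> (real^'d \<Rightarrow> real^'d^'k^'d^'k) \<Rightarrow>
     (real \<Rightarrow> real^'d \<Rightarrow> real^'k) \<Rightarrow> (real \<Rightarrow> real^'d \<Rightarrow> real^'d^'k^'d^'k) \<Rightarrow> bool" where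
  "weak_solution G F \<tau> T u\<^sub>0 H\<^sub>0 u H \<longleftrightarrow>
     (\<exists>\<kappa>>0. AE t in lebesgue_on {0<..<T}. AE x in lebesgue_on G. H t x \<in> sym_tensors_ge \<kappa>) \<and>
     u \<in> bochner_L2 T (space_V G) (H1_norm G) \<and>
     (\<exists>u'. bochner_H1 T (dual_V G) (dual_norm G) (\<lambda>t. embed_H G (u t)) u' \<and>
        (AE t in lebesgue_on {0<..<T}. \<forall>v\<in>space_V G. u' t v + op_A G (H t) (u t) v = 0)) \<and>
     (\<exists>H'. bochner_H1 T (Linf_sym G) (Linf_norm G) H H' \<and>
        (AE t in lebesgue_on {0<..<T}. AE x in lebesgue_on G.
           \<tau> *\<^sub>R H' t x + H t x - F (weak_jacobian G (u t) x) = 0)) \<and>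
     continuous_curve T (space_H G) (L2_norm G) u \<and>
     continuous_curve T (Linf_sym G) (Linf_norm G) H \<and>
     (AE x in lebesgue_on G. u 0 x = u\<^sub>0 x) \<and>
     (AE x in lebesgue_on G. H 0 x = H\<^sub>0 x)"

text \<open>\<open>g\<close> is the jointly measurable representative; the chosen Jacobians need not be jointly measurable.\<close>

definition bounded_gradient ::
    "(real^'d) set \<Rightarrow> real \<Rightarrow> (real \<Rightarrow> real^'d \<Rightarrow> real^'k) \<Rightarrow> bool" where
  "bounded_gradient G T u \<longleftrightarrow>
     (\<exists>g. g \<in> Linf_space ({0<..<T} \<times> G) \<and>
        (AE t in lebesgue_on {0<..<T}. AE x in lebesgue_on G. g (t, x) = weak_jacobian G (u t) x))"

end

theory Submission
  imports Defs
begin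

text \<open>
  Write \<open>w\<close> and \<open>K\<close> for the differences of the two solutions. Testing the difference of the
  parabolic equations with \<open>w\<close> and the difference of the relaxation equations with \<open>K\<close>, the
  bounded gradient of the second solution lets one estimate the flux difference pointwise by
  \<open>- \<kappa> |Dw|\<^sup>2 + C |K| |Dw| \<le> C\<^sup>2 / (4 \<kappa>) |K|\<^sup>2\<close>, so that Gronwall's lemma
  applies to \<open>\<parallel>w\<parallel>\<^sup>2 + \<parallel>K\<parallel>\<^sup>2\<close>.

  Only the inequality \<open>\<parallel>z t\<parallel>\<^sup>2 - \<parallel>z 0\<parallel>\<^sup>2 \<le> 2 \<integral> \<langle>z', z\<rangle>\<close> is needed
  from the chain rule in the Gelfand triple. It is obtained by integrating
  \<open>\<parallel>z r\<parallel>\<^sup>2 - \<parallel>z (r - h)\<parallel>\<^sup>2 \<le> 2 \<langle>z r - z (r - h), z r\<rangle>\<close> over time, dividing by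
  \<open>h\<close> and letting \<open>h\<close> tend to zero: Lebesgue's differentiation theorem, applied to a countable
  dense family of test vectors, identifies the limit of the right-hand side, and since the gradients
  are bounded the convergence is dominated by a constant.
\<close>

section \<open>Smooth cutoff functions\<close>

text \<open>Two features of the encoding shape the proof. \<open>weak_jacobian\<close> is a choice
  made separately for every function, so even its linearity holds only off null sets and rests on
  the uniqueness of weak derivatives. Bochner spaces are carriers of functions with a seminorm, so
  integrals with values in them are not manipulated directly: each statement is tested with a
  bounded functional, and a weak time derivative becomes an integral identity between real
  functions, one for each test vector. Smooth cutoffs serve both purposes. The price is a null set
  of times that depends on the test vector, whereas the energy inequality evaluates the derivative
  at the moving vector \<open>z r\<close>; countability of the family of test vectors reconciles the
  two.

  The flux difference is split as \<open>H\<^sub>1 Dw + K Du\<^sub>2\<close>. Thus \<kappa> is the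
  coercivity constant of the first solution, and C adds the gradient bound of the second, times a
  bound for \<open>tensor_app\<close>, to the Lipschitz constant of \<open>F\<close> over \<tau>,
  which enters through the relaxation equation.\<close>

lemma tcd_Suc_D:
  fixes f :: "'a::euclidean_space \<Rightarrow> real"
  shows "times_continuously_diff (Suc n) f \<Longrightarrow> times_continuously_diff n f"
proof (induction n arbitrary: f)
  case 0
  then show ?case by (auto intro: differentiable_imp_continuous_on)
qed simp

lemma tcd_continuous:
  fixes f :: "'a::euclidean_space \<Rightarrow> real"
  shows "times_continuously_diff n f \<Longrightarrow> continuous_on UNIV f"
  by (induction n) (auto intro: differentiable_imp_continuous_on)

lemma differentiable_on_UNIV_at:
  "f differentiable_on UNIV \<longleftrightarrow> (\<forall>x. f differentiable at x)"
  by (simp add: differentiable_on_def)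

lemma partial_deriv_eqI:
  assumes "\<And>x. (f has_derivative D x) (at x)"
  shows "partial_deriv b f = (\<lambda>x. D x b)"
  using frechet_derivative_at[OF assms] by (simp add: partial_deriv_def fun_eq_iff)

lemma tcd_const: "times_continuously_diff n (\<lambda>x::'a::euclidean_space. c)"
proof (induction n arbitrary: c)
  case (Suc n)
  have "partial_deriv b (\<lambda>x::'a. c) = (\<lambda>x. 0)" for b :: 'a
    by (rule partial_deriv_eqI) auto
  with Suc show ?case by (simp add: differentiable_on_def)
qed simp

lemma tcd_add:
  fixes f g :: "'a::euclidean_space \<Rightarrow> real"
  shows "times_continuously_diff n f \<Longrightarrow> times_continuously_diff n g \<Longrightarrow>
    times_continuously_diff n (\<lambda>x. f x + g x)"
proof (induction n arbitrary: f g)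
  case (Suc n)
  have d: "f differentiable at x" "g differentiable at x" for x
    using Suc.prems by (auto simp: differentiable_on_UNIV_at)
  have "partial_deriv b (\<lambda>x. f x + g x) = (\<lambda>x. partial_deriv b f x + partial_deriv b g x)" for b
    using partial_deriv_eqI[OF has_derivative_add, OF d[unfolded frechet_derivative_works]]
    by (simp add: partial_deriv_def)
  with Suc show ?case by (auto intro!: differentiable_on_add)
qed (auto intro: continuous_on_add)

text \<open>The product rule keeps an undifferentiated factor in each summand, and the induction
  hypothesis asks for it one order lower; \<open>tcd_Suc_D\<close> supplies that.\<close>

lemma tcd_mult:
  fixes f g :: "'a::euclidean_space \<Rightarrow> real"
  shows "times_continuously_diff n f \<Longrightarrow> times_continuously_diff n g \<Longrightarrow>
    times_continuously_diff n (\<lambda>x. f x * g x)"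
proof (induction n arbitrary: f g)
  case (Suc n)
  have d: "f differentiable at x" "g differentiable at x" for x
    using Suc.prems by (auto simp: differentiable_on_UNIV_at)
  have "partial_deriv b (\<lambda>x. f x * g x) =
      (\<lambda>x. f x * partial_deriv b g x + partial_deriv b f x * g x)" for b
    using partial_deriv_eqI[OF has_derivative_mult, OF d[unfolded frechet_derivative_works]]
    by (simp add: partial_deriv_def)
  moreover have "times_continuously_diff n f" "times_continuously_diff n g"
    using Suc.prems tcd_Suc_D by blast+
  ultimately show ?case using Suc by (auto intro!: differentiable_on_mult tcd_add)
qed (auto intro: continuous_on_mult)

lemma tcd_prod:
  fixes f :: "'i \<Rightarrow> 'a::euclidean_space \<Rightarrow> real"
  assumes "\<And>i. i \<in> I \<Longrightarrow> times_continuously_diff n (f i)"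
  shows "times_continuously_diff n (\<lambda>x. \<Prod>i\<in>I. f i x)"
  using assms by (induction I rule: infinite_finite_induct) (auto intro!: tcd_const tcd_mult)

lemma tcd_Suc_realI:
  fixes f f' :: "real \<Rightarrow> real"
  assumes "\<And>x. (f has_real_derivative f' x) (at x)" "times_continuously_diff n f'"
  shows "times_continuously_diff (Suc n) f"
proof -
  have "partial_deriv 1 f = f'"
    using partial_deriv_eqI[OF assms(1)[unfolded has_field_derivative_def]] by simp
  moreover have "f differentiable_on UNIV"
    using assms(1) by (auto simp: differentiable_on_def real_differentiable_def)
  ultimately show ?thesis using assms(2) by simp
qed

text \<open>The derivative in direction \<open>e\<close> is the constant
  \<open>b \<bullet> e\<close> times the same kind of composition with
  \<open>partial_deriv 1 h\<close>, so the induction closes with \<open>h\<close> arbitrary. It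
  lifts one-dimensional steps to functions of a single coordinate.\<close>

lemma tcd_compose_affine:
  fixes h :: "real \<Rightarrow> real" and b :: "'a::euclidean_space"
  shows "times_continuously_diff n h \<Longrightarrow> times_continuously_diff n (\<lambda>x. h (b \<bullet> x + c))"
proof (induction n arbitrary: h)
  case 0
  then show ?case
    by (auto intro!: continuous_on_compose2[of UNIV h] continuous_intros)
next
  case (Suc n)
  have h: "(h has_derivative (\<lambda>t. t * partial_deriv 1 h x)) (at x)" for x
  proof -
    have "h differentiable at x" using Suc.prems by (simp add: differentiable_on_UNIV_at)
    then obtain D where D: "(h has_real_derivative D) (at x)"
      by (auto simp: real_differentiable_def)
    have "partial_deriv 1 h x = D"
      using frechet_derivative_at[OF D[unfolded has_field_derivative_def]]
      by (metis mult.right_neutral partial_deriv_def)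
    moreover have "(\<lambda>t. t * D) = (*) D" by (simp add: fun_eq_iff)
    ultimately show ?thesis using D by (simp add: has_field_derivative_def)
  qed
  have der: "((\<lambda>x. h (b \<bullet> x + c)) has_derivative
      (\<lambda>y. (b \<bullet> y) * partial_deriv 1 h (b \<bullet> x + c))) (at x)" for x
    by (rule has_derivative_compose[of "\<lambda>x. b \<bullet> x + c" "\<lambda>y. b \<bullet> y", OF _ h])
       (auto intro!: derivative_eq_intros)
  have "times_continuously_diff n (\<lambda>x::'a. (b \<bullet> e) * partial_deriv 1 h (b \<bullet> x + c))" for e
    using Suc by (intro tcd_mult tcd_const) auto
  moreover have "(\<lambda>x. h (b \<bullet> x + c)) differentiable_on UNIV"
    using der by (auto simp: differentiable_on_def differentiable_def)
  ultimately show ?case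
    by (simp add: partial_deriv_eqI[OF der])
qed

section \<open>A flat exponential, and the smooth step obtained from it\<close>

lemma poly_times_exp_neg_tendsto_0: "((\<lambda>y. poly p y * exp (- y)) \<longlongrightarrow> (0::real)) at_top"
proof -
  have "((\<lambda>y. \<Sum>i\<le>degree p. coeff p i * (y ^ i / exp y)) \<longlongrightarrow> (\<Sum>i\<le>degree p. coeff p i * 0)) at_top"
    by (intro tendsto_intros tendsto_power_div_exp_0)
  then show ?thesis
    by (simp add: poly_altdef sum_distrib_right exp_minus divide_inverse mult.assoc)
qed

text \<open>The polynomial factor makes this family closed under differentiation.\<close>

definition flat_exp :: "real poly \<Rightarrow> real \<Rightarrow> real" where
  "flat_exp p t = (if t > 0 then poly p (1 / t) * exp (- (1 / t)) else 0)"

text \<open>For t > 0 and s = 1/t, the derivative of p(s) exp(-s) in t is s^2 (p(s) - p'(s))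
  exp(-s); the polynomial \<open>[:0, 0, 1:]\<close> is this square.\<close>

lemma flat_exp_has_derivative:
  "(flat_exp p has_real_derivative flat_exp ([:0, 0, 1:] * (p - pderiv p)) t) (at t)"
proof -
  consider "t > 0" | "t < 0" | "t = 0" by linarith
  then show ?thesis
  proof cases
    case 1
    have "((\<lambda>t. poly p (1 / t) * exp (- (1 / t))) has_real_derivative
        flat_exp ([:0, 0, 1:] * (p - pderiv p)) t) (at t)"
      using 1 unfolding flat_exp_def
      by (auto intro!: derivative_eq_intros poly_DERIV[THEN DERIV_chain2]
          simp: field_simps power2_eq_square)
    then show ?thesis
      by (rule has_field_derivative_transform_within_open[of _ _ _ "{0<..}"])
         (use 1 in \<open>auto simp: flat_exp_def\<close>)
  next
    case 2
    have "((\<lambda>t. 0) has_real_derivative 0) (at t)" by simp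
    then have "(flat_exp p has_real_derivative 0) (at t)"
      by (rule has_field_derivative_transform_within_open[of _ _ _ "{..<0}"])
         (use 2 in \<open>auto simp: flat_exp_def\<close>)
    with 2 show ?thesis by (simp add: flat_exp_def)
  next
    case 3
    \<comment> \<open>The difference quotient at 0 divides by y, that is, multiplies the polynomial
      by its variable, which gives \<open>pCons 0 p\<close> at 1/y. The exponential decay still
      wins.\<close>
    have "((\<lambda>y. poly (pCons 0 p) (1 / y) * exp (- (1 / y))) \<longlongrightarrow> 0) (at_right 0)"
      using filterlim_compose[OF poly_times_exp_neg_tendsto_0 filterlim_inverse_at_top_right,
          of "pCons 0 p"]
      by (simp add: inverse_eq_divide)
    then have "((\<lambda>y. (flat_exp p y - flat_exp p 0) / (y - 0)) \<longlongrightarrow> 0) (at_right 0)"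
      by (rule Lim_transform_eventually)
         (auto simp: flat_exp_def eventually_at_right_field intro!: exI[of _ 1])
    moreover have "((\<lambda>y. (flat_exp p y - flat_exp p 0) / (y - 0)) \<longlongrightarrow> 0) (at_left 0)"
      by (rule Lim_transform_eventually[OF tendsto_const])
         (auto simp: flat_exp_def eventually_at_left_field intro!: exI[of _ "-1"])
    ultimately have "(flat_exp p has_real_derivative 0) (at 0)"
      by (simp add: has_field_derivative_iff filterlim_at_split)
    with 3 show ?thesis by (simp add: flat_exp_def)
  qed
qed

lemma tcd_flat_exp: "times_continuously_diff n (flat_exp p)"
proof (induction n arbitrary: p)
  case 0
  show ?case
    using DERIV_isCont[OF flat_exp_has_derivative] by (auto simp: continuous_on_eq_continuous_at)
next
  case (Suc n)
  show ?case by (rule tcd_Suc_realI[OF flat_exp_has_derivative Suc])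
qed

text \<open>The classical bump exp(-1/t - 1/(1-t)) on the open unit interval, extended by zero;
  \<open>1\<close> is the constant polynomial.\<close>

definition bump :: "real \<Rightarrow> real" where
  "bump t = flat_exp 1 t * flat_exp 1 (1 - t)"

lemma tcd_bump: "times_continuously_diff n bump"
proof -
  have "times_continuously_diff n (\<lambda>t::real. flat_exp 1 (-1 \<bullet> t + 1))"
    by (rule tcd_compose_affine[OF tcd_flat_exp])
  then show ?thesis
    unfolding bump_def[abs_def] by (intro tcd_mult tcd_flat_exp) (simp add: add.commute)
qed

lemma bump_nonneg: "0 \<le> bump t" by (simp add: bump_def flat_exp_def)

lemma bump_eq_0: "t \<le> 0 \<or> 1 \<le> t \<Longrightarrow> bump t = 0" by (auto simp: bump_def flat_exp_def)

lemma continuous_bump: "continuous_on S bump"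
  using tcd_continuous[OF tcd_bump] continuous_on_subset by blast

lemma bump_integrable: "bump integrable_on {a..b}"
  by (rule integrable_continuous_real[OF continuous_bump])

lemma bump_integral_pos: "0 < integral {0..1} bump"
proof -
  have "integral {0..1} bump \<noteq> 0"
  proof
    assume "integral {0..1} bump = 0"
    then have "\<forall>x\<in>cbox 0 1. bump x = 0"
      using integral_cbox_eq_0_iff[OF continuous_bump, of 0 1] by (simp add: bump_nonneg)
    then have "bump (1/2) = 0" by simp
    then show False by (simp add: bump_def flat_exp_def)
  qed
  then show ?thesis
    using integral_nonneg[OF bump_integrable] bump_nonneg by (simp add: order_less_le)
qed

text \<open>The normalised primitive of \<open>bump\<close>, rising from 0 to 1 on the unit
  interval; for negative t the interval is empty and the integral 0. The rise lies to the right of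
  0, so rescaled steps vanish wherever their argument is not positive.\<close>

definition smooth_step :: "real \<Rightarrow> real" where
  "smooth_step t = integral {0..t} bump / integral {0..1} bump"

definition mollifier :: "real \<Rightarrow> real" where
  "mollifier t = bump t / integral {0..1} bump"

lemma mollifier_nonneg: "0 \<le> mollifier t"
  using bump_nonneg bump_integral_pos by (simp add: mollifier_def)

lemma mollifier_eq_0: "t \<le> 0 \<or> 1 \<le> t \<Longrightarrow> mollifier t = 0"
  by (auto simp: mollifier_def bump_eq_0)

lemma tcd_mollifier: "times_continuously_diff n mollifier"
  unfolding mollifier_def[abs_def] divide_inverse by (intro tcd_mult tcd_bump tcd_const)

lemma continuous_mollifier: "continuous_on S mollifier"
  using tcd_continuous[OF tcd_mollifier] continuous_on_subset by blast

lemma mollifier_has_integral: "(mollifier has_integral 1) {0..1}"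
  using has_integral_divide[OF integrable_integral[OF bump_integrable[of 0 1]], of "integral {0..1} bump"]
    bump_integral_pos by (simp add: mollifier_def[abs_def])

lemma smooth_step_eq_0: "t \<le> 0 \<Longrightarrow> smooth_step t = 0"
  by (cases "t = 0") (auto simp: smooth_step_def)

lemma smooth_step_eq_1:
  assumes "1 \<le> t" shows "smooth_step t = 1"
proof -
  have "integral {1..t} bump = integral {1..t} (\<lambda>_. 0)"
    by (rule integral_cong) (auto simp: bump_eq_0)
  then have "integral {0..t} bump = integral {0..1} bump"
    using Henstock_Kurzweil_Integration.integral_combine[OF _ assms bump_integrable, of 0] by simp
  with bump_integral_pos show ?thesis by (simp add: smooth_step_def)
qed

lemma smooth_step_has_derivative: "(smooth_step has_real_derivative mollifier t) (at t)"
proof (cases "t < 0")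
  case True
  have "((\<lambda>_. 0) has_real_derivative mollifier t) (at t)"
    using True by (simp add: mollifier_eq_0)
  then show ?thesis
    by (rule has_field_derivative_transform_within_open[of _ _ _ "{..<0}"])
       (use True in \<open>auto simp: smooth_step_eq_0\<close>)
next
  case False
  \<comment> \<open>The fundamental theorem is applied at an interior point, which t = 0 would not
    be for the left end 0. As \<open>bump\<close> vanishes below 0, the left end may be moved to
    -1.\<close>
  define a b :: real where "a = -1" and "b = t + 1"
  have eq: "integral {0..u} bump = integral {a..u} bump" if "u \<in> {a<..<b}" for u
  proof (cases "u \<ge> 0")
    case True
    have "integral {a..0} bump = integral {a..0} (\<lambda>_. 0)"
      by (rule integral_cong) (auto simp: bump_eq_0)
    then show ?thesis
      using Henstock_Kurzweil_Integration.integral_combine[OF _ True bump_integrable, of a]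
      by (simp add: a_def)
  next
    case u: False
    have "integral {a..u} bump = integral {a..u} (\<lambda>_. 0)"
      by (rule integral_cong) (use u in \<open>auto simp: bump_eq_0\<close>)
    with u show ?thesis by simp
  qed
  have "((\<lambda>u. integral {a..u} bump) has_real_derivative bump t) (at t within {a..b})"
    using False by (intro integral_has_real_derivative[OF continuous_bump]) (auto simp: a_def b_def)
  moreover have "at t within {a..b} = at t"
    using False by (intro at_within_interior) (auto simp: a_def b_def)
  ultimately have "((\<lambda>u. integral {a..u} bump / integral {0..1} bump) has_real_derivative
      bump t / integral {0..1} bump) (at t)"
    by (intro DERIV_cdivide) auto
  then have "((\<lambda>u. integral {a..u} bump / integral {0..1} bump) has_real_derivative mollifier t) (at t)"
    by (simp add: mollifier_def)
  then show ?thesis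
    by (rule has_field_derivative_transform_within_open[of _ _ _ "{a<..<b}"])
       (use False eq in \<open>auto simp: smooth_step_def a_def b_def\<close>)
qed

lemma tcd_smooth_step: "times_continuously_diff n smooth_step"
  by (rule tcd_Suc_D, rule tcd_Suc_realI[OF smooth_step_has_derivative tcd_mollifier])

lemma smooth_step_mono: "s \<le> t \<Longrightarrow> smooth_step s \<le> smooth_step t"
  by (rule DERIV_nonneg_imp_nondecreasing) (use smooth_step_has_derivative mollifier_nonneg in blast)+

lemma smooth_step_bounds: "0 \<le> smooth_step t" "smooth_step t \<le> 1"
  using smooth_step_mono[of "min t 0" t] smooth_step_mono[of t "max t 1"]
  by (auto simp: smooth_step_eq_0 smooth_step_eq_1 min_def max_def split: if_splits)

lemma smooth_step_scaled_tendsto: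
  "(\<lambda>n. smooth_step (real n * t)) \<longlonglongrightarrow> (if t > 0 then 1 else 0)"
proof (cases "t > 0")
  case True
  obtain N :: nat where N: "1 / t \<le> real N" using real_arch_simple by blast
  have "eventually (\<lambda>n. smooth_step (real n * t) = 1) sequentially"
  proof (rule eventually_sequentiallyI[of N])
    fix n assume "N \<le> n"
    then have "1 / t \<le> real n" using N by linarith
    with True show "smooth_step (real n * t) = 1" by (intro smooth_step_eq_1) (simp add: field_simps)
  qed
  with True show ?thesis by (simp add: tendsto_eventually)
next
  case False
  then show ?thesis by (simp add: smooth_step_eq_0 mult_nonneg_nonpos)
qed

section \<open>Uniqueness of weak derivatives\<close>

lemma integrable_cutoff:
  fixes f :: "'a::euclidean_space \<Rightarrow> 'b::euclidean_space"
  assumes "set_integrable lebesgue K f" "compact K" "continuous_on UNIV \<psi>"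
    and "\<And>x. x \<notin> K \<Longrightarrow> \<psi> x = 0"
  shows "integrable lebesgue (\<lambda>x. \<psi> x *\<^sub>R f x)"
proof -
  have "compact (\<psi> ` K)"
    using assms by (meson compact_continuous_image continuous_on_subset subset_UNIV)
  then obtain B where B: "\<And>x. x \<in> K \<Longrightarrow> norm (\<psi> x) \<le> B"
    using compact_imp_bounded bounded_iff by (metis imageI)
  have f: "integrable lebesgue (\<lambda>x. indicator K x *\<^sub>R f x)"
    using assms(1) by (simp add: set_integrable_def)
  have eq: "\<psi> x *\<^sub>R f x = \<psi> x *\<^sub>R (indicator K x *\<^sub>R f x)" for x
    using assms(4) by (auto simp: indicator_def)
  have "integrable lebesgue (\<lambda>x. \<psi> x *\<^sub>R (indicator K x *\<^sub>R f x))"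
  proof (rule Bochner_Integration.integrable_bound)
    show "integrable lebesgue (\<lambda>x. B * norm (indicator K x *\<^sub>R f x))"
      using f by (intro integrable_mult_right integrable_norm)
    have "\<psi> \<in> borel_measurable lebesgue"
      using borel_measurable_continuous_onI[OF assms(3)] by (simp add: measurable_completion)
    then show "(\<lambda>x. \<psi> x *\<^sub>R (indicator K x *\<^sub>R f x)) \<in> borel_measurable lebesgue"
      using borel_measurable_integrable[OF f] by (rule borel_measurable_scaleR)
    show "AE x in lebesgue. norm (\<psi> x *\<^sub>R (indicator K x *\<^sub>R f x))
        \<le> norm (B * norm (indicator K x *\<^sub>R f x))"
    proof (rule AE_I2)
      fix x
      show "norm (\<psi> x *\<^sub>R (indicator K x *\<^sub>R f x)) \<le> norm (B * norm (indicator K x *\<^sub>R f x))"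
      proof (cases "x \<in> K")
        case True
        then show ?thesis using B[OF True] by (auto intro!: mult_right_mono)
      qed simp
    qed
  qed
  then show ?thesis by (simp only: eq[symmetric])
qed

lemma integral_lebesgue_on_vanishing:
  fixes f :: "'a::euclidean_space \<Rightarrow> 'b::euclidean_space"
  assumes "\<Omega> \<in> sets lebesgue" "\<And>x. x \<notin> \<Omega> \<Longrightarrow> f x = 0"
  shows "(LINT x|lebesgue_on \<Omega>. f x) = (LINT x|lebesgue. f x)"
    and "integrable (lebesgue_on \<Omega>) f \<longleftrightarrow> integrable lebesgue f"
proof -
  have eq: "indicator \<Omega> x *\<^sub>R f x = f x" for x
    using assms(2) by (auto simp: indicator_def)
  show "(LINT x|lebesgue_on \<Omega>. f x) = (LINT x|lebesgue. f x)"
    using assms(1) by (simp add: integral_restrict_space eq)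
  show "integrable (lebesgue_on \<Omega>) f \<longleftrightarrow> integrable lebesgue f"
    using assms(1) by (simp add: integrable_restrict_space eq)
qed

lemma partial_deriv_eq_0:
  assumes "x \<notin> closure {x. \<phi> x \<noteq> 0}"
  shows "partial_deriv b \<phi> x = 0"
proof -
  have "((\<lambda>_. 0) has_derivative (\<lambda>_. 0)) (at x)" by simp
  then have "(\<phi> has_derivative (\<lambda>_. 0)) (at x)"
    by (rule has_derivative_transform_within_open[of _ _ _ _ "- closure {x. \<phi> x \<noteq> 0}"])
       (use assms closure_subset[of "{x. \<phi> x \<noteq> 0}"] in auto)
  from frechet_derivative_at[OF this, symmetric] show ?thesis
    by (simp add: partial_deriv_def)
qed

text \<open>Local integrability speaks of compact subsets. The closed support of \<phi> is one, and
  the partial derivatives of \<phi> vanish outside it as well, since \<phi> is locally zero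
  there.\<close>

lemma test_function_integrable:
  fixes f :: "'a::euclidean_space \<Rightarrow> 'b::euclidean_space"
  assumes "test_function \<Omega> \<phi>" "locally_integrable \<Omega> f" "\<Omega> \<in> sets lebesgue"
  shows "integrable (lebesgue_on \<Omega>) (\<lambda>x. \<phi> x *\<^sub>R f x)"
    and "b \<in> Basis \<Longrightarrow> integrable (lebesgue_on \<Omega>) (\<lambda>x. partial_deriv b \<phi> x *\<^sub>R f x)"
proof -
  obtain K where K: "compact K" "K \<subseteq> \<Omega>"
    and z: "\<And>x. x \<notin> K \<Longrightarrow> \<phi> x = 0" "\<And>x. x \<notin> K \<Longrightarrow> partial_deriv b \<phi> x = 0"
  proof
    show "compact (closure {x. \<phi> x \<noteq> 0})" "closure {x. \<phi> x \<noteq> 0} \<subseteq> \<Omega>"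
      using assms(1) by (auto simp: test_function_def)
    show "\<phi> x = 0" if "x \<notin> closure {x. \<phi> x \<noteq> 0}" for x
      using that closure_subset[of "{x. \<phi> x \<noteq> 0}"] by blast
  qed (rule partial_deriv_eq_0)
  have tcd: "\<And>n. times_continuously_diff n \<phi>"
    using assms(1) by (auto simp: test_function_def)
  have f: "set_integrable lebesgue K f"
    using assms(2) K by (simp add: locally_integrable_def)
  have z': "\<phi> x *\<^sub>R f x = 0" "partial_deriv b \<phi> x *\<^sub>R f x = 0" if "x \<notin> \<Omega>" for x
    using that K(2) z by auto
  show "integrable (lebesgue_on \<Omega>) (\<lambda>x. \<phi> x *\<^sub>R f x)"
    using integral_lebesgue_on_vanishing(2)[OF assms(3), of "\<lambda>x. \<phi> x *\<^sub>R f x"]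
      integrable_cutoff[OF f K(1) tcd_continuous[OF tcd]] z z' by simp
  assume "b \<in> Basis"
  then have "continuous_on UNIV (partial_deriv b \<phi>)"
    using tcd[of "Suc 0"] by simp
  then show "integrable (lebesgue_on \<Omega>) (\<lambda>x. partial_deriv b \<phi> x *\<^sub>R f x)"
    using integral_lebesgue_on_vanishing(2)[OF assms(3), of "\<lambda>x. partial_deriv b \<phi> x *\<^sub>R f x"]
      integrable_cutoff[OF f K(1)] z z' by simp
qed

lemma locally_integrable_linear:
  assumes "locally_integrable \<Omega> f" "locally_integrable \<Omega> g"
  shows "locally_integrable \<Omega> (\<lambda>x. c *\<^sub>R f x + d *\<^sub>R g x)"
  using assms unfolding locally_integrable_def
  by (intro allI impI set_integral_add(1) set_integrable_scaleR_right) auto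

lemma is_weak_partial_linear:
  assumes "is_weak_partial \<Omega> b f g" "is_weak_partial \<Omega> b f' g'" "b \<in> Basis" "\<Omega> \<in> sets lebesgue"
  shows "is_weak_partial \<Omega> b (\<lambda>x. c *\<^sub>R f x + d *\<^sub>R f' x) (\<lambda>x. c *\<^sub>R g x + d *\<^sub>R g' x)"
proof -
  have li: "locally_integrable \<Omega> f" "locally_integrable \<Omega> g" "locally_integrable \<Omega> f'" "locally_integrable \<Omega> g'"
    using assms by (auto simp: is_weak_partial_def)
  have "(LINT x|lebesgue_on \<Omega>. partial_deriv b \<phi> x *\<^sub>R (c *\<^sub>R f x + d *\<^sub>R f' x)) =
      - (LINT x|lebesgue_on \<Omega>. \<phi> x *\<^sub>R (c *\<^sub>R g x + d *\<^sub>R g' x))" if t: "test_function \<Omega> \<phi>" for \<phi>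
  proof -
    note i = test_function_integrable[OF t _ assms(4)]
    have "(LINT x|lebesgue_on \<Omega>. partial_deriv b \<phi> x *\<^sub>R (c *\<^sub>R f x + d *\<^sub>R f' x)) =
        (LINT x|lebesgue_on \<Omega>. c *\<^sub>R (partial_deriv b \<phi> x *\<^sub>R f x) + d *\<^sub>R (partial_deriv b \<phi> x *\<^sub>R f' x))"
      by (simp add: algebra_simps)
    also have "\<dots> = c *\<^sub>R (LINT x|lebesgue_on \<Omega>. partial_deriv b \<phi> x *\<^sub>R f x) +
        d *\<^sub>R (LINT x|lebesgue_on \<Omega>. partial_deriv b \<phi> x *\<^sub>R f' x)"
      using i(2)[OF li(1) assms(3)] i(2)[OF li(3) assms(3)]
      by (simp del: scaleR_scaleR)
    also have "\<dots> = - (c *\<^sub>R (LINT x|lebesgue_on \<Omega>. \<phi> x *\<^sub>R g x) + d *\<^sub>R (LINT x|lebesgue_on \<Omega>. \<phi> x *\<^sub>R g' x))"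
      using assms(1,2) t by (simp add: is_weak_partial_def)
    also have "\<dots> = - (LINT x|lebesgue_on \<Omega>. c *\<^sub>R (\<phi> x *\<^sub>R g x) + d *\<^sub>R (\<phi> x *\<^sub>R g' x))"
      using i(1)[OF li(2)] i(1)[OF li(4)] by (simp del: scaleR_scaleR)
    finally show ?thesis by (simp add: algebra_simps)
  qed
  with li show ?thesis
    by (simp add: is_weak_partial_def locally_integrable_linear)
qed

text \<open>One pair of steps per coordinate, each completing its rise within distance 1/n of a
  face. The product lies between 0 and the indicator of the open box and tends to that indicator,
  which is what dominated convergence asks for.\<close>

definition box_cutoff :: "'a::euclidean_space \<Rightarrow> 'a \<Rightarrow> nat \<Rightarrow> 'a \<Rightarrow> real" where
  "box_cutoff a b n x =
     (\<Prod>i\<in>Basis. smooth_step (real n * (x \<bullet> i - a \<bullet> i)) * smooth_step (real n * (b \<bullet> i - x \<bullet> i)))"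

lemma box_cutoff_eq_0: "x \<notin> box a b \<Longrightarrow> box_cutoff a b n x = 0"
proof -
  assume "x \<notin> box a b"
  then obtain i where "i \<in> Basis" "x \<bullet> i - a \<bullet> i \<le> 0 \<or> b \<bullet> i - x \<bullet> i \<le> 0"
    by (force simp: mem_box)
  moreover from this have
    "smooth_step (real n * (x \<bullet> i - a \<bullet> i)) * smooth_step (real n * (b \<bullet> i - x \<bullet> i)) = 0"
    by (auto intro!: smooth_step_eq_0 mult_nonneg_nonpos)
  ultimately show ?thesis
    unfolding box_cutoff_def by (intro prod_zero) auto
qed

lemma box_cutoff_bounds: "0 \<le> box_cutoff a b n x" "box_cutoff a b n x \<le> 1"
proof -
  have *: "0 \<le> smooth_step s * smooth_step t" "smooth_step s * smooth_step t \<le> 1" for s t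
    using smooth_step_bounds[of s] smooth_step_bounds[of t] by (auto intro: mult_le_one)
  show "0 \<le> box_cutoff a b n x"
    unfolding box_cutoff_def by (rule prod_nonneg) (rule *(1))
  show "box_cutoff a b n x \<le> 1"
    unfolding box_cutoff_def by (rule prod_le_1) (use * in blast)
qed

lemma box_cutoff_tendsto: "(\<lambda>n. box_cutoff a b n x) \<longlonglongrightarrow> indicator (box a b) x"
proof (cases "x \<in> box a b")
  case True
  have "(\<lambda>n. box_cutoff a b n x) \<longlonglongrightarrow> (\<Prod>i\<in>(Basis::'a set).
      (if x \<bullet> i - a \<bullet> i > 0 then 1 else 0) * (if b \<bullet> i - x \<bullet> i > 0 then 1 else 0))"
    unfolding box_cutoff_def by (intro tendsto_prod tendsto_mult smooth_step_scaled_tendsto)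
  then show ?thesis using True by (simp add: mem_box)
next
  case False
  then show ?thesis by (simp add: box_cutoff_eq_0)
qed

lemma test_function_box_cutoff:
  assumes "cbox a b \<subseteq> \<Omega>"
  shows "test_function \<Omega> (box_cutoff a b n)"
proof -
  have "times_continuously_diff m (\<lambda>x. smooth_step (real n * (x \<bullet> i - a \<bullet> i)))" for m and i :: 'a
    using tcd_compose_affine[OF tcd_smooth_step, of m "real n *\<^sub>R i" "- real n * (a \<bullet> i)"]
    by (simp add: algebra_simps inner_commute)
  moreover have "times_continuously_diff m (\<lambda>x. smooth_step (real n * (b \<bullet> i - x \<bullet> i)))" for m and i :: 'a
    using tcd_compose_affine[OF tcd_smooth_step, of m "- real n *\<^sub>R i" "real n * (b \<bullet> i)"]
    by (simp add: algebra_simps inner_commute)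
  ultimately have "times_continuously_diff m (box_cutoff a b n)" for m
    unfolding box_cutoff_def[abs_def] by (intro tcd_prod tcd_mult)
  moreover have sub: "closure {x. box_cutoff a b n x \<noteq> 0} \<subseteq> cbox a b"
    using box_cutoff_eq_0 box_subset_cbox by (intro closure_minimal) blast+
  moreover have "compact (closure {x. box_cutoff a b n x \<noteq> 0})"
    using compact_cbox sub by (metis closed_closure compact_Int_closed inf.absorb_iff2)
  ultimately show ?thesis
    using assms by (auto simp: test_function_def)
qed

text \<open>Dominated convergence turns the vanishing integrals against \<open>box_cutoff\<close>
  into a vanishing integral over the open box, and the faces are negligible.\<close>

lemma integral_cbox_eq_0:
  fixes h :: "'a::euclidean_space \<Rightarrow> 'b::euclidean_space"
  assumes li: "locally_integrable \<Omega> h" and \<Omega>: "\<Omega> \<in> sets lebesgue"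
    and 0: "\<And>\<phi>. test_function \<Omega> \<phi> \<Longrightarrow> (LINT x|lebesgue_on \<Omega>. \<phi> x *\<^sub>R h x) = 0"
    and sub: "cbox a b \<subseteq> \<Omega>"
  shows "integral (cbox a b) h = 0"
proof -
  have h: "set_integrable lebesgue (cbox a b) h"
    using li sub by (simp add: locally_integrable_def)
  have hb: "set_integrable lebesgue (box a b) h"
    by (rule set_integrable_subset[OF h _ box_subset_cbox]) simp
  have "(\<lambda>n. LINT x|lebesgue. box_cutoff a b n x *\<^sub>R h x) \<longlonglongrightarrow> (LINT x|lebesgue. indicator (box a b) x *\<^sub>R h x)"
  proof (rule integral_dominated_convergence)
    show "(\<lambda>x. indicator (box a b) x *\<^sub>R h x) \<in> borel_measurable lebesgue"
      using hb by (auto simp: set_integrable_def)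
    \<comment> \<open>Read off from integrability: the cutoff is also a test function on the closed
      box itself.\<close>
    show "(\<lambda>x. box_cutoff a b n x *\<^sub>R h x) \<in> borel_measurable lebesgue" for n
      using test_function_integrable(1)[OF test_function_box_cutoff[OF order_refl], of a b h n]
        integral_lebesgue_on_vanishing(2)[of "cbox a b" "\<lambda>x. box_cutoff a b n x *\<^sub>R h x"]
        li sub box_cutoff_eq_0[of _ a b n] box_subset_cbox[of a b]
      by (auto simp: locally_integrable_def subset_iff intro!: borel_measurable_integrable)
    show "integrable lebesgue (\<lambda>x. norm (indicator (box a b) x *\<^sub>R h x))"
      using hb unfolding set_integrable_def by (rule integrable_norm)
    show "AE x in lebesgue. (\<lambda>n. box_cutoff a b n x *\<^sub>R h x) \<longlonglongrightarrow> indicator (box a b) x *\<^sub>R h x"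
      by (intro AE_I2 tendsto_scaleR box_cutoff_tendsto tendsto_const)
    show "AE x in lebesgue. norm (box_cutoff a b n x *\<^sub>R h x) \<le> norm (indicator (box a b) x *\<^sub>R h x)" for n
      using box_cutoff_bounds[of a b n] box_cutoff_eq_0[of _ a b n]
      by (intro AE_I2) (simp add: indicator_def mult_left_le_one_le)
  qed
  moreover have "(LINT x|lebesgue. box_cutoff a b n x *\<^sub>R h x) = 0" for n
  proof -
    have "(LINT x|lebesgue_on \<Omega>. box_cutoff a b n x *\<^sub>R h x) = (LINT x|lebesgue. box_cutoff a b n x *\<^sub>R h x)"
    proof (rule integral_lebesgue_on_vanishing(1)[OF \<Omega>])
      fix x assume "x \<notin> \<Omega>"
      then have "x \<notin> box a b" using sub box_subset_cbox[of a b] by blast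
      then show "box_cutoff a b n x *\<^sub>R h x = 0" by (simp add: box_cutoff_eq_0)
    qed
    moreover have "(LINT x|lebesgue_on \<Omega>. box_cutoff a b n x *\<^sub>R h x) = 0"
      by (rule 0[OF test_function_box_cutoff[OF sub]])
    ultimately show ?thesis by metis
  qed
  ultimately have "(\<lambda>n. 0) \<longlonglongrightarrow> (LINT x:box a b|lebesgue. h x)"
    by (simp add: set_lebesgue_integral_def)
  then have "(LINT x:box a b|lebesgue. h x) = 0"
    by (simp only: LIMSEQ_const_iff)
  then show ?thesis
    using set_lebesgue_integral_eq_integral(2)[OF hb] integral_open_interval[of a b h] by metis
qed

text \<open>The fundamental lemma of the calculus of variations. The averages of \<open>h\<close>
  over small cubes vanish by \<open>integral_cbox_eq_0\<close>, and by Lebesgue differentiation they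
  converge to \<open>h\<close> almost everywhere.\<close>

lemma ae_zero_if_test_integrals_zero:
  fixes h :: "'a::euclidean_space \<Rightarrow> 'b::euclidean_space"
  assumes li: "locally_integrable \<Omega> h" and \<Omega>: "open \<Omega>"
    and 0: "\<And>\<phi>. test_function \<Omega> \<phi> \<Longrightarrow> (LINT x|lebesgue_on \<Omega>. \<phi> x *\<^sub>R h x) = 0"
  shows "AE x in lebesgue_on \<Omega>. h x = 0"
proof -
  have ms: "\<Omega> \<in> sets lebesgue" using \<Omega> by (simp add: borel_open)
  have loc: "AE x in lebesgue. x \<in> cbox a b \<longrightarrow> h x = 0" if sub: "cbox a b \<subseteq> \<Omega>" for a b
  proof -
    \<comment> \<open>Cutting \<open>h\<close> off outside the box makes it integrable on the whole
      space, where the differentiation theorem applies; inside the box nothing changes.\<close>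
    define h' where "h' x = indicator (cbox a b) x *\<^sub>R h x" for x
    have "integrable lebesgue h'"
      using li sub by (simp add: locally_integrable_def set_integrable_def h'_def[abs_def])
    then have "h' integrable_on UNIV" by (rule integrable_on_lebesgue)
    then have "h' integrable_on cbox p q" for p q
      by (rule integrable_on_subcbox) simp
    then obtain N where N: "negligible N" "\<And>x e. x \<notin> N \<Longrightarrow> 0 < e \<Longrightarrow>
        \<exists>d>0. \<forall>r. 0 < r \<and> r < d \<longrightarrow>
          norm (integral (cbox x (x + r *\<^sub>R One)) h' /\<^sub>R r ^ DIM('a) - h' x) < e"
      using integrable_ccontinuous_explicit by blast
    have "h x = 0" if x: "x \<in> box a b" "x \<notin> N" for x
    proof -
      have "norm (h' x) < e" if e: "0 < e" for e
      proof -
        obtain d where d: "d > 0" "\<And>r. 0 < r \<Longrightarrow> r < d \<Longrightarrow>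
            norm (integral (cbox x (x + r *\<^sub>R One)) h' /\<^sub>R r ^ DIM('a) - h' x) < e"
          using N(2)[OF x(2) e] by blast
        obtain \<rho> where \<rho>: "\<rho> > 0" "cball x \<rho> \<subseteq> box a b"
          using x(1) open_box open_contains_cball by blast
        \<comment> \<open>The cubes have their corner at x and side r. By the l1 bound on the norm
          they reach no further than r times the dimension, so this choice keeps them in the ball of
          radius \<rho>.\<close>
        define r where "r = min (d / 2) (\<rho> / DIM('a))"
        have r: "0 < r" "r < d" "r * DIM('a) \<le> \<rho>"
          using d(1) \<rho>(1) by (auto simp: r_def min_def field_simps)
        have "cbox x (x + r *\<^sub>R One) \<subseteq> cball x \<rho>"
        proof
          fix y assume "y \<in> cbox x (x + r *\<^sub>R One)"
          then have y: "x \<bullet> i \<le> y \<bullet> i" "y \<bullet> i \<le> x \<bullet> i + r" if "i \<in> Basis" for i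
            using that by (auto simp: mem_box inner_left_distrib)
          have "norm (y - x) \<le> (\<Sum>i\<in>Basis. \<bar>(y - x) \<bullet> i\<bar>)" by (rule norm_le_l1)
          also have "\<dots> \<le> (\<Sum>i\<in>(Basis::'a set). r)"
            using y by (intro sum_mono) (fastforce simp: inner_diff_left)
          finally show "y \<in> cball x \<rho>" using r(3) by (simp add: dist_norm norm_minus_commute mult.commute)
        qed
        then have s: "cbox x (x + r *\<^sub>R One) \<subseteq> cbox a b"
          using \<rho>(2) box_subset_cbox by blast
        then have "integral (cbox x (x + r *\<^sub>R One)) h' = integral (cbox x (x + r *\<^sub>R One)) h"
          by (intro integral_cong) (auto simp: h'_def)
        also have "\<dots> = 0"
          using integral_cbox_eq_0[OF li ms 0] s sub by blast
        finally show ?thesis using d(2)[OF r(1,2)] by simp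
      qed
      then have "h' x = 0" by (metis less_irrefl norm_eq_zero zero_less_norm_iff)
      then show "h x = 0" using x box_subset_cbox[of a b] by (auto simp: h'_def)
    qed
    \<comment> \<open>The ball around x requires x in the open box, so the faces join the
      exceptional set.\<close>
    moreover have "negligible (N \<union> (cbox a b - box a b))"
      using N(1) negligible_frontier_interval by (rule negligible_Un)
    ultimately show ?thesis
      by (intro AE_I'[of "N \<union> (cbox a b - box a b)"]) (auto simp: negligible_iff_null_sets)
  qed
  \<comment> \<open>An open set is a countable union of closed boxes, so that countably many null
    sets are united.\<close>
  obtain D where D: "countable D" "D \<subseteq> Pow \<Omega>" "\<And>B. B \<in> D \<Longrightarrow> \<exists>a b. B = cbox a b" "\<Union>D = \<Omega>"
    using open_countable_Union_open_cbox[OF \<Omega>] by metis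
  have "AE x in lebesgue. \<forall>B\<in>D. x \<in> B \<longrightarrow> h x = 0"
  proof (subst AE_ball_countable[OF D(1)], intro ballI)
    fix B assume B: "B \<in> D"
    then obtain a b where "B = cbox a b" using D(3) by blast
    with loc[of a b] B D(2) show "AE x in lebesgue. x \<in> B \<longrightarrow> h x = 0" by blast
  qed
  then have "AE x in lebesgue. x \<in> \<Omega> \<longrightarrow> h x = 0"
    using D(4) by (elim AE_mp) (intro AE_I2, blast)
  then show ?thesis using ms by (simp add: AE_restrict_space_iff)
qed

text \<open>Both are derivatives of one function, so their difference is a weak derivative of the
  zero function and all its test integrals vanish. This makes the choice in
  \<open>weak_jacobian\<close> harmless up to null sets.\<close>

lemma is_weak_partial_unique:
  fixes f :: "'a::euclidean_space \<Rightarrow> 'b::euclidean_space"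
  assumes "is_weak_partial \<Omega> b f g" "is_weak_partial \<Omega> b f g'" "b \<in> Basis" "open \<Omega>"
  shows "AE x in lebesgue_on \<Omega>. g x = g' x"
proof -
  have ms: "\<Omega> \<in> sets lebesgue" using assms by (simp add: borel_open)
  have "is_weak_partial \<Omega> b (\<lambda>x. 1 *\<^sub>R f x + (- 1) *\<^sub>R f x) (\<lambda>x. 1 *\<^sub>R g x + (- 1) *\<^sub>R g' x)"
    by (rule is_weak_partial_linear[OF assms(1,2,3) ms])
  then have "AE x in lebesgue_on \<Omega>. 1 *\<^sub>R g x + (- 1) *\<^sub>R g' x = 0"
    by (intro ae_zero_if_test_integrals_zero[OF _ assms(4)]) (auto simp: is_weak_partial_def)
  then show ?thesis by (elim AE_mp) (intro AE_I2, simp)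
qed

section \<open>Function spaces on the domain\<close>

text \<open>Rests on the completeness of Lebesgue measure. It transfers measurability to chosen
  representatives and to limits identified only almost everywhere.\<close>

lemma borel_measurable_lebesgue_on_AE:
  fixes f :: "'a::euclidean_space \<Rightarrow> 'b::euclidean_space"
  assumes "f \<in> borel_measurable (lebesgue_on S)" "AE x in lebesgue_on S. f x = g x" "S \<in> sets lebesgue"
  shows "g \<in> borel_measurable (lebesgue_on S)"
proof -
  have *: "h \<in> borel_measurable (lebesgue_on S) \<longleftrightarrow> (\<lambda>x. indicator S x *\<^sub>R h x) \<in> borel_measurable lebesgue"
    for h :: "'a \<Rightarrow> 'b"
    using assms(3) by (subst borel_measurable_restrict_space_iff) auto
  have "AE x in lebesgue. x \<in> S \<longrightarrow> f x = g x"
    using assms(2,3) by (simp add: AE_restrict_space_iff)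
  then have "AE x in lebesgue. indicator S x *\<^sub>R f x = indicator S x *\<^sub>R g x"
    by (elim AE_mp) (intro AE_I2, auto simp: indicator_def)
  with assms(1) show ?thesis
    unfolding * by (rule borel_measurable_AE)
qed

text \<open>On vector fields this is \<open>embed_H\<close>; the general value type lets the tensor
  fields be treated by the same lemmas.\<close>

definition L2_inner :: "'a::euclidean_space set \<Rightarrow> ('a \<Rightarrow> 'b::euclidean_space) \<Rightarrow> ('a \<Rightarrow> 'b) \<Rightarrow> real" where
  "L2_inner G f g = (LINT x|lebesgue_on G. f x \<bullet> g x)"

lemma L2_spaceD:
  assumes "f \<in> L2_space G"
  shows "f \<in> borel_measurable (lebesgue_on G)" "integrable (lebesgue_on G) (\<lambda>x. (norm (f x))\<^sup>2)"
  using assms by (auto simp: L2_space_def)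

lemma L2_norm_nonneg: "0 \<le> L2_norm G f" by (simp add: L2_norm_def)

lemma L2_norm_sq: "(L2_norm G f)\<^sup>2 = L2_inner G f f"
  by (simp add: L2_norm_def L2_inner_def power2_norm_eq_inner)

lemma L2_inner_integrable:
  assumes "f \<in> L2_space G" "g \<in> L2_space G"
  shows "integrable (lebesgue_on G) (\<lambda>x. f x \<bullet> g x)"
proof (rule Bochner_Integration.integrable_bound)
  show "integrable (lebesgue_on G) (\<lambda>x. (norm (f x))\<^sup>2 + (norm (g x))\<^sup>2)"
    using assms by (auto dest: L2_spaceD)
  show "(\<lambda>x. f x \<bullet> g x) \<in> borel_measurable (lebesgue_on G)"
    using assms by (intro borel_measurable_inner) (auto dest: L2_spaceD)
  have "\<bar>f x \<bullet> g x\<bar> \<le> (norm (f x))\<^sup>2 + (norm (g x))\<^sup>2" for x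
  proof -
    have "\<bar>f x \<bullet> g x\<bar> \<le> norm (f x) * norm (g x)" by (rule Cauchy_Schwarz_ineq2)
    also have "\<dots> \<le> (norm (f x))\<^sup>2 + (norm (g x))\<^sup>2"
      using sum_squares_bound[of "norm (f x)" "norm (g x)"] mult_nonneg_nonneg[OF norm_ge_zero[of "f x"] norm_ge_zero[of "g x"]]
      by linarith
    finally show ?thesis .
  qed
  then show "AE x in lebesgue_on G. norm (f x \<bullet> g x) \<le> norm ((norm (f x))\<^sup>2 + (norm (g x))\<^sup>2)"
    by (intro AE_I2) simp
qed

lemma L2_space_linear:
  assumes "f \<in> L2_space G" "g \<in> L2_space G"
  shows "(\<lambda>x. c *\<^sub>R f x + d *\<^sub>R g x) \<in> L2_space G"
proof -
  have "integrable (lebesgue_on G) (\<lambda>x. c\<^sup>2 * (f x \<bullet> f x) + 2 * c * d * (f x \<bullet> g x) + d\<^sup>2 * (g x \<bullet> g x))"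
    using assms by (intro Bochner_Integration.integrable_add integrable_mult_right L2_inner_integrable)
  moreover have "(norm (c *\<^sub>R f x + d *\<^sub>R g x))\<^sup>2 = c\<^sup>2 * (f x \<bullet> f x) + 2 * c * d * (f x \<bullet> g x) + d\<^sup>2 * (g x \<bullet> g x)" for x
    unfolding power2_norm_eq_inner by (simp add: algebra_simps inner_commute power2_eq_square)
  moreover have "(\<lambda>x. c *\<^sub>R f x + d *\<^sub>R g x) \<in> borel_measurable (lebesgue_on G)"
    using assms
    by (intro borel_measurable_add borel_measurable_scaleR borel_measurable_const) (auto dest: L2_spaceD)
  ultimately show ?thesis
    by (simp add: L2_space_def)
qed

lemma L2_space_diff: "f \<in> L2_space G \<Longrightarrow> g \<in> L2_space G \<Longrightarrow> (\<lambda>x. f x - g x) \<in> L2_space G"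
  using L2_space_linear[of f G g 1 "-1"] by simp

lemma L2_space_scaleR: "f \<in> L2_space G \<Longrightarrow> (\<lambda>x. c *\<^sub>R f x) \<in> L2_space G"
  using L2_space_linear[of f G f c 0] by simp

lemma L2_space_AE_cong:
  assumes "f \<in> L2_space G" "AE x in lebesgue_on G. f x = g x" "G \<in> sets lebesgue"
  shows "g \<in> L2_space G"
proof -
  have g: "g \<in> borel_measurable (lebesgue_on G)"
    by (rule borel_measurable_lebesgue_on_AE[OF L2_spaceD(1)[OF assms(1)] assms(2,3)])
  moreover have "integrable (lebesgue_on G) (\<lambda>x. (norm (g x))\<^sup>2)"
  proof (rule integrable_cong_AE_imp[OF L2_spaceD(2)[OF assms(1)]])
    show "AE x in lebesgue_on G. (norm (f x))\<^sup>2 = (norm (g x))\<^sup>2"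
      using assms(2) by (elim AE_mp) (intro AE_I2, simp)
  qed (use g assms(1) in \<open>auto dest: L2_spaceD(1)\<close>)
  ultimately show ?thesis by (simp add: L2_space_def)
qed

lemma L2_inner_commute: "L2_inner G f g = L2_inner G g f"
  by (simp add: L2_inner_def inner_commute)

lemma L2_inner_linear_left:
  assumes "f \<in> L2_space G" "g \<in> L2_space G" "h \<in> L2_space G"
  shows "L2_inner G (\<lambda>x. c *\<^sub>R f x + d *\<^sub>R g x) h = c * L2_inner G f h + d * L2_inner G g h"
  using L2_inner_integrable[OF assms(1,3)] L2_inner_integrable[OF assms(2,3)]
  by (simp add: L2_inner_def inner_left_distrib)

lemma L2_inner_diff_left:
  assumes "f \<in> L2_space G" "g \<in> L2_space G" "h \<in> L2_space G"
  shows "L2_inner G (\<lambda>x. f x - g x) h = L2_inner G f h - L2_inner G g h"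
  using L2_inner_linear_left[OF assms, of 1 "-1"] by simp

lemma L2_inner_diff_right:
  assumes "f \<in> L2_space G" "g \<in> L2_space G" "h \<in> L2_space G"
  shows "L2_inner G h (\<lambda>x. f x - g x) = L2_inner G h f - L2_inner G h g"
  using L2_inner_diff_left[OF assms] by (simp add: L2_inner_commute)

text \<open>The discriminant argument on a carrier with a seminorm: P + 2 t Q + t^2 R \<ge> 0 for
  all t, where R may be 0 for a function that is not zero everywhere.\<close>

lemma L2_Cauchy_Schwarz:
  assumes f: "f \<in> L2_space G" and g: "g \<in> L2_space G"
  shows "\<bar>L2_inner G f g\<bar> \<le> L2_norm G f * L2_norm G g"
proof -
  define P Q R where "P = L2_inner G f f" and "Q = L2_inner G f g" and "R = L2_inner G g g"
  have pos: "0 \<le> P + 2 * t * Q + t\<^sup>2 * R" for t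
  proof -
    have "0 \<le> (L2_norm G (\<lambda>x. 1 *\<^sub>R f x + t *\<^sub>R g x))\<^sup>2" by simp
    also have "\<dots> = L2_inner G f (\<lambda>x. 1 *\<^sub>R f x + t *\<^sub>R g x) + t * L2_inner G g (\<lambda>x. 1 *\<^sub>R f x + t *\<^sub>R g x)"
      unfolding L2_norm_sq using L2_inner_linear_left[OF f g L2_space_linear[OF f g], of 1 t 1 t] by simp
    also have "L2_inner G f (\<lambda>x. 1 *\<^sub>R f x + t *\<^sub>R g x) = P + t * Q"
      using L2_inner_linear_left[OF f g f, of 1 t] by (simp add: P_def Q_def L2_inner_commute)
    also have "L2_inner G g (\<lambda>x. 1 *\<^sub>R f x + t *\<^sub>R g x) = Q + t * R"
      using L2_inner_linear_left[OF f g g, of 1 t] by (simp add: R_def Q_def L2_inner_commute)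
    finally show ?thesis by (simp add: algebra_simps power2_eq_square)
  qed
  have PR: "0 \<le> P" "0 \<le> R" by (auto simp: P_def R_def L2_norm_sq[symmetric])
  have "Q\<^sup>2 \<le> P * R"
  proof (cases "R = 0")
    case True
    have "Q = 0"
    proof (rule ccontr)
      assume "Q \<noteq> 0"
      \<comment> \<open>At this t the polynomial, which is linear as R = 0, takes the value
        -1.\<close>
      then show False using pos[of "- (P + 1) / (2 * Q)"] True PR(1) by (simp add: field_simps)
    qed
    with True show ?thesis by simp
  next
    case False
    then have "R > 0" using PR by simp
    then show ?thesis using pos[of "- Q / R"] by (simp add: power2_eq_square field_simps)
  qed
  then have "\<bar>Q\<bar> \<le> sqrt (P * R)" by (rule real_le_rsqrt[of "\<bar>Q\<bar>", simplified])
  then show ?thesis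
    by (simp add: real_sqrt_mult P_def Q_def R_def L2_norm_sq[symmetric] L2_norm_nonneg)
qed

lemma L2_norm_diff_sq:
  assumes f: "f \<in> L2_space G" and g: "g \<in> L2_space G"
  shows "(L2_norm G (\<lambda>x. f x - g x))\<^sup>2 = (L2_norm G f)\<^sup>2 + (L2_norm G g)\<^sup>2 - 2 * L2_inner G f g"
  using L2_inner_diff_left[OF f g L2_space_diff[OF f g]] L2_inner_diff_right[OF f g f] L2_inner_diff_right[OF f g g]
  by (simp add: L2_norm_sq L2_inner_commute)

lemma L2_norm_triangle_diff:
  assumes f: "f \<in> L2_space G" and g: "g \<in> L2_space G"
  shows "\<bar>L2_norm G f - L2_norm G g\<bar> \<le> L2_norm G (\<lambda>x. f x - g x)"
proof -
  have "(L2_norm G f - L2_norm G g)\<^sup>2 \<le> (L2_norm G (\<lambda>x. f x - g x))\<^sup>2"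
    using L2_Cauchy_Schwarz[OF f g] by (simp add: L2_norm_diff_sq[OF f g] power2_diff)
  then show ?thesis by (metis L2_norm_nonneg abs_le_square_iff abs_of_nonneg)
qed

text \<open>In squared form the inequality adds up over the two summands of the squared
  \<open>H1_norm\<close>, and so carries over to \<open>H1_norm_diff_sq_le\<close>.\<close>

lemma L2_norm_diff_sq_le:
  assumes f: "f \<in> L2_space G" and g: "g \<in> L2_space G"
  shows "(L2_norm G (\<lambda>x. f x - g x))\<^sup>2 \<le> 2 * (L2_norm G f)\<^sup>2 + 2 * (L2_norm G g)\<^sup>2"
  using L2_Cauchy_Schwarz[OF f g] sum_squares_bound[of "L2_norm G f" "L2_norm G g"]
  unfolding L2_norm_diff_sq[OF f g] by linarith

lemma L2_norm_scaleR: "L2_norm G (\<lambda>x. c *\<^sub>R f x) = \<bar>c\<bar> * L2_norm G f"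
  by (simp add: L2_norm_def power_mult_distrib real_sqrt_mult)

lemma L2_norm_AE_cong:
  assumes "AE x in lebesgue_on G. f x = g x" "f \<in> L2_space G" "g \<in> L2_space G"
  shows "L2_norm G f = L2_norm G g"
  unfolding L2_norm_def
  by (intro arg_cong[of _ _ sqrt] integral_cong_AE)
     (use assms in \<open>auto dest: L2_spaceD(1)\<close>)

lemma Linf_norm_bound:
  assumes "f \<in> Linf_space G"
  shows "AE x in lebesgue_on G. norm (f x) \<le> Linf_norm G f"
proof -
  let ?e = "esssup (lebesgue_on G) (\<lambda>x. ereal (norm (f x)))"
  have ae: "AE x in lebesgue_on G. ereal (norm (f x)) \<le> ?e" by (rule esssup_AE)
  obtain M where M: "AE x in lebesgue_on G. norm (f x) \<le> M"
    using assms by (auto simp: Linf_space_def)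
  have "?e \<le> ereal M"
    using assms M by (intro esssup_I) (auto simp: Linf_space_def)
  \<comment> \<open>The value -\<infinity> belongs to a domain of measure zero, where every
    almost-everywhere statement holds.\<close>
  then consider "?e = - \<infinity>" | r where "?e = ereal r" by (cases ?e) auto
  then show ?thesis
  proof cases
    case 1
    with ae show ?thesis by (elim AE_mp) (intro AE_I2, simp)
  next
    case 2
    with ae show ?thesis by (elim AE_mp) (intro AE_I2, simp add: Linf_norm_def)
  qed
qed

lemma bounded_measurable_L2:
  assumes f: "f \<in> borel_measurable (lebesgue_on G)" and ae: "AE x in lebesgue_on G. norm (f x) \<le> M"
    and M: "0 \<le> M" and G: "G \<in> lmeasurable"
  shows "f \<in> L2_space G" "L2_norm G f \<le> M * sqrt (measure lebesgue G)"
proof -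
  have const: "integrable (lebesgue_on G) (\<lambda>_. M\<^sup>2)"
    by (intro finite_measure.integrable_const finite_measure_lebesgue_on G)
  have ae2: "AE x in lebesgue_on G. (norm (f x))\<^sup>2 \<le> M\<^sup>2"
    using ae by eventually_elim (simp add: power_mono)
  have i: "integrable (lebesgue_on G) (\<lambda>x. (norm (f x))\<^sup>2)"
    by (rule Bochner_Integration.integrable_bound[OF const]) (use f ae2 in auto)
  with f show "f \<in> L2_space G" by (simp add: L2_space_def)
  have "(LINT x|lebesgue_on G. (norm (f x))\<^sup>2) \<le> (LINT x|lebesgue_on G. M\<^sup>2)"
    by (rule integral_mono_AE[OF i const ae2])
  also have "\<dots> = M\<^sup>2 * measure lebesgue G"
    using G by (simp add: measure_restrict_space fmeasurable_def)
  finally have "sqrt (LINT x|lebesgue_on G. (norm (f x))\<^sup>2) \<le> sqrt (M\<^sup>2 * measure lebesgue G)"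
    by (rule real_sqrt_le_mono)
  then show "L2_norm G f \<le> M * sqrt (measure lebesgue G)"
    using M by (simp add: L2_norm_def real_sqrt_mult)
qed

lemma Linf_space_imp_L2:
  assumes "f \<in> Linf_space G" "G \<in> lmeasurable"
  shows "f \<in> L2_space G"
proof -
  obtain M where M: "AE x in lebesgue_on G. norm (f x) \<le> M"
    using assms(1) by (auto simp: Linf_space_def)
  then have "AE x in lebesgue_on G. norm (f x) \<le> max 0 M" by eventually_elim simp
  then show ?thesis
    using assms by (intro bounded_measurable_L2(1)[of f G "max 0 M"]) (auto simp: Linf_space_def)
qed

section \<open>Weak Jacobians, the space V and its dual\<close>

lemma is_weak_jacobian_linear:
  assumes "is_weak_jacobian G u g" "is_weak_jacobian G v h" "G \<in> sets lebesgue"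
  shows "is_weak_jacobian G (\<lambda>x. c *\<^sub>R u x + d *\<^sub>R v x) (\<lambda>x. c *\<^sub>R g x + d *\<^sub>R h x)"
  unfolding is_weak_jacobian_def
proof
  fix j
  have "(\<lambda>x. \<chi> i. (c *\<^sub>R g x + d *\<^sub>R h x) $ i $ j) =
      (\<lambda>x. c *\<^sub>R (\<chi> i. g x $ i $ j) + d *\<^sub>R (\<chi> i. h x $ i $ j))"
    by (simp add: vec_eq_iff fun_eq_iff)
  moreover have "is_weak_partial G (axis j 1) (\<lambda>x. c *\<^sub>R u x + d *\<^sub>R v x)
      (\<lambda>x. c *\<^sub>R (\<chi> i. g x $ i $ j) + d *\<^sub>R (\<chi> i. h x $ i $ j))"
    using assms by (intro is_weak_partial_linear) (auto simp: is_weak_jacobian_def axis_in_Basis_iff)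
  ultimately show "is_weak_partial G (axis j 1) (\<lambda>x. c *\<^sub>R u x + d *\<^sub>R v x)
      (\<lambda>x. \<chi> i. (c *\<^sub>R g x + d *\<^sub>R h x) $ i $ j)"
    by (simp only:)
qed

lemma weak_jacobian_is: "is_weak_jacobian G u g \<Longrightarrow> is_weak_jacobian G u (weak_jacobian G u)"
  unfolding weak_jacobian_def by (rule someI[of "is_weak_jacobian G u"])

lemma weak_jacobian_AE:
  assumes "is_weak_jacobian G u g" "open G"
  shows "AE x in lebesgue_on G. g x = weak_jacobian G u x"
proof -
  have "AE x in lebesgue_on G. (\<chi> i. g x $ i $ j) = (\<chi> i. weak_jacobian G u x $ i $ j)" for j
    using assms(1) weak_jacobian_is[OF assms(1)] assms(2)
    by (intro is_weak_partial_unique[of G "axis j 1" u]) (auto simp: is_weak_jacobian_def axis_in_Basis_iff)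
  then have "AE x in lebesgue_on G. \<forall>j. (\<chi> i. g x $ i $ j) = (\<chi> i. weak_jacobian G u x $ i $ j)"
    by (simp add: AE_all_countable)
  then show ?thesis by (elim AE_mp) (intro AE_I2, simp add: vec_eq_iff)
qed

text \<open>Membership in H1 promises some square-integrable Jacobian; uniqueness passes this on to
  the one picked by \<open>weak_jacobian\<close>.\<close>

lemma space_V_D:
  assumes "u \<in> space_V G" "open G"
  shows "u \<in> L2_space G" "is_weak_jacobian G u (weak_jacobian G u)" "weak_jacobian G u \<in> L2_space G"
proof -
  obtain g where g: "g \<in> L2_space G" "is_weak_jacobian G u g"
    using assms by (auto simp: space_V_def H1_space_def)
  show "u \<in> L2_space G" using assms by (auto simp: space_V_def space_H_def)
  show "is_weak_jacobian G u (weak_jacobian G u)" using g(2) by (rule weak_jacobian_is)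
  show "weak_jacobian G u \<in> L2_space G"
    using assms by (intro L2_space_AE_cong[OF g(1) weak_jacobian_AE[OF g(2)]]) (auto simp: borel_open)
qed

lemma L2_space_integrable:
  assumes "f \<in> L2_space G" "G \<in> lmeasurable"
  shows "integrable (lebesgue_on G) f"
proof (rule Bochner_Integration.integrable_bound)
  show "integrable (lebesgue_on G) (\<lambda>x. 1 + (norm (f x))\<^sup>2)"
    using L2_spaceD(2)[OF assms(1)] finite_measure.integrable_const[OF finite_measure_lebesgue_on[OF assms(2)]]
    by (intro Bochner_Integration.integrable_add)
  have "norm (f x) \<le> 1 + (norm (f x))\<^sup>2" for x
    using sum_squares_bound[of 1 "norm (f x)"] norm_ge_zero[of "f x"] by (simp del: norm_ge_zero)
  then show "AE x in lebesgue_on G. norm (f x) \<le> norm (1 + (norm (f x))\<^sup>2)"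
    by (intro AE_I2) simp
qed (use assms(1) L2_spaceD in auto)

text \<open>The Jacobians of the three functions are chosen independently of each other, so they are
  related only almost everywhere.\<close>

lemma space_V_linear:
  assumes u: "u \<in> space_V G" and v: "v \<in> space_V G" and G: "open G" "bounded G"
  shows "(\<lambda>x. c *\<^sub>R u x + d *\<^sub>R v x) \<in> space_V G"
    and "AE x in lebesgue_on G. c *\<^sub>R weak_jacobian G u x + d *\<^sub>R weak_jacobian G v x =
      weak_jacobian G (\<lambda>x. c *\<^sub>R u x + d *\<^sub>R v x) x"
proof -
  have G': "G \<in> lmeasurable" "G \<in> sets lebesgue"
    using G lmeasurable_open by (auto simp: borel_open)
  note U = space_V_D[OF u G(1)] and V = space_V_D[OF v G(1)]
  note J = is_weak_jacobian_linear[OF U(2) V(2) G'(2), of c d]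
  have "(LINT x|lebesgue_on G. c *\<^sub>R u x + d *\<^sub>R v x) = c *\<^sub>R (LINT x|lebesgue_on G. u x) + d *\<^sub>R (LINT x|lebesgue_on G. v x)"
    using L2_space_integrable[OF U(1) G'(1)] L2_space_integrable[OF V(1) G'(1)] by simp
  also have "\<dots> = 0"
    using u v by (simp add: space_V_def space_H_def)
  finally show "(\<lambda>x. c *\<^sub>R u x + d *\<^sub>R v x) \<in> space_V G"
    using L2_space_linear[OF U(1) V(1)] L2_space_linear[OF U(3) V(3)] J
    by (auto simp: space_V_def space_H_def H1_space_def)
  show "AE x in lebesgue_on G. c *\<^sub>R weak_jacobian G u x + d *\<^sub>R weak_jacobian G v x =
      weak_jacobian G (\<lambda>x. c *\<^sub>R u x + d *\<^sub>R v x) x"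
    by (rule weak_jacobian_AE[OF J G(1)])
qed

lemma space_V_diff:
  assumes "u \<in> space_V G" "v \<in> space_V G" "open G" "bounded G"
  shows "(\<lambda>x. u x - v x) \<in> space_V G"
    and "AE x in lebesgue_on G. weak_jacobian G u x - weak_jacobian G v x = weak_jacobian G (\<lambda>x. u x - v x) x"
  using space_V_linear[OF assms, of 1 "-1"] by simp_all

lemma space_V_scaleR:
  assumes "u \<in> space_V G" "open G" "bounded G"
  shows "(\<lambda>x. c *\<^sub>R u x) \<in> space_V G"
    and "AE x in lebesgue_on G. c *\<^sub>R weak_jacobian G u x = weak_jacobian G (\<lambda>x. c *\<^sub>R u x) x"
  using space_V_linear[OF assms(1) assms, of c 0] by simp_all

lemma H1_norm_sq: "(H1_norm G u)\<^sup>2 = (L2_norm G u)\<^sup>2 + (L2_norm G (weak_jacobian G u))\<^sup>2"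
  by (simp add: H1_norm_def)

lemma H1_norm_nonneg: "0 \<le> H1_norm G u"
  by (simp add: H1_norm_def)

lemma H1_norm_scaleR:
  assumes "u \<in> space_V G" "open G" "bounded G"
  shows "H1_norm G (\<lambda>x. c *\<^sub>R u x) = \<bar>c\<bar> * H1_norm G u"
proof -
  have "L2_norm G (\<lambda>x. c *\<^sub>R weak_jacobian G u x) = L2_norm G (weak_jacobian G (\<lambda>x. c *\<^sub>R u x))"
    using space_V_D[OF space_V_scaleR(1)[OF assms, of c] assms(2)] space_V_D[OF assms(1,2)]
    by (intro L2_norm_AE_cong space_V_scaleR assms L2_space_scaleR)
  then have "L2_norm G (weak_jacobian G (\<lambda>x. c *\<^sub>R u x)) = \<bar>c\<bar> * L2_norm G (weak_jacobian G u)"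
    by (simp add: L2_norm_scaleR)
  then have "(H1_norm G (\<lambda>x. c *\<^sub>R u x))\<^sup>2 = (\<bar>c\<bar> * H1_norm G u)\<^sup>2"
    by (simp add: H1_norm_sq L2_norm_scaleR power_mult_distrib distrib_left)
  then show ?thesis by (simp add: H1_norm_nonneg)
qed

lemma H1_norm_diff_sq_le:
  assumes u: "u \<in> space_V G" and v: "v \<in> space_V G" and G: "open G" "bounded G"
  shows "(H1_norm G (\<lambda>x. u x - v x))\<^sup>2 \<le> 2 * (H1_norm G u)\<^sup>2 + 2 * (H1_norm G v)\<^sup>2"
proof -
  note U = space_V_D[OF u G(1)] and V = space_V_D[OF v G(1)]
  have "L2_norm G (weak_jacobian G (\<lambda>x. u x - v x)) = L2_norm G (\<lambda>x. weak_jacobian G u x - weak_jacobian G v x)"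
    using space_V_D(3)[OF space_V_diff(1)[OF u v G] G(1)] U V
    by (intro L2_norm_AE_cong[symmetric] space_V_diff u v G L2_space_diff)
  moreover note L2_norm_diff_sq_le[OF U(1) V(1)] L2_norm_diff_sq_le[OF U(3) V(3)]
  ultimately show ?thesis
    by (simp add: H1_norm_sq)
qed

lemma dual_norm_upper:
  assumes l: "l \<in> dual_V G" and w: "w \<in> space_V G" "H1_norm G w \<le> 1"
  shows "\<bar>l w\<bar> \<le> dual_norm G l"
proof -
  obtain M where M: "\<And>v. v \<in> space_V G \<Longrightarrow> \<bar>l v\<bar> \<le> M * H1_norm G v"
    using l unfolding dual_V_def by blast
  have "bdd_above {\<bar>l v\<bar> | v. v \<in> space_V G \<and> H1_norm G v \<le> 1}"
  proof (rule bdd_aboveI)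
    fix y assume "y \<in> {\<bar>l v\<bar> | v. v \<in> space_V G \<and> H1_norm G v \<le> 1}"
    then obtain z where z: "y = \<bar>l z\<bar>" "z \<in> space_V G" "H1_norm G z \<le> 1" by blast
    have "y \<le> M * H1_norm G z" using M[OF z(2)] z(1) by simp
    also have "\<dots> \<le> \<bar>M\<bar> * 1"
      using z(3) H1_norm_nonneg[of G z] by (intro mult_mono) auto
    finally show "y \<le> \<bar>M\<bar>" by simp
  qed
  then show ?thesis
    unfolding dual_norm_def using w by (intro cSup_upper) auto
qed

lemma dual_norm_nonneg:
  fixes v :: "real^'d \<Rightarrow> real^'k" and l :: "(real^'d \<Rightarrow> real^'k) \<Rightarrow> real"
  assumes l: "l \<in> dual_V G" and v: "v \<in> space_V G" and G: "open G" "bounded G"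
  shows "0 \<le> dual_norm G l"
proof -
  \<comment> \<open>The zero function, written as a multiple of \<open>v\<close>, lies in the unit
    ball and puts a nonnegative number below the supremum.\<close>
  have "\<bar>l (\<lambda>x. 0 *\<^sub>R v x)\<bar> \<le> dual_norm G l"
    using H1_norm_scaleR[OF v G, of 0] by (intro dual_norm_upper l space_V_scaleR(1) v G) simp
  then show ?thesis by linarith
qed

lemma dual_norm_bound:
  assumes l: "l \<in> dual_V G" and v: "v \<in> space_V G" and G: "open G" "bounded G"
  shows "\<bar>l v\<bar> \<le> dual_norm G l * H1_norm G v"
proof (cases "H1_norm G v = 0")
  \<comment> \<open>A vector of seminorm zero cannot be normalised; there the boundedness of
    \<open>l\<close> forces \<open>l v = 0\<close>.\<close>
  case True
  obtain M where "\<bar>l v\<bar> \<le> M * H1_norm G v"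
    using l v unfolding dual_V_def by blast
  with True show ?thesis by simp
next
  case False
  then have pos: "0 < H1_norm G v" using H1_norm_nonneg[of G v] by linarith
  define w where "w = (\<lambda>x. (1 / H1_norm G v) *\<^sub>R v x)"
  have "w \<in> space_V G" "H1_norm G w = 1"
    using space_V_scaleR(1)[OF v G] H1_norm_scaleR[OF v G, of "1 / H1_norm G v"] pos by (auto simp: w_def)
  then have "\<bar>l w\<bar> \<le> dual_norm G l" by (intro dual_norm_upper l) auto
  moreover have "l w = (1 / H1_norm G v) * l v"
    using l v by (auto simp: dual_V_def w_def)
  ultimately show ?thesis
    using pos by (simp add: abs_mult field_simps)
qed

lemma dual_V_linear:
  assumes "l \<in> dual_V G" "m \<in> dual_V G"
  shows "(\<lambda>v. c * l v + d * m v) \<in> dual_V G"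
proof -
  obtain M N where M: "\<And>v. v \<in> space_V G \<Longrightarrow> \<bar>l v\<bar> \<le> M * H1_norm G v"
    and N: "\<And>v. v \<in> space_V G \<Longrightarrow> \<bar>m v\<bar> \<le> N * H1_norm G v"
    using assms unfolding dual_V_def by blast
  have "\<bar>c * l v + d * m v\<bar> \<le> (\<bar>c\<bar> * M + \<bar>d\<bar> * N) * H1_norm G v" if "v \<in> space_V G" for v
  proof -
    have "\<bar>c * l v + d * m v\<bar> \<le> \<bar>c\<bar> * \<bar>l v\<bar> + \<bar>d\<bar> * \<bar>m v\<bar>"
      by (metis abs_mult abs_triangle_ineq)
    also have "\<dots> \<le> \<bar>c\<bar> * (M * H1_norm G v) + \<bar>d\<bar> * (N * H1_norm G v)"
      using M[OF that] N[OF that] by (intro add_mono mult_left_mono) auto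
    finally show ?thesis by (simp add: algebra_simps)
  qed
  moreover have "c * l (\<lambda>x. v x + w x) + d * m (\<lambda>x. v x + w x) = (c * l v + d * m v) + (c * l w + d * m w)"
    if "v \<in> space_V G" "w \<in> space_V G" for v w
    using assms that by (simp add: dual_V_def algebra_simps)
  moreover have "c * l (\<lambda>x. a *\<^sub>R v x) + d * m (\<lambda>x. a *\<^sub>R v x) = a * (c * l v + d * m v)"
    if "v \<in> space_V G" for v a
    using assms that by (simp add: dual_V_def algebra_simps)
  ultimately show ?thesis unfolding dual_V_def by blast
qed

lemma Linf_space_linear:
  assumes "f \<in> Linf_space G" "g \<in> Linf_space G"
  shows "(\<lambda>x. c *\<^sub>R f x + d *\<^sub>R g x) \<in> Linf_space G"
proof -
  obtain M N where M: "AE x in lebesgue_on G. norm (f x) \<le> M" and N: "AE x in lebesgue_on G. norm (g x) \<le> N"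
    using assms by (auto simp: Linf_space_def)
  have "AE x in lebesgue_on G. norm (c *\<^sub>R f x + d *\<^sub>R g x) \<le> \<bar>c\<bar> * M + \<bar>d\<bar> * N"
    using M N
  proof eventually_elim
    case (elim x)
    have "norm (c *\<^sub>R f x + d *\<^sub>R g x) \<le> \<bar>c\<bar> * norm (f x) + \<bar>d\<bar> * norm (g x)"
      by (rule order_trans[OF norm_triangle_ineq]) simp
    also have "\<dots> \<le> \<bar>c\<bar> * M + \<bar>d\<bar> * N" using elim by (intro add_mono mult_left_mono) auto
    finally show ?case .
  qed
  with assms show ?thesis by (auto simp: Linf_space_def)
qed

lemma Linf_sym_linear:
  assumes "f \<in> Linf_sym G" "g \<in> Linf_sym G"
  shows "(\<lambda>x. c *\<^sub>R f x + d *\<^sub>R g x) \<in> Linf_sym G"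
proof -
  have "AE x in lebesgue_on G. f x \<in> sym_tensors" "AE x in lebesgue_on G. g x \<in> sym_tensors"
    using assms by (auto simp: Linf_sym_def)
  then have "AE x in lebesgue_on G. c *\<^sub>R f x + d *\<^sub>R g x \<in> sym_tensors"
    by eventually_elim (auto simp: sym_tensors_def)
  with assms show ?thesis by (simp add: Linf_sym_def Linf_space_linear)
qed

section \<open>Bochner integrals and weak time derivatives tested with functionals\<close>

lemma integrable_lebesgue_on_iff:
  fixes f :: "'a::euclidean_space \<Rightarrow> 'b::euclidean_space"
  assumes "S \<in> sets lebesgue"
  shows "integrable (lebesgue_on S) f \<longleftrightarrow> set_integrable lebesgue S f"
  using assms by (simp add: integrable_restrict_space set_integrable_def)

lemma integrable_on_Icc_if_Ioo:
  fixes f :: "real \<Rightarrow> 'b::euclidean_space"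
  assumes "integrable (lebesgue_on {0<..<T}) f" "0 \<le> a" "b \<le> T"
  shows "f integrable_on {a..b}"
proof -
  have "set_integrable lebesgue {0<..<T} f" using assms(1) by (simp add: integrable_lebesgue_on_iff)
  then have "f integrable_on {0..T}"
    using set_lebesgue_integral_eq_integral(1) by (simp add: integrable_on_Icc_iff_Ioo)
  then show ?thesis by (rule integrable_on_subinterval) (use assms in auto)
qed

lemma integral_indicator_Ioo:
  fixes f :: "real \<Rightarrow> real"
  assumes "set_integrable lebesgue {a<..<b} f" "0 \<le> a" "b \<le> T"
  shows "(LINT r|lebesgue_on {0<..<T}. indicator {a<..<b} r * f r) = integral {a..b} f"
proof -
  have "(LINT r|lebesgue_on {0<..<T}. indicator {a<..<b} r * f r) = (LINT r|lebesgue. indicator {a<..<b} r * f r)"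
    by (rule integral_lebesgue_on_vanishing) (use assms in auto)
  also have "\<dots> = integral {a<..<b} f"
    using set_lebesgue_integral_eq_integral(2)[OF assms(1)] by (simp add: set_lebesgue_integral_def)
  finally show ?thesis by (simp add: integral_open_interval_real)
qed

text \<open>Through such a functional, statements on Bochner integrals become statements on
  integrals of real functions. It is instantiated with evaluation at a fixed \<open>v\<close> on
  \<open>dual_V\<close>, and with the pairing against a fixed square-integrable field on
  \<open>Linf_sym\<close>. \<open>C\<close> is strictly positive because the proofs divide by
  it.\<close>

locale bounded_functional =
  fixes X :: "('p \<Rightarrow> 'q::real_vector) set" and N :: "('p \<Rightarrow> 'q) \<Rightarrow> real"
    and \<Lambda> :: "('p \<Rightarrow> 'q) \<Rightarrow> real" and C :: real
  assumes X_linear: "\<And>f g c d. f \<in> X \<Longrightarrow> g \<in> X \<Longrightarrow> (\<lambda>p. c *\<^sub>R f p + d *\<^sub>R g p) \<in> X"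
    and linear: "\<And>f g c d. f \<in> X \<Longrightarrow> g \<in> X \<Longrightarrow> \<Lambda> (\<lambda>p. c *\<^sub>R f p + d *\<^sub>R g p) = c * \<Lambda> f + d * \<Lambda> g"
    and bound: "\<And>f. f \<in> X \<Longrightarrow> \<bar>\<Lambda> f\<bar> \<le> C * N f"
    and C_pos: "0 < C"
begin

lemma X_diff: "f \<in> X \<Longrightarrow> g \<in> X \<Longrightarrow> (\<lambda>p. f p - g p) \<in> X"
  using X_linear[of f g 1 "-1"] by simp

lemma diff: "f \<in> X \<Longrightarrow> g \<in> X \<Longrightarrow> \<Lambda> (\<lambda>p. f p - g p) = \<Lambda> f - \<Lambda> g"
  using linear[of f g 1 "-1"] by simp

lemma scale: "f \<in> X \<Longrightarrow> \<Lambda> (\<lambda>p. c *\<^sub>R f p) = c * \<Lambda> f"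
  using linear[of f f c 0] by simp

lemma diff_bound: "f \<in> X \<Longrightarrow> g \<in> X \<Longrightarrow> \<bar>\<Lambda> f - \<Lambda> g\<bar> \<le> C * N (\<lambda>p. f p - g p)"
  using bound[OF X_diff] diff by simp

lemma tendsto_functional:
  assumes "f \<in> X" "\<And>n. s n \<in> X" "(\<lambda>n. N (\<lambda>p. f p - s n p)) \<longlonglongrightarrow> 0"
  shows "(\<lambda>n. \<Lambda> (s n)) \<longlonglongrightarrow> \<Lambda> f"
proof -
  have "(\<lambda>n. \<Lambda> f - \<Lambda> (s n)) \<longlonglongrightarrow> 0"
    by (rule Lim_null_comparison[OF always_eventually tendsto_mult_right_zero[OF assms(3), of C]])
       (use diff_bound[OF assms(1,2)] in simp)
  from tendsto_diff[OF tendsto_const[of "\<Lambda> f"] this] show ?thesis by simp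
qed

lemma linear_sum:
  assumes "finite A" "A \<subseteq> X" "X \<noteq> {}"
  shows "(\<lambda>p. \<Sum>a\<in>A. c a *\<^sub>R a p) \<in> X \<and> \<Lambda> (\<lambda>p. \<Sum>a\<in>A. c a *\<^sub>R a p) = (\<Sum>a\<in>A. c a * \<Lambda> a)"
  using assms
proof (induction A rule: finite_induct)
  case empty
  then obtain f where "f \<in> X" by blast
  then show ?case using X_linear[of f f 0 0] linear[of f f 0 0] by simp
next
  case (insert a A)
  then have "(\<lambda>p. \<Sum>a\<in>A. c a *\<^sub>R a p) \<in> X" "a \<in> X" by auto
  with insert show ?case
    using X_linear[of a "\<lambda>p. \<Sum>a\<in>A. c a *\<^sub>R a p" "c a" 1] linear[of a "\<lambda>p. \<Sum>a\<in>A. c a *\<^sub>R a p" "c a" 1]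
    by simp
qed

text \<open>Along each approximating simple curve the functional is again a simple function, and by
  boundedness it follows the approximation to the limit.\<close>

lemma measurable:
  assumes "strongly_measurable T X N f"
  shows "(\<lambda>t. \<Lambda> (f t)) \<in> borel_measurable (lebesgue_on {0<..<T})"
proof -
  obtain s where s: "\<And>n. simple_curve T X (s n)"
    and lim: "AE t in lebesgue_on {0<..<T}. (\<lambda>n. N (\<lambda>p. f t p - s n t p)) \<longlonglongrightarrow> 0"
    and X: "AE t in lebesgue_on {0<..<T}. f t \<in> X"
    using assms by (auto simp: strongly_measurable_def)
  have meas: "(\<lambda>t. \<Lambda> (s n t)) \<in> borel_measurable (lebesgue_on {0<..<T})" for n
    using s[of n] by (intro borel_measurable_simple_function simple_function_compose1[where g = \<Lambda>])
      (simp add: simple_curve_def)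
  have "AE t in lebesgue_on {0<..<T}. lim (\<lambda>n. \<Lambda> (s n t)) = \<Lambda> (f t)"
    using lim X AE_space
  proof eventually_elim
    case (elim t)
    then have sX: "s n t \<in> X" for n using s by (auto simp: simple_curve_def)
    from tendsto_functional[OF elim(2) sX elim(1)] show ?case by (rule limI)
  qed
  then show ?thesis
    by (rule borel_measurable_lebesgue_on_AE[OF borel_measurable_lim_metric[OF meas]]) simp
qed

lemma simple_curve_integral:
  assumes s: "simple_curve T X s" and y: "y \<in> X"
  shows "integrable (lebesgue_on {0<..<T}) (\<lambda>t. \<Lambda> (s t))"
    and "simple_curve_integral T s \<in> X"
    and "(LINT t|lebesgue_on {0<..<T}. \<Lambda> (s t)) = \<Lambda> (simple_curve_integral T s)"
proof -
  let ?M = "lebesgue_on {0<..<T}" and ?A = "s ` {0<..<T}"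
  have A: "finite ?A" "?A \<subseteq> X"
    using s simple_functionD(1)[of ?M s] by (auto simp: simple_curve_def)
  have set: "{t \<in> {0<..<T}. s t = a} \<in> sets ?M" for a
  proof -
    have "s -` {a} \<inter> space ?M \<in> sets ?M"
      using s by (intro simple_functionD(2)) (simp add: simple_curve_def)
    moreover have "s -` {a} \<inter> space ?M = {t \<in> {0<..<T}. s t = a}" by auto
    ultimately show ?thesis by simp
  qed
  have meas: "measure ?M {t \<in> {0<..<T}. s t = a} = measure lebesgue {t \<in> {0<..<T}. s t = a}" for a
    by (rule measure_restrict_space) auto
  have fin: "emeasure ?M B < \<infinity>" for B
    using finite_measure.emeasure_finite[OF finite_measure_lebesgue_on[of "{0<..<T}"], of B]
    by (simp add: top.not_eq_extremum)
  have int: "integrable ?M (indicator {t \<in> {0<..<T}. s t = a} :: real \<Rightarrow> real)" for a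
    using set fin by (intro integrable_real_indicator) auto
  have eq: "\<Lambda> (s t) = (\<Sum>a\<in>?A. \<Lambda> a * indicator {t \<in> {0<..<T}. s t = a} t)" if t: "t \<in> {0<..<T}" for t
  proof -
    have "(\<Sum>a\<in>?A. \<Lambda> a * indicator {t \<in> {0<..<T}. s t = a} t) = (\<Sum>a\<in>?A. if s t = a then \<Lambda> a else 0)"
      using t by (intro sum.cong) (auto simp: indicator_def)
    then show ?thesis using A(1) t by simp
  qed
  have i: "integrable ?M (\<lambda>t. \<Sum>a\<in>?A. \<Lambda> a * indicator {t \<in> {0<..<T}. s t = a} t)"
    using int by (intro Bochner_Integration.integrable_sum integrable_mult_right)
  then show "integrable ?M (\<lambda>t. \<Lambda> (s t))"
    using eq by (subst Bochner_Integration.integrable_cong[OF refl, where g = "\<lambda>t. \<Sum>a\<in>?A. \<Lambda> a * indicator {t \<in> {0<..<T}. s t = a} t"]) auto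
  \<comment> \<open>The point \<open>y\<close> shows that the carrier is nonempty, so that it
    contains the zero function, the value of an empty sum.\<close>
  have ne: "X \<noteq> {}" using y by auto
  note L = linear_sum[OF A ne, of "\<lambda>a. measure lebesgue {t \<in> {0<..<T}. s t = a}"]
  show "simple_curve_integral T s \<in> X"
    using L unfolding simple_curve_integral_def by blast
  have "(LINT t|?M. \<Lambda> (s t)) = (LINT t|?M. (\<Sum>a\<in>?A. \<Lambda> a * indicator {t \<in> {0<..<T}. s t = a} t))"
    using eq by (intro Bochner_Integration.integral_cong) auto
  also have "\<dots> = (\<Sum>a\<in>?A. \<Lambda> a * measure ?M {t \<in> {0<..<T}. s t = a})"
  proof (subst Bochner_Integration.integral_sum)
    fix a
    show "integrable ?M (\<lambda>t. \<Lambda> a * indicator {t \<in> {0<..<T}. s t = a} t)"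
      by (intro integrable_mult_right int)
  next
    have "{t \<in> {0<..<T}. s t = a} \<inter> space ?M = {t \<in> {0<..<T}. s t = a}" for a by auto
    then show "(\<Sum>a\<in>?A. LINT t|?M. \<Lambda> a * indicator {t \<in> {0<..<T}. s t = a} t) =
        (\<Sum>a\<in>?A. \<Lambda> a * measure ?M {t \<in> {0<..<T}. s t = a})"
      by (simp only: integral_mult_right_zero Bochner_Integration.integral_indicator)
  qed
  also have "\<dots> = \<Lambda> (simple_curve_integral T s)"
    unfolding simple_curve_integral_def meas L[THEN conjunct2] by (simp only: mult.commute)
  finally show "(LINT t|?M. \<Lambda> (s t)) = \<Lambda> (simple_curve_integral T s)" .
qed

text \<open>
  The map \<open>t \<mapsto> N (f t - s t)\<close> need not be measurable, so its \<open>nn_integral\<close> is only a lower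
  integral; monotonicity still holds, and the factor \<open>C\<close> is therefore moved to the measurable side.
\<close>

lemma bochner_integral:
  assumes "is_bochner_integral T X N f y"
  shows "integrable (lebesgue_on {0<..<T}) (\<lambda>t. \<Lambda> (f t))"
    and "(LINT t|lebesgue_on {0<..<T}. \<Lambda> (f t)) = \<Lambda> y"
proof -
  let ?M = "lebesgue_on {0<..<T}"
  have sm: "strongly_measurable T X N f" and y: "y \<in> X"
    using assms by (auto simp: is_bochner_integral_def)
  obtain s where s: "\<And>n. simple_curve T X (s n)"
    and lim: "(\<lambda>n. \<integral>\<^sup>+t. ennreal (N (\<lambda>p. f t p - s n t p)) \<partial>?M) \<longlonglongrightarrow> 0"
    and limy: "(\<lambda>n. N (\<lambda>p. y p - simple_curve_integral T (s n) p)) \<longlonglongrightarrow> 0"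
    using assms by (auto simp: is_bochner_integral_def)
  note sint = simple_curve_integral[OF s y]
  note f_meas = measurable[OF sm]
  have X: "AE t in ?M. f t \<in> X" using sm by (simp add: strongly_measurable_def)
  have le: "(\<integral>\<^sup>+t. ennreal (norm (\<Lambda> (s n t) - \<Lambda> (f t))) \<partial>?M)
      \<le> ennreal C * (\<integral>\<^sup>+t. ennreal (N (\<lambda>p. f t p - s n t p)) \<partial>?M)" for n
  proof -
    have "(\<integral>\<^sup>+t. ennreal (norm (\<Lambda> (s n t) - \<Lambda> (f t))) \<partial>?M)
        = (\<integral>\<^sup>+t. ennreal C * ennreal (norm (\<Lambda> (s n t) - \<Lambda> (f t)) / C) \<partial>?M)"
      using C_pos by (intro nn_integral_cong) (simp add: ennreal_mult[symmetric])
    also have "\<dots> = ennreal C * (\<integral>\<^sup>+t. ennreal (norm (\<Lambda> (s n t) - \<Lambda> (f t)) / C) \<partial>?M)"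
      using f_meas borel_measurable_integrable[OF sint(1)] by (intro nn_integral_cmult) simp
    also have "(\<integral>\<^sup>+t. ennreal (norm (\<Lambda> (s n t) - \<Lambda> (f t)) / C) \<partial>?M)
        \<le> (\<integral>\<^sup>+t. ennreal (N (\<lambda>p. f t p - s n t p)) \<partial>?M)"
    proof (rule nn_integral_mono_AE)
      show "AE t in ?M. ennreal (norm (\<Lambda> (s n t) - \<Lambda> (f t)) / C) \<le> ennreal (N (\<lambda>p. f t p - s n t p))"
        using X AE_space
      proof eventually_elim
        case (elim t)
        then have "\<bar>\<Lambda> (f t) - \<Lambda> (s n t)\<bar> \<le> C * N (\<lambda>p. f t p - s n t p)"
          using s by (intro diff_bound) (auto simp: simple_curve_def)
        then show ?case
          using C_pos by (intro ennreal_leI) (simp add: field_simps abs_minus_commute)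
      qed
    qed
    finally show ?thesis by (simp add: mult_left_mono)
  qed
  have "(\<lambda>n. ennreal C * (\<integral>\<^sup>+t. ennreal (N (\<lambda>p. f t p - s n t p)) \<partial>?M)) \<longlonglongrightarrow> ennreal C * 0"
    by (intro ennreal_tendsto_cmult lim) simp
  then have lim0: "(\<lambda>n. ennreal C * (\<integral>\<^sup>+t. ennreal (N (\<lambda>p. f t p - s n t p)) \<partial>?M)) \<longlonglongrightarrow> 0"
    by (simp only: mult_zero_right)
  have L1: "(\<lambda>n. \<integral>\<^sup>+t. ennreal (norm (\<Lambda> (s n t) - \<Lambda> (f t))) \<partial>?M) \<longlonglongrightarrow> 0"
    by (rule tendsto_sandwich[OF _ _ tendsto_const lim0]) (use le in \<open>blast intro: always_eventually zero_le\<close>)+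
  then have "eventually (\<lambda>n. (\<integral>\<^sup>+t. ennreal (norm (\<Lambda> (s n t) - \<Lambda> (f t))) \<partial>?M) < 1) sequentially"
    by (rule order_tendstoD) simp
  then obtain n where n: "(\<integral>\<^sup>+t. ennreal (norm (\<Lambda> (s n t) - \<Lambda> (f t))) \<partial>?M) < 1"
    by (auto simp: eventually_sequentially)
  have "integrable ?M (\<lambda>t. \<Lambda> (s n t) - \<Lambda> (f t))"
  proof (rule integrableI_bounded)
    show "(\<lambda>t. \<Lambda> (s n t) - \<Lambda> (f t)) \<in> borel_measurable ?M"
      using f_meas borel_measurable_integrable[OF sint(1)] by measurable
    show "(\<integral>\<^sup>+t. ennreal (norm (\<Lambda> (s n t) - \<Lambda> (f t))) \<partial>?M) < \<infinity>"
      using n by (rule less_trans) simp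
  qed
  from Bochner_Integration.integrable_diff[OF sint(1)[of n] this]
  show fi: "integrable ?M (\<lambda>t. \<Lambda> (f t))" by simp
  have "(\<lambda>n. LINT t|?M. \<Lambda> (s n t)) \<longlonglongrightarrow> (LINT t|?M. \<Lambda> (f t))"
    by (rule tendsto_L1_int[OF sint(1) fi L1])
  moreover have "(\<lambda>n. LINT t|?M. \<Lambda> (s n t)) \<longlonglongrightarrow> \<Lambda> y"
    unfolding sint(3) by (rule tendsto_functional[OF y sint(2) limy])
  ultimately show "(LINT t|?M. \<Lambda> (f t)) = \<Lambda> y" by (rule LIMSEQ_unique)
qed

text \<open>On an interval of finite length, |x| \<le> 1 + x^2 reduces integrability to square
  integrability. The measurable function \<open>\<Lambda> (f t) / C\<close> stays on the smaller
  side of the comparison, since \<open>N (f t)\<close> may fail to be measurable in t.\<close>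

lemma bochner_L2_integrable:
  assumes "f \<in> bochner_L2 T X N"
  shows "integrable (lebesgue_on {0<..<T}) (\<lambda>t. \<Lambda> (f t))"
proof -
  let ?M = "lebesgue_on {0<..<T}"
  have sm: "strongly_measurable T X N f" and fin: "(\<integral>\<^sup>+t. ennreal ((N (f t))\<^sup>2) \<partial>?M) < \<infinity>"
    using assms by (auto simp: bochner_L2_def)
  note m = measurable[OF sm]
  have "AE t in ?M. f t \<in> X" using sm by (simp add: strongly_measurable_def)
  then have "AE t in ?M. ennreal ((\<Lambda> (f t) / C)\<^sup>2) \<le> ennreal ((N (f t))\<^sup>2)"
  proof eventually_elim
    case (elim t)
    have "\<bar>\<Lambda> (f t) / C\<bar> \<le> \<bar>N (f t)\<bar>"
      using order_trans[OF bound[OF elim] mult_left_mono[OF abs_ge_self[of "N (f t)"], of C]] C_pos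
      by (simp add: field_simps)
    then show ?case by (intro ennreal_leI abs_le_square_iff[THEN iffD1])
  qed
  then have "(\<integral>\<^sup>+t. ennreal ((\<Lambda> (f t) / C)\<^sup>2) \<partial>?M) < \<infinity>"
    by (rule le_less_trans[OF nn_integral_mono_AE fin])
  then have "integrable ?M (\<lambda>t. (\<Lambda> (f t) / C)\<^sup>2)"
    using m by (intro integrableI_nonneg) auto
  then have "integrable ?M (\<lambda>t. C * (1 + (\<Lambda> (f t) / C)\<^sup>2))"
    by (intro integrable_mult_right Bochner_Integration.integrable_add
        finite_measure.integrable_const finite_measure_lebesgue_on) auto
  then show ?thesis
  proof (rule Bochner_Integration.integrable_bound)
    have "\<bar>\<Lambda> (f t)\<bar> \<le> C * (1 + (\<Lambda> (f t) / C)\<^sup>2)" for t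
    proof -
      have "\<bar>x\<bar> \<le> 1 + x\<^sup>2" for x :: real
        using sum_squares_bound[of 1 "\<bar>x\<bar>"] by simp
      from mult_left_mono[OF this[of "\<Lambda> (f t) / C"], of C]
      show ?thesis using C_pos by (simp add: abs_divide)
    qed
    then show "AE t in ?M. norm (\<Lambda> (f t)) \<le> norm (C * (1 + (\<Lambda> (f t) / C)\<^sup>2))"
      by (intro AE_I2) (metis abs_ge_self order_trans real_norm_def)
  qed (rule m)
qed

text \<open>The definition provides one \<open>y\<close> that is the Bochner integral of both
  vector-valued integrands; both real integrals are then equal to
  \<open>\<Lambda> y\<close>.\<close>

lemma weak_time_deriv:
  assumes "bochner_H1 T X N f f'" "test_function {0<..<T} \<phi>"
  shows "(LINT t|lebesgue_on {0<..<T}. deriv \<phi> t * \<Lambda> (f t)) =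
      - (LINT t|lebesgue_on {0<..<T}. \<phi> t * \<Lambda> (f' t))"
proof -
  let ?M = "lebesgue_on {0<..<T}"
  obtain y where y: "is_bochner_integral T X N (\<lambda>t p. deriv \<phi> t *\<^sub>R f t p) y"
      "is_bochner_integral T X N (\<lambda>t p. - (\<phi> t *\<^sub>R f' t p)) y"
    using assms by (auto simp: bochner_H1_def is_weak_time_deriv_def)
  have X: "AE t in ?M. f t \<in> X" "AE t in ?M. f' t \<in> X"
    using assms(1) by (auto simp: bochner_H1_def bochner_L2_def strongly_measurable_def)
  have ae1: "AE t in ?M. \<Lambda> (\<lambda>p. deriv \<phi> t *\<^sub>R f t p) = deriv \<phi> t * \<Lambda> (f t)"
    using X(1) by eventually_elim (rule scale)
  have ae2: "AE t in ?M. \<Lambda> (\<lambda>p. - (\<phi> t *\<^sub>R f' t p)) = - (\<phi> t * \<Lambda> (f' t))"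
    using X(2)
  proof eventually_elim
    case (elim t)
    then show ?case using scale[of "f' t" "- \<phi> t"] by simp
  qed
  have m: "(\<lambda>t. \<Lambda> (\<lambda>p. deriv \<phi> t *\<^sub>R f t p)) \<in> borel_measurable ?M"
      "(\<lambda>t. \<Lambda> (\<lambda>p. - (\<phi> t *\<^sub>R f' t p))) \<in> borel_measurable ?M"
    using y by (auto intro!: measurable simp: is_bochner_integral_def)
  have "(LINT t|?M. deriv \<phi> t * \<Lambda> (f t)) = (LINT t|?M. \<Lambda> (\<lambda>p. deriv \<phi> t *\<^sub>R f t p))"
    using ae1 m(1) borel_measurable_lebesgue_on_AE[OF m(1) ae1]
    by (intro integral_cong_AE) (auto elim: AE_mp)
  also have "\<dots> = (LINT t|?M. \<Lambda> (\<lambda>p. - (\<phi> t *\<^sub>R f' t p)))"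
    using bochner_integral(2)[OF y(1)] bochner_integral(2)[OF y(2)] by simp
  also have "\<dots> = (LINT t|?M. - (\<phi> t * \<Lambda> (f' t)))"
    using ae2 m(2) borel_measurable_lebesgue_on_AE[OF m(2) ae2]
    by (intro integral_cong_AE) auto
  finally show ?thesis by simp
qed

end

section \<open>From weak time derivatives to integral identities\<close>

lemma mollified_tendsto:
  fixes g :: "real \<Rightarrow> real"
  assumes g: "continuous_on UNIV g"
  shows "(\<lambda>n. integral {0..1} (\<lambda>s. mollifier s * g (a + s / real (Suc n)))) \<longlonglongrightarrow> g a"
proof -
  have "compact (g ` {a..a + 1})"
    using g by (intro compact_continuous_image) (auto intro: continuous_on_subset)
  then obtain B where B: "\<And>t. t \<in> {a..a + 1} \<Longrightarrow> \<bar>g t\<bar> \<le> B"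
    using compact_imp_bounded bounded_iff by (metis imageI real_norm_def)
  have "(\<lambda>n. integral {0..1} (\<lambda>s. mollifier s * g (a + s / real (Suc n)))) \<longlonglongrightarrow>
      integral {0..1} (\<lambda>s. mollifier s * g a)"
  proof (rule dominated_convergence(2))
    show "(\<lambda>s. mollifier s * g (a + s / real (Suc n))) integrable_on {0..1}" for n
      by (intro integrable_continuous_real continuous_on_mult continuous_mollifier
          continuous_on_compose2[OF g]) (auto intro!: continuous_intros)
    show "(\<lambda>s. mollifier s * B) integrable_on {0..1}"
      by (intro integrable_continuous_real continuous_on_mult continuous_mollifier continuous_on_const)
    show "norm (mollifier s * g (a + s / real (Suc n))) \<le> mollifier s * B" if "s \<in> {0..1}" for n s
    proof -
      have "s / real (Suc n) \<le> 1" using that by (simp add: field_simps)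
      then have "\<bar>g (a + s / real (Suc n))\<bar> \<le> B" using that by (intro B) auto
      then show ?thesis
        using mollifier_nonneg[of s] by (simp add: abs_mult mult_left_mono)
    qed
    show "(\<lambda>n. mollifier s * g (a + s / real (Suc n))) \<longlonglongrightarrow> mollifier s * g a" if "s \<in> {0..1}" for s
    proof -
      have "(\<lambda>n. a + s * inverse (real (Suc n))) \<longlonglongrightarrow> a + s * 0"
        by (intro tendsto_intros LIMSEQ_inverse_real_of_nat)
      then have "(\<lambda>n. g (a + s / real (Suc n))) \<longlonglongrightarrow> g a"
        using g by (intro isCont_tendsto_compose[of a g])
          (auto simp: continuous_on_eq_continuous_at divide_inverse)
      then show ?thesis by (intro tendsto_mult tendsto_const)
    qed
  qed
  moreover have "integral {0..1} (\<lambda>s. mollifier s * g a) = g a"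
    using has_integral_mult_left[OF mollifier_has_integral, of "g a"] 
    by (simp only: integral_unique mult_1)
  ultimately show ?thesis by (simp only:)
qed

text \<open>The substitution s = m (t - a). The kernel is the derivative of the rescaled step
  \<open>smooth_step (m * (t - a))\<close>.\<close>

lemma mollifier_scaled_has_integral:
  fixes g :: "real \<Rightarrow> real"
  assumes g: "continuous_on UNIV g" and n: "0 < m" and sub: "{a..a + 1 / m} \<subseteq> {0..T}"
  shows "((\<lambda>t. m * mollifier (m * (t - a)) * g t) has_integral
      integral {0..1} (\<lambda>s. mollifier s * g (a + s / m))) {0..T}"
proof -
  let ?h = "\<lambda>s. mollifier s * g (a + s / m)"
  have "?h integrable_on {0..1}"
    using n by (intro integrable_continuous_real continuous_on_mult continuous_mollifier
        continuous_on_compose2[OF g]) (auto intro!: continuous_intros)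
  then have "(?h has_integral integral {0..1} ?h) (cbox 0 1)"
    by (simp add: integrable_integral)
  from has_integral_affinity'[OF this n, of "- (m * a)"]
  have "((\<lambda>t. ?h (m * t - m * a)) has_integral integral {0..1} ?h / m) {a..a + 1 / m}"
    using n by (simp add: field_simps)
  from has_integral_mult_right[OF this, of m]
  have "((\<lambda>t. m * ?h (m * t - m * a)) has_integral integral {0..1} ?h) {a..a + 1 / m}"
    using n by simp
  moreover have "m * ?h (m * t - m * a) = m * mollifier (m * (t - a)) * g t" for t
  proof -
    have "a + (m * t - m * a) / m = t" using n by (simp add: field_simps)
    then show ?thesis by (simp add: right_diff_distrib)
  qed
  ultimately have "((\<lambda>t. m * mollifier (m * (t - a)) * g t) has_integral integral {0..1} ?h) {a..a + 1 / m}"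
    by simp
  then show ?thesis
  proof (rule has_integral_on_superset[OF _ _ sub])
    fix t assume "t \<notin> {a..a + 1 / m}"
    then have "m * (t - a) \<le> 0 \<or> 1 \<le> m * (t - a)"
      using n by (auto simp: field_simps mult_le_0_iff)
    then show "m * mollifier (m * (t - a)) * g t = 0" by (simp add: mollifier_eq_0)
  qed
qed

text \<open>The test functions rise from 0 to 1 just after a and fall back just after b. Their
  derivatives concentrate at a and b, so one side of the weak identity tends to f a - f b and the
  other to minus the integral of \<open>p\<close> from a to b. Continuity of \<open>f\<close>
  extends the result to the end points 0 and T.\<close>

lemma weak_derivative_fundamental_theorem:
  fixes f p :: "real \<Rightarrow> real"
  assumes f: "continuous_on {0..T} f" and p: "integrable (lebesgue_on {0<..<T}) p"
    and weak: "\<And>\<phi>. test_function {0<..<T} \<phi> \<Longrightarrow>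
      (LINT t|lebesgue_on {0<..<T}. deriv \<phi> t * f t) = - (LINT t|lebesgue_on {0<..<T}. \<phi> t * p t)"
    and st: "0 \<le> s" "s \<le> t" "t \<le> T"
  shows "f t - f s = integral {s..t} p"
proof -
  let ?M = "lebesgue_on {0<..<T}"
  note sub = integrable_on_Icc_if_Ioo[OF p]
  have inner: "f b - f a = integral {a..b} p" if ab: "0 < a" "a < b" "b < T" for a b
  proof -
    \<comment> \<open>A continuous extension of \<open>f\<close>, constant to either side of the
      interval, so that the convergence of mollified values on the whole line applies.\<close>
    define g where "g t = f (max 0 (min T t))" for t
    have g: "continuous_on UNIV g"
      unfolding g_def by (rule continuous_on_compose2[OF f]) (use ab in \<open>auto intro!: continuous_intros\<close>)
    have gf: "g t = f t" if "t \<in> {0..T}" for t using that by (simp add: g_def)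
    define \<phi> where "\<phi> n t = smooth_step (real (Suc n) * (t - a)) - smooth_step (real (Suc n) * (t - b))" for n t
    define A where "A n a = integral {0..1} (\<lambda>s. mollifier s * g (a + s / real (Suc n)))" for n a
    \<comment> \<open>The fall of the test function ends at b + 1 / (n + 1), which has to stay below
      T; this holds from N on.\<close>
    obtain N where N: "1 / (T - b) \<le> real N" using real_arch_simple by blast
    have small: "b + 1 / real (Suc n) < T" if "N \<le> n" for n
    proof -
      have "1 / (T - b) < real (Suc n)" using N that by simp
      then show ?thesis using ab by (simp add: field_simps)
    qed
    have der: "(\<phi> n has_real_derivative
        (real (Suc n) * mollifier (real (Suc n) * (t - a)) - real (Suc n) * mollifier (real (Suc n) * (t - b)))) (at t)" for n t
      unfolding \<phi>_def
      by (auto intro!: derivative_eq_intros smooth_step_has_derivative[THEN DERIV_chain2])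
    have test: "test_function {0<..<T} (\<phi> n)" if n: "N \<le> n" for n
    proof -
      have st: "times_continuously_diff m (\<lambda>t. smooth_step (real (Suc n) * (t - c)))" for m c
        using tcd_compose_affine[OF tcd_smooth_step, of m "real (Suc n)" "- real (Suc n) * c"]
        by (simp add: algebra_simps)
      have "times_continuously_diff m (\<lambda>t. smooth_step (real (Suc n) * (t - a)) + (- 1) * smooth_step (real (Suc n) * (t - b)))" for m
        by (intro tcd_add tcd_mult tcd_const st)
      then have "times_continuously_diff m (\<phi> n)" for m
        by (simp add: \<phi>_def[abs_def])
      moreover have vanish: "\<phi> n t = 0" if "t \<notin> {a..b + 1 / real (Suc n)}" for t
      proof (cases "t < a")
        case True
        then show ?thesis using ab by (simp add: \<phi>_def smooth_step_eq_0 mult_nonneg_nonpos)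
      next
        case False
        then have "t - b > 1 / real (Suc n)" using that by auto
        then have "real (Suc n) * (t - b) \<ge> 1" by (simp add: field_simps)
        moreover have "real (Suc n) * (t - b) \<le> real (Suc n) * (t - a)"
          using ab by (intro mult_left_mono) auto
        ultimately show ?thesis by (simp only: \<phi>_def smooth_step_eq_1 order_trans[of 1 "real (Suc n) * (t - b)"])
      qed
      then have cl: "closure {t. \<phi> n t \<noteq> 0} \<subseteq> {a..b + 1 / real (Suc n)}"
        by (intro closure_minimal closed_atLeastAtMost) (use vanish in blast)
      moreover have "compact (closure {t. \<phi> n t \<noteq> 0})"
        using compact_Icc cl by (metis closed_closure compact_Int_closed inf.absorb_iff2)
      moreover have "{a..b + 1 / real (Suc n)} \<subseteq> {0<..<T}"
        using ab small[OF n] by auto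
      ultimately show ?thesis unfolding test_function_def by blast
    qed
    have left: "(LINT t|?M. deriv (\<phi> n) t * f t) = A n a - A n b" if n: "N \<le> n" for n
    proof -
      let ?h = "\<lambda>t. deriv (\<phi> n) t * g t"
      have eq: "?h = (\<lambda>t. real (Suc n) * mollifier (real (Suc n) * (t - a)) * g t -
          real (Suc n) * mollifier (real (Suc n) * (t - b)) * g t)"
        using der[THEN DERIV_imp_deriv] by (simp add: fun_eq_iff left_diff_distrib)
      have "1 / real (Suc n) > 0" by simp
      with small[OF n] ab have "{a..a + 1 / real (Suc n)} \<subseteq> {0..T}" "{b..b + 1 / real (Suc n)} \<subseteq> {0..T}"
        by auto
      then have hi: "(?h has_integral (A n a - A n b)) {0..T}"
        unfolding eq A_def by (intro has_integral_diff mollifier_scaled_has_integral g) auto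
      have "continuous_on {0..T} ?h"
        unfolding eq
        by (intro continuous_intros continuous_on_compose2[OF continuous_mollifier]
            continuous_on_subset[OF g]) auto
      then have "set_integrable lebesgue {0..T} ?h"
        by (rule absolutely_integrable_continuous_real)
      then have "set_integrable lebesgue {0<..<T} ?h"
        by (rule set_integrable_subset) auto
      then have "(LINT t|?M. ?h t) = integral {0<..<T} ?h"
        by (intro lebesgue_integral_eq_integral) (simp_all add: integrable_lebesgue_on_iff)
      also have "\<dots> = A n a - A n b"
        using hi has_integral_Icc_iff_Ioo by (metis integral_unique)
      also have "(LINT t|?M. ?h t) = (LINT t|?M. deriv (\<phi> n) t * f t)"
        by (intro Bochner_Integration.integral_cong) (auto simp: gf)
      finally show ?thesis .
    qed
    have "(\<lambda>n. A n a - A n b) \<longlonglongrightarrow> g a - g b"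
      unfolding A_def by (intro tendsto_diff mollified_tendsto g)
    then have "(\<lambda>n. LINT t|?M. deriv (\<phi> n) t * f t) \<longlonglongrightarrow> g a - g b"
      by (rule Lim_transform_eventually) (rule eventually_sequentiallyI[of N], simp add: left)
    moreover have "(\<lambda>n. - (LINT t|?M. \<phi> n t * p t)) \<longlonglongrightarrow> - (LINT t|?M. indicator {a<..b} t * p t)"
    proof (intro tendsto_minus integral_dominated_convergence)
      have pm: "p \<in> borel_measurable ?M" using p by (rule borel_measurable_integrable)
      have "continuous_on UNIV (\<phi> n)" for n
        using der DERIV_isCont by (metis continuous_at_imp_continuous_on)
      then have "\<phi> n \<in> borel_measurable ?M" for n
        using borel_measurable_continuous_onI[of "\<phi> n"]
        by (intro measurable_restrict_space1 measurable_completion) simp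
      then show "(\<lambda>t. \<phi> n t * p t) \<in> borel_measurable ?M" for n
        using pm by (rule borel_measurable_times)
      show "(\<lambda>t. indicator {a<..b} t * p t) \<in> borel_measurable ?M"
        using pm by (intro borel_measurable_times borel_measurable_indicator sets_restrict_space_iff[THEN iffD2]) (use ab in auto)
      show "integrable ?M (\<lambda>t. norm (p t))" using p by (rule integrable_norm)
      \<comment> \<open>A step vanishes at its own base point, so the limit is the indicator of the
        half-open interval.\<close>
      have "(\<lambda>n. smooth_step (real (Suc n) * (t - c))) \<longlonglongrightarrow> (if t - c > 0 then 1 else 0)" for t c
        using LIMSEQ_Suc[OF smooth_step_scaled_tendsto] .
      then have "(\<lambda>n. \<phi> n t) \<longlonglongrightarrow> (if t - a > 0 then 1 else 0) - (if t - b > 0 then 1 else 0)" for t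
        unfolding \<phi>_def by (intro tendsto_diff)
      moreover have "(if t - a > 0 then 1 else 0) - (if t - b > 0 then 1 else 0) = (indicator {a<..b} t :: real)" for t
        using ab by (auto simp: indicator_def)
      ultimately show "AE t in ?M. (\<lambda>n. \<phi> n t * p t) \<longlonglongrightarrow> indicator {a<..b} t * p t"
        by (intro AE_I2 tendsto_mult tendsto_const) metis
      have "\<bar>\<phi> n t\<bar> \<le> 1" for n t
        unfolding \<phi>_def using smooth_step_bounds[of "real (Suc n) * (t - a)"] smooth_step_bounds[of "real (Suc n) * (t - b)"]
        by linarith
      then show "AE t in ?M. norm (\<phi> n t * p t) \<le> norm (p t)" for n
        by (intro AE_I2) (simp add: abs_mult mult_left_le_one_le)
    qed
    then have "(\<lambda>n. LINT t|?M. deriv (\<phi> n) t * f t) \<longlonglongrightarrow> - (LINT t|?M. indicator {a<..b} t * p t)"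
      by (rule Lim_transform_eventually) (rule eventually_sequentiallyI[of N], simp only: weak[OF test])
    ultimately have "g a - g b = - (LINT t|?M. indicator {a<..b} t * p t)"
      by (rule LIMSEQ_unique)
    also have "(LINT t|?M. indicator {a<..b} t * p t) = (LINT t|lebesgue. indicator {a<..b} t * p t)"
      by (rule integral_lebesgue_on_vanishing) (use ab in auto)
    also have "\<dots> = integral {a<..b} p"
    proof -
      have "set_integrable lebesgue {0<..<T} p"
        using p by (simp add: integrable_lebesgue_on_iff)
      then have "set_integrable lebesgue {a<..b} p"
        by (rule set_integrable_subset) (use ab in auto)
      from set_lebesgue_integral_eq_integral(2)[OF this] show ?thesis
        by (simp add: set_lebesgue_integral_def)
    qed
    also have "integral {a<..b} p = integral {a..b} p"
      by (rule integral_subset_negligible) (auto intro: negligible_subset[OF negligible_sing[of a]])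
    finally show ?thesis using gf[of a] gf[of b] ab by simp
  qed
  show ?thesis
  proof (cases "s = t")
    case False
    then have T: "0 < T" using st by linarith
    \<comment> \<open>By \<open>inner\<close> this function is constant on the open interval. The
      midpoint T / 2 serves as reference, and continuity reaches 0 and T.\<close>
    define h where "h t = f t - integral {0..t} p" for t
    have h: "continuous_on {0..T} h"
      unfolding h_def by (intro continuous_on_diff f indefinite_integral_continuous_1 sub) auto
    have const: "h r = h (T / 2)" if r: "r \<in> {0..T}" for r
    proof (rule continuous_constant_on_closure[of "{0<..<T}" h])
      show "continuous_on (closure {0<..<T}) h" using h T by simp
      show "r \<in> closure {0<..<T}" using r T by simp
      have *: "h b = h a" if "0 < a" "a < b" "b < T" for a b
        using inner[OF that] Henstock_Kurzweil_Integration.integral_combine[of 0 a b p] sub[of 0 b] that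
        by (simp add: h_def)
      fix x assume "x \<in> {0<..<T}"
      then show "h x = h (T / 2)"
        using *[of x "T / 2"] *[of "T / 2" x] T by (cases x "T / 2" rule: linorder_cases) auto
    qed
    have "h t = h s" using const[of t] const[of s] st by force
    moreover have "integral {0..s} p + integral {s..t} p = integral {0..t} p"
      using st sub[of 0 t] by (intro Henstock_Kurzweil_Integration.integral_combine) auto
    ultimately show ?thesis by (simp add: h_def)
  qed simp
qed

section \<open>The energy inequality\<close>

lemma integral_AE_mono:
  fixes p q :: "real \<Rightarrow> real"
  assumes p: "integrable (lebesgue_on {0<..<T}) p" and q: "integrable (lebesgue_on {0<..<T}) q"
    and ae: "AE r in lebesgue_on {0<..<T}. p r \<le> q r" and ab: "0 \<le> a" "b \<le> T"
  shows "integral {a..b} p \<le> integral {a..b} q"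
proof -
  have sub: "integrable (lebesgue_on {a<..<b}) f" if "integrable (lebesgue_on {0<..<T}) f" for f :: "real \<Rightarrow> real"
  proof -
    have "set_integrable lebesgue {0<..<T} f" using that by (simp add: integrable_lebesgue_on_iff)
    then have "set_integrable lebesgue {a<..<b} f"
    proof (rule set_integrable_subset)
      show "{a<..<b} \<subseteq> {0<..<T}" using ab by auto
    qed simp
    then show ?thesis by (simp add: integrable_lebesgue_on_iff)
  qed
  have eq: "integral {a..b} f = (LINT r|lebesgue_on {a<..<b}. f r)"
    if "integrable (lebesgue_on {0<..<T}) f" for f :: "real \<Rightarrow> real"
    using lebesgue_integral_eq_integral[OF sub[OF that]] by (simp add: integral_open_interval_real)
  have "AE r in lebesgue. r \<in> {0<..<T} \<longrightarrow> p r \<le> q r"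
    using ae by (simp add: AE_restrict_space_iff)
  then have "AE r in lebesgue. r \<in> {a<..<b} \<longrightarrow> p r \<le> q r"
    by eventually_elim (use ab in simp)
  then have "AE r in lebesgue_on {a<..<b}. p r \<le> q r"
    by (simp add: AE_restrict_space_iff)
  then show ?thesis
    unfolding eq[OF p] eq[OF q] by (rule integral_mono_AE[OF sub[OF p] sub[OF q]])
qed

lemma integral_AE_bound:
  fixes q :: "real \<Rightarrow> real"
  assumes q: "integrable (lebesgue_on {0<..<T}) q" and ae: "AE r in lebesgue_on {0<..<T}. \<bar>q r\<bar> \<le> K"
    and ab: "0 \<le> a" "a \<le> b" "b \<le> T"
  shows "\<bar>integral {a..b} q\<bar> \<le> K * (b - a)"
proof -
  have const: "integrable (lebesgue_on {0<..<T}) (\<lambda>_. c)" for c :: real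
    by (intro finite_measure.integrable_const finite_measure_lebesgue_on) simp
  have "AE r in lebesgue_on {0<..<T}. q r \<le> K" "AE r in lebesgue_on {0<..<T}. - K \<le> q r"
    using ae by (eventually_elim, linarith)+
  from integral_AE_mono[OF q const this(1) ab(1,3)] integral_AE_mono[OF const q this(2) ab(1,3)]
  show ?thesis using ab(2) by (simp add: abs_le_iff mult.commute)
qed

text \<open>The library provides averages to the right of a point only, hence the reflection.\<close>

lemma lebesgue_differentiation_left:
  fixes p :: "real \<Rightarrow> real"
  assumes p: "integrable (lebesgue_on {0<..<T}) p"
  shows "AE \<sigma> in lebesgue_on {0<..<T}.
    (\<lambda>n. real (Suc n) * integral {\<sigma> - 1 / real (Suc n)..\<sigma>} p) \<longlonglongrightarrow> p \<sigma>"
proof -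
  define P where "P \<sigma> = indicator {0<..<T} \<sigma> * p \<sigma>" for \<sigma>
  define q where "q x = P (- x)" for x
  have "integrable lebesgue P"
    using p by (simp add: integrable_lebesgue_on_iff set_integrable_def P_def[abs_def])
  then have Pu: "P integrable_on UNIV" by (rule integrable_on_lebesgue)
  have "q integrable_on cbox a b" for a b
  proof -
    have "P integrable_on {- b..- a}" by (rule integrable_on_subinterval[OF Pu]) simp
    then have "(\<lambda>x. P (- x)) integrable_on {- (- a)..- (- b)}"
      by (rule Henstock_Kurzweil_Integration.integrable_reflect_real[where f = P and a = "- b" and b = "- a", THEN iffD2])
    then show ?thesis by (simp add: q_def[abs_def])
  qed
  then obtain N where N: "negligible N" "\<And>x e. x \<notin> N \<Longrightarrow> 0 < e \<Longrightarrow>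
      \<exists>d>0. \<forall>h. 0 < h \<and> h < d \<longrightarrow>
        norm (integral (cbox x (x + h *\<^sub>R One)) q /\<^sub>R h ^ DIM(real) - q x) < e"
    using integrable_ccontinuous_explicit by blast
  have "(\<lambda>n. real (Suc n) * integral {\<sigma> - 1 / real (Suc n)..\<sigma>} p) \<longlonglongrightarrow> p \<sigma>"
    if \<sigma>: "0 < \<sigma>" "\<sigma> < T" "\<sigma> \<notin> uminus ` N" for \<sigma>
  proof (rule LIMSEQ_I)
    fix e :: real assume e: "0 < e"
    have "- \<sigma> \<notin> N" using \<sigma>(3) by force
    from N(2)[OF this e] obtain d where d: "d > 0" and d': "\<forall>h. 0 < h \<and> h < d \<longrightarrow>
        norm (integral (cbox (- \<sigma>) (- \<sigma> + h *\<^sub>R One)) q /\<^sub>R h ^ DIM(real) - q (- \<sigma>)) < e"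
      by blast
    have d'': "\<bar>integral {- \<sigma>..- \<sigma> + h} q / h - q (- \<sigma>)\<bar> < e" if "0 < h" "h < d" for h
      using d'[rule_format, of h] that by (simp add: divide_inverse mult.commute)
    obtain m where m: "1 / real (Suc m) < min d \<sigma>"
      using nat_approx_posE[of "min d \<sigma>"] d \<sigma>(1) by auto
    show "\<exists>no. \<forall>n\<ge>no. norm (real (Suc n) * integral {\<sigma> - 1 / real (Suc n)..\<sigma>} p - p \<sigma>) < e"
    proof (intro exI allI impI)
      fix n assume "m \<le> n"
      then have "1 / real (Suc n) \<le> 1 / real (Suc m)" by (simp add: field_simps)
      then have h: "1 / real (Suc n) < d" "1 / real (Suc n) < \<sigma>" using m by auto
      have "integral {- \<sigma>..- \<sigma> + 1 / real (Suc n)} q = integral {- \<sigma>..- (\<sigma> - 1 / real (Suc n))} (\<lambda>x. P (- x))"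
        by (simp add: q_def[abs_def])
      also have "\<dots> = integral {\<sigma> - 1 / real (Suc n)..\<sigma>} P"
        by (rule Henstock_Kurzweil_Integration.integral_reflect_real)
      also have "\<dots> = integral {\<sigma> - 1 / real (Suc n)..\<sigma>} p"
        using h(2) \<sigma> by (intro integral_cong) (auto simp: P_def)
      finally have "integral {- \<sigma>..- \<sigma> + 1 / real (Suc n)} q / (1 / real (Suc n)) =
          real (Suc n) * integral {\<sigma> - 1 / real (Suc n)..\<sigma>} p" by simp
      then show "norm (real (Suc n) * integral {\<sigma> - 1 / real (Suc n)..\<sigma>} p - p \<sigma>) < e"
        using d''[of "1 / real (Suc n)"] h(1) \<sigma> by (simp add: q_def P_def mult.commute)
    qed
  qed
  moreover have "uminus ` N \<in> null_sets lebesgue"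
  proof -
    have "(indicator (uminus ` N) has_integral (0::real)) (cbox a b)" for a b
    proof -
      have "(indicator N has_integral (0::real)) {- b..- a}"
        using N(1) by (simp add: negligible_def flip: box_real)
      then have "((\<lambda>x. indicator N (- x)) has_integral (0::real)) {a..b}"
        using has_integral_reflect_real[of "indicator N" "0::real" "- a" "- b"] by simp
      moreover have "(\<lambda>x. indicator N (- x)) = (indicator (uminus ` N) :: real \<Rightarrow> real)"
        by (force simp: fun_eq_iff indicator_def)
      ultimately show ?thesis by simp
    qed
    then show ?thesis by (simp add: negligible_def flip: negligible_iff_null_sets)
  qed
  ultimately have "AE \<sigma> in lebesgue. \<sigma> \<in> {0<..<T} \<longrightarrow>
      (\<lambda>n. real (Suc n) * integral {\<sigma> - 1 / real (Suc n)..\<sigma>} p) \<longlonglongrightarrow> p \<sigma>"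
    by (intro AE_I'[of "uminus ` N"]) auto
  then show ?thesis by (simp add: AE_restrict_space_iff)
qed

text \<open>The intervals may move while they shrink towards x. The lemma thus serves at both ends
  of the time interval in \<open>energy_inequality\<close>, for averages before t and for averages
  after 0.\<close>

lemma averages_tendsto:
  fixes e :: "real \<Rightarrow> real"
  assumes e: "continuous_on {0..T} e" and x: "x \<in> {0..T}" and h: "\<And>n. 0 < h n"
    and lim: "a \<longlonglongrightarrow> x" "(\<lambda>n. a n + h n) \<longlonglongrightarrow> x"
    and sub: "eventually (\<lambda>n. 0 \<le> a n \<and> a n + h n \<le> T) sequentially"
  shows "(\<lambda>n. integral {a n..a n + h n} e / h n) \<longlonglongrightarrow> e x"
proof (rule tendstoI)
  fix \<epsilon> :: real assume \<epsilon>: "0 < \<epsilon>"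
  then obtain d where d: "d > 0" "\<And>y. y \<in> {0..T} \<Longrightarrow> dist y x < d \<Longrightarrow> dist (e y) (e x) < \<epsilon> / 2"
    using e x unfolding continuous_on_iff by (metis half_gt_zero)
  show "eventually (\<lambda>n. dist (integral {a n..a n + h n} e / h n) (e x) < \<epsilon>) sequentially"
    using tendstoD[OF lim(1) d(1)] tendstoD[OF lim(2) d(1)] sub
  proof eventually_elim
    case (elim n)
    have c: "continuous_on {a n..a n + h n} e"
      by (rule continuous_on_subset[OF e]) (use elim in auto)
    have "norm (integral {a n..a n + h n} (\<lambda>y. e y - e x)) \<le> \<epsilon> / 2 * (a n + h n - a n)"
    proof (rule integral_bound)
      show "continuous_on {a n..a n + h n} (\<lambda>y. e y - e x)" by (intro continuous_intros c)
      fix y assume y: "y \<in> {a n..a n + h n}"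
      then have "dist y x < d" "y \<in> {0..T}" using elim by (auto simp: dist_real_def)
      then show "norm (e y - e x) \<le> \<epsilon> / 2" using d(2)[of y] by (simp add: dist_norm)
    qed (use h[of n] in simp)
    moreover have "integral {a n..a n + h n} (\<lambda>y. e y - e x) = integral {a n..a n + h n} e - h n * e x"
      using h[of n] by (subst Henstock_Kurzweil_Integration.integral_diff)
        (auto intro: integrable_continuous_real c)
    ultimately have "\<bar>integral {a n..a n + h n} e - h n * e x\<bar> \<le> \<epsilon> / 2 * h n" by simp
    moreover have "integral {a n..a n + h n} e / h n - e x = (integral {a n..a n + h n} e - h n * e x) / h n"
      using h[of n] by (simp add: field_simps)
    ultimately have "\<bar>integral {a n..a n + h n} e / h n - e x\<bar> \<le> \<epsilon> / 2"
      using h[of n] by (simp add: field_simps)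
    then show ?case using \<epsilon> by (simp add: dist_real_def)
  qed
qed

text \<open>A common form for both equations. For \<open>u\<close> the test space is
  \<open>space_V\<close> and \<open>L r\<close> is a functional on it; for \<open>H\<close> the test
  space is \<open>L2_space\<close> and \<open>L r\<close> is the pairing with the time derivative.
  The end points 0 and T are included, as \<open>z\<close> stands for a continuous
  representative.\<close>

definition tested_derivative :: "'a::euclidean_space set \<Rightarrow> real \<Rightarrow> ('a \<Rightarrow> 'b::euclidean_space) set \<Rightarrow>
    (real \<Rightarrow> 'a \<Rightarrow> 'b) \<Rightarrow> (real \<Rightarrow> ('a \<Rightarrow> 'b) \<Rightarrow> real) \<Rightarrow> bool" where
  "tested_derivative G T V z L \<longleftrightarrow> (\<forall>v\<in>V. integrable (lebesgue_on {0<..<T}) (\<lambda>r. L r v) \<and>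
     (\<forall>s t. 0 \<le> s \<longrightarrow> s \<le> t \<longrightarrow> t \<le> T \<longrightarrow>
        L2_inner G (z t) v - L2_inner G (z s) v = integral {s..t} (\<lambda>r. L r v)))"

lemma tested_derivativeD:
  assumes "tested_derivative G T V z L" "v \<in> V"
  shows "integrable (lebesgue_on {0<..<T}) (\<lambda>r. L r v)"
    and "0 \<le> s \<Longrightarrow> s \<le> t \<Longrightarrow> t \<le> T \<Longrightarrow>
      L2_inner G (z t) v - L2_inner G (z s) v = integral {s..t} (\<lambda>r. L r v)"
  using assms by (auto simp: tested_derivative_def)

lemma null_comparison_within:
  fixes f g :: "real \<Rightarrow> real"
  assumes "(g \<longlongrightarrow> 0) (at t within S)" "\<And>s. s \<in> S \<Longrightarrow> \<bar>f s\<bar> \<le> g s"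
  shows "(f \<longlongrightarrow> 0) (at t within S)"
  by (rule Lim_null_comparison[OF _ assms(1)]) (use assms(2) in \<open>auto simp: eventually_at_filter\<close>)

locale L2_curve =
  fixes G :: "'a::euclidean_space set" and T :: real and z :: "real \<Rightarrow> 'a \<Rightarrow> 'b::euclidean_space"
  assumes T_pos: "0 < T"
    and z_L2: "\<And>t. t \<in> {0..T} \<Longrightarrow> z t \<in> L2_space G"
    and z_cont: "\<And>t. t \<in> {0..T} \<Longrightarrow>
      ((\<lambda>s. L2_norm G (\<lambda>x. z s x - z t x)) \<longlongrightarrow> 0) (at t within {0..T})"
begin

lemma norm_continuous: "continuous_on {0..T} (\<lambda>t. L2_norm G (z t))"
  unfolding continuous_on_def
proof
  fix t assume t: "t \<in> {0..T}"
  have "((\<lambda>s. L2_norm G (z s) - L2_norm G (z t)) \<longlongrightarrow> 0) (at t within {0..T})"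
    by (rule null_comparison_within[OF z_cont[OF t] L2_norm_triangle_diff[OF z_L2 z_L2[OF t]]])
  then show "((\<lambda>s. L2_norm G (z s)) \<longlongrightarrow> L2_norm G (z t)) (at t within {0..T})"
    by (rule LIM_zero_cancel)
qed

lemma norm_bounded: obtains R where "\<And>t. t \<in> {0..T} \<Longrightarrow> L2_norm G (z t) \<le> R" "0 \<le> R"
proof -
  have "compact ((\<lambda>t. L2_norm G (z t)) ` {0..T})"
    by (intro compact_continuous_image norm_continuous) simp
  then obtain R where "\<And>t. t \<in> {0..T} \<Longrightarrow> norm (L2_norm G (z t)) \<le> R"
    using compact_imp_bounded bounded_iff by (metis imageI)
  then show ?thesis using L2_norm_nonneg T_pos that[of R]
    by (metis abs_of_nonneg atLeastAtMost_iff less_eq_real_def order_trans real_norm_def)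
qed

text \<open>Two time arguments are allowed because the quotients below pair
  \<open>z (r - h n)\<close> with \<open>z r\<close>. The difference is split bilinearly, with the
  uniform bound \<open>R\<close> on the factor that is kept.\<close>

lemma inner_continuous:
  fixes f g :: "real \<Rightarrow> real"
  assumes f: "continuous_on S f" "f ` S \<subseteq> {0..T}" and g: "continuous_on S g" "g ` S \<subseteq> {0..T}"
  shows "continuous_on S (\<lambda>s. L2_inner G (z (f s)) (z (g s)))"
  unfolding continuous_on_def
proof
  fix t assume t: "t \<in> S"
  obtain R where R: "\<And>t. t \<in> {0..T} \<Longrightarrow> L2_norm G (z t) \<le> R" "0 \<le> R" using norm_bounded by blast
  have lim: "((\<lambda>s. L2_norm G (\<lambda>x. z (f s) x - z (f t) x)) \<longlongrightarrow> 0) (at t within S)"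
    if f: "continuous_on S f" "f ` S \<subseteq> {0..T}" for f
  proof -
    have "f t \<in> {0..T}" using f t by auto
    then have "continuous (at (f t) within {0..T}) (\<lambda>s. L2_norm G (\<lambda>x. z s x - z (f t) x))"
      using z_cont[of "f t"] by (simp add: continuous_within L2_norm_def)
    moreover have "eventually (\<lambda>s. f s \<in> {0..T}) (at t within S)"
      using f(2) 
      by (auto simp: eventually_at_filter image_subset_iff intro!: always_eventually)
    moreover have "(f \<longlongrightarrow> f t) (at t within S)" using f t by (simp add: continuous_on_def)
    ultimately have "((\<lambda>s. L2_norm G (\<lambda>x. z (f s) x - z (f t) x)) \<longlongrightarrow> L2_norm G (\<lambda>x. z (f t) x - z (f t) x)) (at t within S)"
      by (rule continuous_within_tendsto_compose)
    then show ?thesis by (simp add: L2_norm_def)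
  qed
  have "((\<lambda>s. L2_inner G (z (f s)) (z (g s)) - L2_inner G (z (f t)) (z (g t))) \<longlongrightarrow> 0) (at t within S)"
  proof (rule null_comparison_within)
    show "((\<lambda>s. L2_norm G (\<lambda>x. z (f s) x - z (f t) x) * R + R * L2_norm G (\<lambda>x. z (g s) x - z (g t) x)) \<longlongrightarrow> 0) (at t within S)"
      using tendsto_add[OF tendsto_mult_left_zero[OF lim[OF f]] tendsto_mult_right_zero[OF lim[OF g]]] by simp
    show "\<bar>L2_inner G (z (f s)) (z (g s)) - L2_inner G (z (f t)) (z (g t))\<bar>
        \<le> L2_norm G (\<lambda>x. z (f s) x - z (f t) x) * R + R * L2_norm G (\<lambda>x. z (g s) x - z (g t) x)"
      if s: "s \<in> S" for s
    proof -
      have I: "f s \<in> {0..T}" "g s \<in> {0..T}" "f t \<in> {0..T}" "g t \<in> {0..T}" using f g s t by auto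
      note Z = I[THEN z_L2]
      have "L2_inner G (z (f s)) (z (g s)) - L2_inner G (z (f t)) (z (g t)) =
          L2_inner G (\<lambda>x. z (f s) x - z (f t) x) (z (g s)) + L2_inner G (z (f t)) (\<lambda>x. z (g s) x - z (g t) x)"
        using L2_inner_diff_left[OF Z(1,3,2)] L2_inner_diff_right[OF Z(2,4,3)] by simp
      moreover have "\<bar>L2_inner G (\<lambda>x. z (f s) x - z (f t) x) (z (g s))\<bar> \<le> L2_norm G (\<lambda>x. z (f s) x - z (f t) x) * R"
        by (rule order_trans[OF L2_Cauchy_Schwarz[OF L2_space_diff[OF Z(1,3)] Z(2)]])
           (intro mult_left_mono R I L2_norm_nonneg)
      moreover have "\<bar>L2_inner G (z (f t)) (\<lambda>x. z (g s) x - z (g t) x)\<bar> \<le> R * L2_norm G (\<lambda>x. z (g s) x - z (g t) x)"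
        by (rule order_trans[OF L2_Cauchy_Schwarz[OF Z(3) L2_space_diff[OF Z(2,4)]]])
           (intro mult_right_mono R I L2_norm_nonneg)
      ultimately show ?thesis by linarith
    qed
  qed
  then show "((\<lambda>s. L2_inner G (z (f s)) (z (g s))) \<longlongrightarrow> L2_inner G (z (f t)) (z (g t))) (at t within S)"
    by (rule LIM_zero_cancel)
qed

lemma inner_const_continuous:
  assumes v: "v \<in> L2_space G"
  shows "continuous_on {0..T} (\<lambda>t. L2_inner G (z t) v)"
  unfolding continuous_on_def
proof
  fix t assume t: "t \<in> {0..T}"
  have "((\<lambda>s. L2_inner G (z s) v - L2_inner G (z t) v) \<longlongrightarrow> 0) (at t within {0..T})"
  proof (rule null_comparison_within[OF tendsto_mult_left_zero[OF z_cont[OF t], of "L2_norm G v"]])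
    fix s assume s: "s \<in> {0..T}"
    show "\<bar>L2_inner G (z s) v - L2_inner G (z t) v\<bar> \<le> L2_norm G (\<lambda>x. z s x - z t x) * L2_norm G v"
      using L2_Cauchy_Schwarz[OF L2_space_diff[OF z_L2[OF s] z_L2[OF t]] v]
        L2_inner_diff_left[OF z_L2[OF s] z_L2[OF t] v] by simp
  qed
  then show "((\<lambda>s. L2_inner G (z s) v) \<longlongrightarrow> L2_inner G (z t) v) (at t within {0..T})"
    by (rule LIM_zero_cancel)
qed

text \<open>The gap between the two sides is the squared distance of \<open>z s\<close> and
  \<open>z t\<close>.\<close>

lemma norm_sq_difference_quotient_le:
  assumes "s \<in> {0..T}" "t \<in> {0..T}"
  shows "(L2_norm G (z t))\<^sup>2 - (L2_norm G (z s))\<^sup>2 \<le> 2 * ((L2_norm G (z t))\<^sup>2 - L2_inner G (z s) (z t))"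
proof -
  have "0 \<le> (L2_norm G (\<lambda>x. z s x - z t x))\<^sup>2" by simp
  then show ?thesis
    unfolding L2_norm_diff_sq[OF assms[THEN z_L2]] by simp
qed

end

lemma abs_divide_le: "\<bar>x\<bar> \<le> K * h \<Longrightarrow> 0 < h \<Longrightarrow> \<bar>x / h\<bar> \<le> K" for x :: real
  by (simp add: abs_divide pos_divide_le_eq)

context L2_curve
begin

text \<open>The quotient \<open>D n r\<close> is the average of \<open>L s (z r)\<close> over the
  times s in an interval of length \<open>h n\<close> ending at r, with the vector frozen at time r.
  For a fixed vector such averages converge off a null set, but that set depends on the vector and
  here the vector depends on r. For all vectors of the countable \<open>S\<close> one null set
  suffices, and the error made by replacing \<open>z r\<close> is controlled by \<open>M\<close>,
  uniformly in time.\<close>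

lemma energy_inequality:
  fixes L :: "real \<Rightarrow> ('a \<Rightarrow> 'b) \<Rightarrow> real" and nrm :: "('a \<Rightarrow> 'b) \<Rightarrow> real"
  assumes S: "countable S" "S \<subseteq> V" and M: "0 \<le> M"
    and V_diff: "\<And>v w. v \<in> V \<Longrightarrow> w \<in> V \<Longrightarrow> (\<lambda>x. v x - w x) \<in> V"
    and deriv: "tested_derivative G T V z L"
    and nrm_nonneg: "\<And>v. 0 \<le> nrm v"
    and L_bound: "AE r in lebesgue_on {0<..<T}. \<forall>v\<in>V. \<bar>L r v\<bar> \<le> M * nrm v"
    and L_diff: "AE r in lebesgue_on {0<..<T}. \<forall>v\<in>V. \<forall>w\<in>V. L r (\<lambda>x. v x - w x) = L r v - L r w"
    and zV: "AE r in lebesgue_on {0<..<T}. z r \<in> V \<and> nrm (z r) \<le> B"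
    and dense: "AE r in lebesgue_on {0<..<T}. \<forall>\<epsilon>>0. \<exists>v\<in>S. nrm (\<lambda>x. z r x - v x) < \<epsilon>"
  shows "integrable (lebesgue_on {0<..<T}) (\<lambda>r. L r (z r))"
    and "t \<in> {0..T} \<Longrightarrow> (L2_norm G (z t))\<^sup>2 - (L2_norm G (z 0))\<^sup>2 \<le>
      2 * integral {0..t} (\<lambda>r. L r (z r))"
proof -
  let ?M = "lebesgue_on {0<..<T}"
  note L_int = tested_derivativeD(1)[OF deriv] and ftc = tested_derivativeD(2)[OF deriv]
  \<comment> \<open>From here on \<open>L_diff\<close> denotes the Lipschitz bound that combines the
    additivity and the boundedness of \<open>L r\<close>.\<close>
  have L_diff: "AE r in ?M. \<forall>v\<in>V. \<forall>w\<in>V. \<bar>L r v - L r w\<bar> \<le> M * nrm (\<lambda>x. v x - w x)"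
    using L_bound L_diff
  proof eventually_elim
    case (elim r)
    show ?case
    proof (intro ballI)
      fix v w assume v: "v \<in> V" and w: "w \<in> V"
      have "\<bar>L r (\<lambda>x. v x - w x)\<bar> \<le> M * nrm (\<lambda>x. v x - w x)"
        by (rule elim(1)[THEN bspec, OF V_diff[OF v w]])
      moreover have "L r (\<lambda>x. v x - w x) = L r v - L r w"
        by (rule elim(2)[THEN bspec, OF v, THEN bspec, OF w])
      ultimately show "\<bar>L r v - L r w\<bar> \<le> M * nrm (\<lambda>x. v x - w x)" by (simp only:)
    qed
  qed
  define h where "h n = 1 / real (Suc n)" for n
  have h: "0 < h n" for n by (simp add: h_def)
  have h0: "h \<longlonglongrightarrow> 0" unfolding h_def[abs_def] using LIMSEQ_inverse_real_of_nat by (simp add: inverse_eq_divide)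
  define c where "c s t = L2_inner G (z s) (z t)" for s t
  \<comment> \<open>A backward difference quotient in the first argument of \<open>c\<close> only.
    The cutoff keeps \<open>r - h n\<close> positive.\<close>
  define D where "D n r = indicator {h n<..<T} r * ((c r r - c (r - h n) r) / h n)" for n r
  have D_eq: "D n r = integral {r - h n..r} (\<lambda>s. L s (z r)) / h n"
    if "z r \<in> V" "h n < r" "r < T" for n r
    using ftc[OF that(1), of "r - h n" r] that h[of n] by (simp add: D_def c_def)
  have c_cont: "continuous_on {h n..T} (\<lambda>r. (c r r - c (r - h n) r) / h n)" for n
    unfolding c_def
    by (intro continuous_on_divide continuous_on_diff inner_continuous continuous_intros)
       (use h[of n] in auto)
  have D_meas: "D n \<in> borel_measurable ?M" for n
  proof -
    have "(\<lambda>r. if r \<in> {h n..T} then (c r r - c (r - h n) r) / h n else 0) \<in> borel_measurable borel"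
      by (rule borel_measurable_continuous_on_if) (auto intro: c_cont)
    then have "(\<lambda>r. indicator {h n<..<T} r * (if r \<in> {h n..T} then (c r r - c (r - h n) r) / h n else 0)) \<in> borel_measurable borel"
      by (intro borel_measurable_times borel_measurable_indicator) auto
    also have "(\<lambda>r. indicator {h n<..<T} r * (if r \<in> {h n..T} then (c r r - c (r - h n) r) / h n else 0)) = D n"
      by (auto simp: D_def fun_eq_iff indicator_def)
    finally show ?thesis by (intro measurable_restrict_space1 measurable_completion) simp
  qed
  have int_sub: "(\<lambda>s. L s v) integrable_on {a..b}" if "v \<in> V" "0 \<le> a" "b \<le> T" for v a b
    by (rule integrable_on_Icc_if_Ioo[OF L_int[OF that(1)] that(2,3)])
  have D_bound: "AE r in ?M. \<forall>n. \<bar>D n r\<bar> \<le> M * B"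
    using zV AE_space
  proof eventually_elim
    case (elim r)
    have MB: "M * nrm (z r) \<le> M * B" using elim M by (intro mult_left_mono) auto
    have pos: "0 \<le> M * nrm (z r)" by (intro mult_nonneg_nonneg M nrm_nonneg)
    show ?case
    proof
      fix n
      show "\<bar>D n r\<bar> \<le> M * B"
      proof (cases "h n < r")
        case True
        have "\<bar>integral {r - h n..r} (\<lambda>s. L s (z r))\<bar> \<le> M * nrm (z r) * (r - (r - h n))"
        proof (rule integral_AE_bound[OF L_int])
          show "AE s in ?M. \<bar>L s (z r)\<bar> \<le> M * nrm (z r)"
            using L_bound by eventually_elim (use elim in blast)
        qed (use elim True h[of n] pos in auto)
        then have "\<bar>integral {r - h n..r} (\<lambda>s. L s (z r)) / h n\<bar> \<le> M * nrm (z r)"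
          by (intro abs_divide_le h) simp
        then have "\<bar>D n r\<bar> \<le> M * nrm (z r)"
          using D_eq[of r n] elim True by simp
        with MB show ?thesis by linarith
      next
        case False
        then show ?thesis using pos MB by (simp add: D_def)
      qed
    qed
  qed
  have "AE r in ?M. \<forall>v\<in>S. (\<lambda>n. real (Suc n) * integral {r - 1 / real (Suc n)..r} (\<lambda>s. L s v)) \<longlonglongrightarrow> L r v"
  proof (subst AE_ball_countable[OF S(1)], intro ballI)
    fix v assume "v \<in> S"
    then show "AE r in ?M. (\<lambda>n. real (Suc n) * integral {r - 1 / real (Suc n)..r} (\<lambda>s. L s v)) \<longlonglongrightarrow> L r v"
      using S(2) by (intro lebesgue_differentiation_left L_int) blast
  qed
  then have D_lim: "AE r in ?M. (\<lambda>n. D n r) \<longlonglongrightarrow> L r (z r)"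
    using zV dense L_diff AE_space
  proof eventually_elim
    case (elim r)
    have zr: "z r \<in> V" and r: "0 < r" "r < T" using elim by auto
    show ?case
    proof (rule LIMSEQ_I)
      fix e :: real assume e: "0 < e"
      \<comment> \<open>The error e splits into thirds: from \<open>D n r\<close> to the average for
        \<open>v\<close>, from there to \<open>L r v\<close>, and on to \<open>L r (z r)\<close>.
        The factor M + 1 in place of M avoids a division by zero.\<close>
      obtain v where v: "v \<in> S" "nrm (\<lambda>x. z r x - v x) < e / (3 * (M + 1))"
        using elim(3) e M by (metis add_nonneg_pos divide_pos_pos mult_pos_pos zero_less_numeral zero_less_one)
      have vV: "v \<in> V" using v S by auto
      let ?N = "nrm (\<lambda>x. z r x - v x)"
      have ae: "AE s in ?M. \<bar>L s (z r) - L s v\<bar> \<le> M * ?N"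
        using L_diff by eventually_elim (use zr vV in blast)
      have "M * ?N \<le> M * (e / (3 * (M + 1)))" using v(2) M by (intro mult_left_mono) auto
      also have "\<dots> \<le> e / 3" using M e by (simp add: field_simps)
      finally have small: "M * ?N \<le> e / 3" .
      have "\<bar>L r (z r) - L r v\<bar> \<le> M * ?N" using elim(4) zr vV by blast
      then have near: "\<bar>L r (z r) - L r v\<bar> \<le> e / 3"
        using small by simp
      have "eventually (\<lambda>n. \<bar>integral {r - h n..r} (\<lambda>s. L s v) / h n - L r v\<bar> < e / 3) sequentially"
        using tendstoD[OF elim(1)[rule_format, OF v(1)], of "e / 3"] e
        by (simp add: dist_real_def h_def mult.commute)
      moreover have "eventually (\<lambda>n. h n < r) sequentially"
        using order_tendstoD(2)[OF h0 r(1)] .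
      ultimately have "eventually (\<lambda>n. norm (D n r - L r (z r)) < e) sequentially"
      proof eventually_elim
        case (elim n)
        have "integral {r - h n..r} (\<lambda>s. L s (z r)) - integral {r - h n..r} (\<lambda>s. L s v) =
            integral {r - h n..r} (\<lambda>s. L s (z r) - L s v)"
          using elim r h[of n] by (intro Henstock_Kurzweil_Integration.integral_diff[symmetric] int_sub zr vV) auto
        moreover have "\<bar>integral {r - h n..r} (\<lambda>s. L s (z r) - L s v)\<bar> \<le> M * ?N * (r - (r - h n))"
          using elim r h[of n] ae
          by (intro integral_AE_bound[of T] Bochner_Integration.integrable_diff L_int zr vV) auto
        moreover have "M * ?N * (r - (r - h n)) \<le> e / 3 * h n"
          using small h[of n] by (simp add: mult_right_mono)
        ultimately have "\<bar>integral {r - h n..r} (\<lambda>s. L s (z r)) - integral {r - h n..r} (\<lambda>s. L s v)\<bar> \<le> e / 3 * h n"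
          by linarith
        then have "\<bar>(integral {r - h n..r} (\<lambda>s. L s (z r)) - integral {r - h n..r} (\<lambda>s. L s v)) / h n\<bar> \<le> e / 3"
          by (rule abs_divide_le[OF _ h])
        then have "\<bar>D n r - integral {r - h n..r} (\<lambda>s. L s v) / h n\<bar> \<le> e / 3"
          using D_eq[OF zr, of n] elim r by (simp add: diff_divide_distrib)
        then show ?case using elim near unfolding real_norm_def by linarith
      qed
      then show "\<exists>no. \<forall>n\<ge>no. norm (D n r - L r (z r)) < e"
        by (simp add: eventually_sequentially)
    qed
  qed
  \<comment> \<open>Measurability along the moving vector is inherited from the quotients
    \<open>D n\<close>, which are built from continuous functions of time.\<close>
  have ell_meas: "(\<lambda>r. L r (z r)) \<in> borel_measurable ?M"
  proof (rule borel_measurable_lebesgue_on_AE)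
    show "(\<lambda>r. lim (\<lambda>n. D n r)) \<in> borel_measurable ?M"
      by (rule borel_measurable_lim_metric[OF D_meas])
    show "AE r in ?M. lim (\<lambda>n. D n r) = L r (z r)"
      using D_lim by eventually_elim (rule limI)
  qed simp
  have const: "integrable ?M (\<lambda>_. M * B)"
    by (intro finite_measure.integrable_const finite_measure_lebesgue_on) simp
  have ell_bound: "AE r in ?M. \<bar>L r (z r)\<bar> \<le> M * B"
    using D_lim D_bound
  proof eventually_elim
    case (elim r)
    from tendsto_rabs[OF elim(1)] show ?case
      by (rule tendsto_upperbound) (use elim(2) in simp_all)
  qed
  show ell_int: "integrable ?M (\<lambda>r. L r (z r))"
  proof (rule Bochner_Integration.integrable_bound[OF const ell_meas])
    show "AE r in ?M. norm (L r (z r)) \<le> norm (M * B)"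
      using ell_bound by eventually_elim simp
  qed
  assume t: "t \<in> {0..T}"
  show "(L2_norm G (z t))\<^sup>2 - (L2_norm G (z 0))\<^sup>2 \<le> 2 * integral {0..t} (\<lambda>r. L r (z r))"
  proof (cases "t = 0")
    case False
    then have t0: "0 < t" "t \<le> T" using t by auto
    define e where "e r = (L2_norm G (z r))\<^sup>2" for r
    have e_cont: "continuous_on {0..T} e"
      unfolding e_def by (intro continuous_on_power norm_continuous)
    have lim: "(\<lambda>n. LINT r|?M. indicator {0<..<t} r * D n r) \<longlonglongrightarrow> (LINT r|?M. indicator {0<..<t} r * L r (z r))"
    proof (rule integral_dominated_convergence[where w = "\<lambda>_. M * B"])
      have ind: "(indicator {0<..<t} :: real \<Rightarrow> real) \<in> borel_measurable ?M"
        using t0 by (intro borel_measurable_indicator) (auto simp: sets_restrict_space_iff)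
      show "(\<lambda>r. indicator {0<..<t} r * D n r) \<in> borel_measurable ?M" for n
        by (rule borel_measurable_times[OF ind D_meas])
      show "(\<lambda>r. indicator {0<..<t} r * L r (z r)) \<in> borel_measurable ?M"
        by (rule borel_measurable_times[OF ind ell_meas])
      show "AE r in ?M. (\<lambda>n. indicator {0<..<t} r * D n r) \<longlonglongrightarrow> indicator {0<..<t} r * L r (z r)"
        using D_lim by eventually_elim (intro tendsto_intros)
      show "AE r in ?M. norm (indicator {0<..<t} r * D n r) \<le> M * B" for n
        using D_bound
      proof eventually_elim
        case (elim r)
        then have "\<bar>D n r\<bar> \<le> M * B" by blast
        then show ?case using order_trans[OF abs_ge_zero, of "D n r" "M * B"] by (simp add: indicator_def)
      qed
    qed (rule const)
    have "set_integrable lebesgue {0<..<T} (\<lambda>r. L r (z r))"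
      using ell_int by (simp add: integrable_lebesgue_on_iff)
    then have "set_integrable lebesgue {0<..<t} (\<lambda>r. L r (z r))"
      by (rule set_integrable_subset) (use t0 in auto)
    then have int_eq: "(LINT r|?M. indicator {0<..<t} r * L r (z r)) = integral {0..t} (\<lambda>r. L r (z r))"
      by (rule integral_indicator_Ioo) (use t0 in auto)
    \<comment> \<open>After a shift in time the integrals of \<open>e\<close> cancel on the common
      part, leaving an average before t and one after 0. The halving absorbs the factor 2 of
      \<open>norm_sq_difference_quotient_le\<close>.\<close>
    have lim_e: "(\<lambda>n. (integral {t - h n..t} e / h n - integral {0..h n} e / h n) / 2) \<longlonglongrightarrow> (e t - e 0) / 2"
    proof -
      have "(\<lambda>n. t - h n) \<longlonglongrightarrow> t - 0" by (intro tendsto_intros h0)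
      moreover have "eventually (\<lambda>n. h n < t) sequentially" using order_tendstoD(2)[OF h0 t0(1)] .
      ultimately have "(\<lambda>n. integral {t - h n..t - h n + h n} e / h n) \<longlonglongrightarrow> e t"
        using t0 by (intro averages_tendsto[OF e_cont t h]) (auto elim!: eventually_mono)
      moreover have "eventually (\<lambda>n. h n < T) sequentially" using order_tendstoD(2)[OF h0 T_pos] .
      then have "(\<lambda>n. integral {0..0 + h n} e / h n) \<longlonglongrightarrow> e 0"
        using T_pos h0 by (intro averages_tendsto[OF e_cont _ h]) (auto elim!: eventually_mono)
      ultimately show ?thesis by (intro tendsto_divide tendsto_diff tendsto_const) auto
    qed
    have "eventually (\<lambda>n. (integral {t - h n..t} e / h n - integral {0..h n} e / h n) / 2 \<le>
        (LINT r|?M. indicator {0<..<t} r * D n r)) sequentially"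
      using order_tendstoD(2)[OF h0 t0(1)]
    proof eventually_elim
      case (elim n)
      let ?q = "\<lambda>r. (c r r - c (r - h n) r) / h n"
      let ?d = "\<lambda>r. (e r - e (r - h n)) / h n / 2"
      have q_cont: "continuous_on {h n..t} ?q"
        by (rule continuous_on_subset[OF c_cont]) (use t0 in auto)
      \<comment> \<open>Up to time \<open>h n\<close> the quotient is zero by its cutoff, hence the
        smaller interval.\<close>
      have ind: "indicator {0<..<t} r * D n r = indicator {h n<..<t} r * ?q r" for r
        using t0 h[of n] by (auto simp: D_def indicator_def)
      have "set_integrable lebesgue {h n<..<t} ?q"
        by (rule set_integrable_subset[OF absolutely_integrable_continuous_real[OF q_cont]]) auto
      then have eq: "(LINT r|?M. indicator {0<..<t} r * D n r) = integral {h n..t} ?q"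
        unfolding ind by (rule integral_indicator_Ioo) (use t0 h[of n] in auto)
      have e_int: "e integrable_on {a..b}" if "0 \<le> a" "b \<le> T" for a b
        by (intro integrable_continuous_real continuous_on_subset[OF e_cont]) (use that in auto)
      have e_shift: "((\<lambda>r. e (r - h n)) has_integral integral {0..t - h n} e) {h n..t}"
        using has_integral_affinity'[OF _ zero_less_one, of e "integral {0..t - h n} e" 0 "t - h n" "- h n"]
          integrable_integral[OF e_int[of 0 "t - h n"]] elim t0 h[of n] by simp
      have "((\<lambda>r. e r - e (r - h n)) has_integral (integral {h n..t} e - integral {0..t - h n} e)) {h n..t}"
        using t0 h[of n] by (intro has_integral_diff e_shift integrable_integral e_int) auto
      then have "(?d has_integral (integral {h n..t} e - integral {0..t - h n} e) / h n / 2) {h n..t}"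
        by (intro has_integral_divide)
      moreover have "integral {h n..t} e - integral {0..t - h n} e = integral {t - h n..t} e - integral {0..h n} e"
      proof -
        have "integral {0..h n} e + integral {h n..t} e = integral {0..t} e"
          using elim t0 h[of n] by (intro Henstock_Kurzweil_Integration.integral_combine e_int) auto
        moreover have "integral {0..t - h n} e + integral {t - h n..t} e = integral {0..t} e"
          using elim t0 h[of n] by (intro Henstock_Kurzweil_Integration.integral_combine e_int) auto
        ultimately show ?thesis by simp
      qed
      ultimately have d: "(?d has_integral (integral {t - h n..t} e / h n - integral {0..h n} e / h n) / 2) {h n..t}"
        by (simp add: diff_divide_distrib)
      have "(integral {t - h n..t} e / h n - integral {0..h n} e / h n) / 2 \<le> integral {h n..t} ?q"
      proof (rule has_integral_le[OF d])
        show "(?q has_integral integral {h n..t} ?q) {h n..t}"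
          by (intro integrable_integral integrable_continuous_real q_cont)
        fix r assume r: "r \<in> {h n..t}"
        then have "e r - e (r - h n) \<le> 2 * (c r r - c (r - h n) r)"
          using norm_sq_difference_quotient_le[of "r - h n" r] t0 h[of n]
          by (auto simp: e_def c_def L2_norm_sq)
        then have "(e r - e (r - h n)) / 2 \<le> c r r - c (r - h n) r" by simp
        from divide_right_mono[OF this, of "h n"] show "?d r \<le> ?q r"
          using h[of n] by (simp add: mult.commute)
      qed
      then show ?case by (simp only: eq)
    qed
    from tendsto_le[OF sequentially_bot lim lim_e this]
    have "(e t - e 0) / 2 \<le> integral {0..t} (\<lambda>r. L r (z r))"
      by (simp only: int_eq)
    then show ?thesis by (simp add: e_def)
  qed simp
qed

end

section \<open>Weak solutions\<close>

lemma bilinear_tensor_app: "bilinear tensor_app"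
  unfolding bilinear_def
  by (auto intro!: linearI simp: tensor_app_def vec_eq_iff sum.distrib sum_distrib_left algebra_simps)

interpretation tensor_app: bounded_bilinear tensor_app
  using bilinear_tensor_app by (simp add: bilinear_conv_bounded_bilinear)

lemma L2_norm_diff_le:
  assumes "f \<in> L2_space G" "g \<in> L2_space G"
  shows "L2_norm G (\<lambda>x. f x - g x) \<le> 2 * L2_norm G f + 2 * L2_norm G g"
proof (rule power2_le_imp_le)
  have "(2 * L2_norm G f + 2 * L2_norm G g)\<^sup>2 =
      4 * (L2_norm G f)\<^sup>2 + 4 * (L2_norm G g)\<^sup>2 + 8 * (L2_norm G f * L2_norm G g)"
    by (simp add: power2_sum power_mult_distrib)
  moreover have "0 \<le> L2_norm G f * L2_norm G g" by (intro mult_nonneg_nonneg L2_norm_nonneg)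
  moreover have "0 \<le> (L2_norm G f)\<^sup>2" "0 \<le> (L2_norm G g)\<^sup>2" by simp_all
  ultimately show "(L2_norm G (\<lambda>x. f x - g x))\<^sup>2 \<le> (2 * L2_norm G f + 2 * L2_norm G g)\<^sup>2"
    using L2_norm_diff_sq_le[OF assms] by linarith
  show "0 \<le> 2 * L2_norm G f + 2 * L2_norm G g" by (simp add: L2_norm_nonneg)
qed

lemma L2_curve_diff:
  assumes "L2_curve G T u" "L2_curve G T v"
  shows "L2_curve G T (\<lambda>t x. u t x - v t x)"
proof -
  interpret u: L2_curve G T u by fact
  interpret v: L2_curve G T v by fact
  show ?thesis
  proof
    show "0 < T" by (rule u.T_pos)
    fix t assume t: "t \<in> {0..T}"
    then show "(\<lambda>x. u t x - v t x) \<in> L2_space G" by (intro L2_space_diff u.z_L2 v.z_L2)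
    show "((\<lambda>s. L2_norm G (\<lambda>x. u s x - v s x - (u t x - v t x))) \<longlongrightarrow> 0) (at t within {0..T})"
    proof (rule null_comparison_within)
      show "((\<lambda>s. 2 * L2_norm G (\<lambda>x. u s x - u t x) + 2 * L2_norm G (\<lambda>x. v s x - v t x)) \<longlongrightarrow> 0) (at t within {0..T})"
        using tendsto_add[OF tendsto_mult_right_zero[OF u.z_cont[OF t]] tendsto_mult_right_zero[OF v.z_cont[OF t]]]
        by simp
      fix s assume s: "s \<in> {0..T}"
      have "(\<lambda>x. u s x - v s x - (u t x - v t x)) = (\<lambda>x. (u s x - u t x) - (v s x - v t x))"
        by (simp add: fun_eq_iff algebra_simps)
      then show "\<bar>L2_norm G (\<lambda>x. u s x - v s x - (u t x - v t x))\<bar> \<le>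
          2 * L2_norm G (\<lambda>x. u s x - u t x) + 2 * L2_norm G (\<lambda>x. v s x - v t x)"
        using s t by (simp only: abs_of_nonneg[OF L2_norm_nonneg]) (intro L2_norm_diff_le L2_space_diff u.z_L2 v.z_L2)
    qed
  qed
qed

text \<open>A negative bound on a norm can hold almost everywhere only on a null set, and a nonempty
  open set is not negligible.\<close>

lemma Linf_norm_nonneg:
  assumes f: "f \<in> Linf_space G" and G: "open G" "G \<noteq> {}"
  shows "0 \<le> Linf_norm G f"
proof (rule ccontr)
  assume neg: "\<not> 0 \<le> Linf_norm G f"
  have "AE x in lebesgue_on G. False"
    using Linf_norm_bound[OF f]
  proof eventually_elim
    case (elim x)
    then show ?case using neg norm_ge_zero[of "f x"] by linarith
  qed
  then have "AE x in lebesgue. x \<notin> G" using G by (simp add: AE_restrict_space_iff borel_open)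
  then have "negligible G" by (simp add: completion.null_sets_iff_AE negligible_iff_null_sets)
  then show False using open_not_negligible[OF G] by simp
qed

lemma Linf_L2_norm_le:
  assumes f: "f \<in> Linf_space G" and G: "open G" "G \<noteq> {}" "bounded G"
  shows "L2_norm G f \<le> Linf_norm G f * sqrt (measure lebesgue G)"
  using f Linf_norm_bound[OF f] Linf_norm_nonneg[OF f G(1,2)] lmeasurable_open[OF G(3,1)]
  by (intro bounded_measurable_L2) (auto simp: Linf_space_def)

lemma space_V_integral_bound:
  assumes f: "f \<in> L2_space G" "L2_norm G f \<le> M" and v: "v \<in> space_V G" and G: "open G"
  shows "\<bar>LINT x|lebesgue_on G. f x \<bullet> weak_jacobian G v x\<bar> \<le> M * H1_norm G v"
proof -
  have "\<bar>LINT x|lebesgue_on G. f x \<bullet> weak_jacobian G v x\<bar> \<le> L2_norm G f * L2_norm G (weak_jacobian G v)"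
    using L2_Cauchy_Schwarz[OF f(1) space_V_D(3)[OF v G]] by (simp add: L2_inner_def)
  also have "\<dots> \<le> M * H1_norm G v"
  proof (rule mult_mono[OF f(2)])
    show "L2_norm G (weak_jacobian G v) \<le> H1_norm G v"
      by (rule power2_le_imp_le) (simp_all add: H1_norm_sq H1_norm_nonneg)
    show "0 \<le> M" using f(2) L2_norm_nonneg[of G f] by linarith
  qed (rule L2_norm_nonneg)
  finally show ?thesis .
qed

lemma tested_derivative_diff:
  assumes curve: "L2_curve G T u" "L2_curve G T v" and V: "V \<subseteq> L2_space G"
    and deriv: "tested_derivative G T V u k" "tested_derivative G T V v l"
  shows "tested_derivative G T V (\<lambda>t x. u t x - v t x) (\<lambda>r y. k r y - l r y)"
  unfolding tested_derivative_def
proof (intro ballI conjI allI impI)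
  interpret u: L2_curve G T u by fact
  interpret v: L2_curve G T v by fact
  fix y assume y: "y \<in> V"
  note int = tested_derivativeD(1)[OF deriv(1) y] tested_derivativeD(1)[OF deriv(2) y]
  show "integrable (lebesgue_on {0<..<T}) (\<lambda>r. k r y - l r y)"
    using int by simp
  fix s t assume st: "0 \<le> s" "s \<le> t" "t \<le> T"
  have "L2_inner G (\<lambda>x. u r x - v r x) y = L2_inner G (u r) y - L2_inner G (v r) y" if "r \<in> {0..T}" for r
    using y V by (intro L2_inner_diff_left u.z_L2 v.z_L2 that) auto
  then have "L2_inner G (\<lambda>x. u t x - v t x) y - L2_inner G (\<lambda>x. u s x - v s x) y =
      (L2_inner G (u t) y - L2_inner G (u s) y) - (L2_inner G (v t) y - L2_inner G (v s) y)"
    using st by simp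
  also have "\<dots> = integral {s..t} (\<lambda>r. k r y - l r y)"
    unfolding tested_derivativeD(2)[OF deriv(1) y st] tested_derivativeD(2)[OF deriv(2) y st]
    using integrable_on_Icc_if_Ioo[OF int(1) st(1,3)] integrable_on_Icc_if_Ioo[OF int(2) st(1,3)]
    by (rule Henstock_Kurzweil_Integration.integral_diff[symmetric])
  finally show "L2_inner G (\<lambda>x. u t x - v t x) y - L2_inner G (\<lambda>x. u s x - v s x) y =
      integral {s..t} (\<lambda>r. k r y - l r y)" .
qed

text \<open>Fubini for null sets: a null set in space-time has null slices at almost every time. The
  slices of the joint representative agree with the chosen Jacobians at almost every time as
  well.\<close>

lemma bounded_gradient_AE:
  assumes "bounded_gradient G T u" "open G"
  obtains M where "0 \<le> M"
    "AE t in lebesgue_on {0<..<T}. AE x in lebesgue_on G. norm (weak_jacobian G (u t) x) \<le> M"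
proof -
  let ?Q = "{0<..<T} \<times> G"
  obtain g where g: "g \<in> Linf_space ?Q"
    and eq: "AE t in lebesgue_on {0<..<T}. AE x in lebesgue_on G. g (t, x) = weak_jacobian G (u t) x"
    using assms(1) by (auto simp: bounded_gradient_def)
  obtain M where M: "AE p in lebesgue_on ?Q. norm (g p) \<le> M"
    using g by (auto simp: Linf_space_def)
  have ms: "G \<in> sets lebesgue" using assms(2) by (simp add: borel_open)
  have "open ?Q" using assms(2) by (intro open_Times) auto
  then have "AE p in lebesgue. p \<in> ?Q \<longrightarrow> norm (g p) \<le> M"
    using M by (simp add: AE_restrict_space_iff borel_open)
  \<comment> \<open>The slicing theorem concerns product measures. Lebesgue measure on the product
    is the completion of one, and completion does not affect almost-everywhere statements.\<close>
  then have "AE p in lborel. p \<in> ?Q \<longrightarrow> norm (g p) \<le> M"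
    by (simp only: AE_completion_iff)
  then have "AE p in lborel \<Otimes>\<^sub>M lborel. p \<in> ?Q \<longrightarrow> norm (g p) \<le> M"
    by (simp only: lborel_prod)
  then have "AE t in lborel. AE x in lborel. (t, x) \<in> ?Q \<longrightarrow> norm (g (t, x)) \<le> M"
    by (rule lborel_pair.AE_pair)
  then have "AE t in lebesgue. AE x in lebesgue. (t, x) \<in> ?Q \<longrightarrow> norm (g (t, x)) \<le> M"
    by (simp only: AE_completion_iff)
  then have "AE t in lebesgue. t \<in> {0<..<T} \<longrightarrow> (AE x in lebesgue_on G. norm (g (t, x)) \<le> M)"
  proof eventually_elim
    case (elim t)
    show ?case
    proof
      assume t: "t \<in> {0<..<T}"
      from elim have "AE x in lebesgue. x \<in> G \<longrightarrow> norm (g (t, x)) \<le> M"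
        by eventually_elim (use t in auto)
      then show "AE x in lebesgue_on G. norm (g (t, x)) \<le> M"
        using ms by (simp add: AE_restrict_space_iff)
    qed
  qed
  then have "AE t in lebesgue_on {0<..<T}. AE x in lebesgue_on G. norm (g (t, x)) \<le> M"
    by (simp add: AE_restrict_space_iff)
  then have "AE t in lebesgue_on {0<..<T}. AE x in lebesgue_on G. norm (weak_jacobian G (u t) x) \<le> max 0 M"
    using eq
  proof eventually_elim
    case (elim t)
    then show ?case by eventually_elim auto
  qed
  then show ?thesis by (rule that[rotated]) simp
qed

text \<open>By continuity the values at times near t are bounded by those at t plus 1, and
  compactness reduces the centres t to finitely many. The bound is the same for all times; the
  exceptional set in G may vary.\<close>

lemma continuous_curve_Linf_bounded:
  assumes "continuous_curve T (Linf_sym G) (Linf_norm G) H"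
  obtains M where "0 \<le> M" "\<And>t. t \<in> {0..T} \<Longrightarrow> AE x in lebesgue_on G. norm (H t x) \<le> M"
proof -
  have H: "H t \<in> Linf_sym G" if "t \<in> {0..T}" for t
    using assms that by (simp add: continuous_curve_def)
  have "\<exists>d>0. \<forall>s\<in>{0..T}. dist s t < d \<longrightarrow> (AE x in lebesgue_on G. norm (H s x) \<le> \<bar>Linf_norm G (H t)\<bar> + 1)"
    if t: "t \<in> {0..T}" for t
  proof -
    have lim: "((\<lambda>s. Linf_norm G (\<lambda>x. H s x - H t x)) \<longlongrightarrow> 0) (at t within {0..T})"
      using assms t by (simp add: continuous_curve_def)
    then obtain d where d: "d > 0" "\<And>s. s \<in> {0..T} \<Longrightarrow> s \<noteq> t \<Longrightarrow> dist s t < d \<Longrightarrow> Linf_norm G (\<lambda>x. H s x - H t x) < 1"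
      using order_tendstoD(2)[OF lim zero_less_one] unfolding eventually_at by blast
    have "AE x in lebesgue_on G. norm (H s x) \<le> \<bar>Linf_norm G (H t)\<bar> + 1" if s: "s \<in> {0..T}" "dist s t < d" for s
    proof (cases "s = t")
      case True
      have "AE x in lebesgue_on G. norm (H t x) \<le> Linf_norm G (H t)"
        using H[OF t] by (intro Linf_norm_bound) (simp add: Linf_sym_def)
      then show ?thesis unfolding True by eventually_elim linarith
    next
      case False
      have ds: "(\<lambda>x. H s x - H t x) \<in> Linf_space G"
        using Linf_sym_linear[OF H[OF s(1)] H[OF t], of 1 "-1"] by (simp add: Linf_sym_def)
      have "H t \<in> Linf_space G" using H[OF t] by (simp add: Linf_sym_def)
      from Linf_norm_bound[OF this] Linf_norm_bound[OF ds] show ?thesis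
      proof eventually_elim
        case (elim x)
        have "norm (H s x) \<le> norm (H t x) + norm (H s x - H t x)"
          by (metis norm_triangle_sub)
        then show ?case using elim d(2)[OF s(1) False s(2)] by linarith
      qed
    qed
    with d(1) show ?thesis by blast
  qed
  then obtain d where d: "\<And>t. t \<in> {0..T} \<Longrightarrow> d t > 0"
    "\<And>t s. t \<in> {0..T} \<Longrightarrow> s \<in> {0..T} \<Longrightarrow> dist s t < d t \<Longrightarrow>
      AE x in lebesgue_on G. norm (H s x) \<le> \<bar>Linf_norm G (H t)\<bar> + 1"
    by metis
  have cover: "{0..T} \<subseteq> (\<Union>t\<in>{0..T}. ball t (d t))" using d(1) by force
  obtain I where I: "I \<subseteq> {0..T}" "finite I" "{0..T} \<subseteq> (\<Union>t\<in>I. ball t (d t))"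
    using compactE_image[OF compact_Icc open_ball cover] by metis
  \<comment> \<open>A sum over the finite set of centres dominates each summand, and is meaningful
    also for an empty set.\<close>
  define M where "M = (\<Sum>t\<in>I. \<bar>Linf_norm G (H t)\<bar>) + 1"
  have "AE x in lebesgue_on G. norm (H s x) \<le> M" if s: "s \<in> {0..T}" for s
  proof -
    obtain t where t: "t \<in> I" "dist t s < d t" using I(3) s by (auto simp: subset_iff)
    have "\<bar>Linf_norm G (H t)\<bar> \<le> (\<Sum>t\<in>I. \<bar>Linf_norm G (H t)\<bar>)"
      using I(2) t(1) by (intro member_le_sum) auto
    then have le: "\<bar>Linf_norm G (H t)\<bar> + 1 \<le> M" by (simp add: M_def)
    have "AE x in lebesgue_on G. norm (H s x) \<le> \<bar>Linf_norm G (H t)\<bar> + 1"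
      using t I(1) s by (intro d(2)) (auto simp: dist_commute)
    then show ?thesis by eventually_elim (use le in linarith)
  qed
  moreover have "0 \<le> M" by (simp add: M_def sum_nonneg)
  ultimately show ?thesis using that by blast
qed

text \<open>The approximating simple curves take countably many values altogether, and these come
  arbitrarily close to \<open>f t\<close> for almost every t. The absolute value is there because
  \<open>N\<close> is an arbitrary real function.\<close>

lemma strongly_measurable_separable:
  assumes "strongly_measurable T X N f"
  obtains S where "countable S" "S \<subseteq> X"
    "AE t in lebesgue_on {0<..<T}. \<forall>\<epsilon>>0. \<exists>a\<in>S. \<bar>N (\<lambda>p. f t p - a p)\<bar> < \<epsilon>"
proof -
  obtain s where s: "\<And>n. simple_curve T X (s n)"
    and lim: "AE t in lebesgue_on {0<..<T}. (\<lambda>n. N (\<lambda>p. f t p - s n t p)) \<longlonglongrightarrow> 0"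
    using assms by (auto simp: strongly_measurable_def)
  show ?thesis
  proof (rule that[of "\<Union>n. s n ` {0<..<T}"])
    have "finite (s n ` {0<..<T})" for n
      using s[of n] simple_functionD(1)[of "lebesgue_on {0<..<T}" "s n"] by (simp add: simple_curve_def)
    then show "countable (\<Union>n. s n ` {0<..<T})"
      by (intro countable_UN[OF _ countable_finite]) auto
    show "(\<Union>n. s n ` {0<..<T}) \<subseteq> X" using s by (auto simp: simple_curve_def)
    show "AE t in lebesgue_on {0<..<T}. \<forall>\<epsilon>>0. \<exists>a\<in>\<Union>n. s n ` {0<..<T}. \<bar>N (\<lambda>p. f t p - a p)\<bar> < \<epsilon>"
      using lim AE_space
    proof eventually_elim
      case (elim t)
      show ?case
      proof (intro allI impI)
        fix \<epsilon> :: real assume "0 < \<epsilon>"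
        then obtain n where "\<bar>N (\<lambda>p. f t p - s n t p)\<bar> < \<epsilon>"
          using LIMSEQ_D[OF elim(1), of \<epsilon>] by auto
        moreover have "s n t \<in> (\<Union>n. s n ` {0<..<T})" using elim(2) by (intro UN_I[of n] imageI) auto
        ultimately show "\<exists>a\<in>\<Union>n. s n ` {0<..<T}. \<bar>N (\<lambda>p. f t p - a p)\<bar> < \<epsilon>" by blast
      qed
    qed
  qed
qed

section \<open>Weak solutions as L2 curves with tested derivatives\<close>

lemma bochner_H1_functional:
  assumes "bounded_functional X N \<Lambda> C" "bochner_H1 T X N f f'" "continuous_on {0..T} (\<lambda>t. \<Lambda> (f t))"
  shows "integrable (lebesgue_on {0<..<T}) (\<lambda>r. \<Lambda> (f' r))"
    and "0 \<le> s \<Longrightarrow> s \<le> t \<Longrightarrow> t \<le> T \<Longrightarrow> \<Lambda> (f t) - \<Lambda> (f s) = integral {s..t} (\<lambda>r. \<Lambda> (f' r))"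
proof -
  interpret bounded_functional X N \<Lambda> C by fact
  show i: "integrable (lebesgue_on {0<..<T}) (\<lambda>r. \<Lambda> (f' r))"
    using assms(2) by (intro bochner_L2_integrable) (simp add: bochner_H1_def)
  show "\<Lambda> (f t) - \<Lambda> (f s) = integral {s..t} (\<lambda>r. \<Lambda> (f' r))" if "0 \<le> s" "s \<le> t" "t \<le> T"
    by (rule weak_derivative_fundamental_theorem[OF assms(3) i weak_time_deriv[OF assms(2)] that])
qed

lemma weak_solution_u:
  fixes u :: "real \<Rightarrow> real^'d \<Rightarrow> real^'k"
  assumes sol: "weak_solution G F \<tau> T u0 H0 u H" and G: "open G" "bounded G" and T: "0 < T"
  obtains u' where
    "L2_curve G T u"
    "AE r in lebesgue_on {0<..<T}. u r \<in> space_V G"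
    "AE r in lebesgue_on {0<..<T}. u' r \<in> dual_V G \<and> (\<forall>v\<in>space_V G. u' r v = - op_A G (H r) (u r) v)"
    "tested_derivative G T (space_V G) u u'"
proof -
  obtain u' where H1: "bochner_H1 T (dual_V G) (dual_norm G) (\<lambda>t. embed_H G (u t)) u'"
    and eq: "AE t in lebesgue_on {0<..<T}. \<forall>v\<in>space_V G. u' t v + op_A G (H t) (u t) v = 0"
    using sol by (auto simp: weak_solution_def)
  have curve: "L2_curve G T u"
    using sol T by unfold_locales (auto simp: weak_solution_def continuous_curve_def space_H_def)
  interpret L2_curve G T u by (rule curve)
  \<comment> \<open>Evaluation at \<open>v\<close> is bounded with the constant
    \<open>H1_norm G v\<close>; adding 1 makes it positive even for the zero function.\<close>
  have func: "bounded_functional (dual_V G) (dual_norm G) (\<lambda>l. l v) (H1_norm G v + 1)"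
    if v: "v \<in> space_V G" for v :: "real^'d \<Rightarrow> real^'k"
  proof
    fix f :: "(real^'d \<Rightarrow> real^'k) \<Rightarrow> real" assume f: "f \<in> dual_V G"
    from dual_norm_nonneg[OF f v G] dual_norm_bound[OF f v G] show "\<bar>f v\<bar> \<le> (H1_norm G v + 1) * dual_norm G f"
      by (simp add: algebra_simps)
  qed (use H1_norm_nonneg[of G v] dual_V_linear in \<open>auto simp: add_nonneg_pos\<close>)
  have cont: "continuous_on {0..T} (\<lambda>t. embed_H G (u t) v)" if "v \<in> space_V G" for v
    using inner_const_continuous[OF space_V_D(1)[OF that G(1)]] by (simp add: embed_H_def L2_inner_def)
  show ?thesis
  proof (rule that[OF curve, of u'])
    show "AE r in lebesgue_on {0<..<T}. u r \<in> space_V G"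
      using sol by (auto simp: weak_solution_def bochner_L2_def strongly_measurable_def)
    have "AE r in lebesgue_on {0<..<T}. u' r \<in> dual_V G"
      using H1 by (auto simp: bochner_H1_def bochner_L2_def strongly_measurable_def)
    then show "AE r in lebesgue_on {0<..<T}. u' r \<in> dual_V G \<and> (\<forall>v\<in>space_V G. u' r v = - op_A G (H r) (u r) v)"
      using eq by eventually_elim (auto simp: eq_neg_iff_add_eq_0)
    show "tested_derivative G T (space_V G) u u'"
      unfolding tested_derivative_def
    proof (intro ballI conjI allI impI)
      fix v :: "real^'d \<Rightarrow> real^'k" assume v: "v \<in> space_V G"
      note thms = bochner_H1_functional[where \<Lambda> = "\<lambda>l. l v" and f = "\<lambda>t. embed_H G (u t)",
          OF func[OF v] H1 cont[OF v]]
      show "integrable (lebesgue_on {0<..<T}) (\<lambda>r. u' r v)" by (rule thms(1))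
      fix s t assume "0 \<le> s" "s \<le> t" "t \<le> T"
      from thms(2)[OF this]
      show "L2_inner G (u t) v - L2_inner G (u s) v = integral {s..t} (\<lambda>r. u' r v)"
        by (simp add: embed_H_def L2_inner_def)
    qed
  qed
qed

text \<open>On a bounded domain convergence in the essential supremum implies convergence in L2, at
  the price of the factor \<open>sqrt (measure lebesgue G)\<close>. The derivative can thus be
  tested with every square-integrable field.\<close>

lemma weak_solution_H:
  fixes H :: "real \<Rightarrow> real^'d \<Rightarrow> real^'d^'k^'d^'k"
  assumes sol: "weak_solution G F \<tau> T u0 H0 u H" and G: "open G" "bounded G" "G \<noteq> {}" and T: "0 < T"
  obtains H' where
    "L2_curve G T H"
    "AE r in lebesgue_on {0<..<T}. H' r \<in> Linf_space G \<and>
      (AE x in lebesgue_on G. \<tau> *\<^sub>R H' r x = F (weak_jacobian G (u r) x) - H r x)"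
    "tested_derivative G T (L2_space G) H (\<lambda>r. L2_inner G (H' r))"
proof -
  obtain H' where H1: "bochner_H1 T (Linf_sym G) (Linf_norm G) H H'"
    and eq: "AE t in lebesgue_on {0<..<T}. AE x in lebesgue_on G.
           \<tau> *\<^sub>R H' t x + H t x - F (weak_jacobian G (u t) x) = 0"
    using sol unfolding weak_solution_def by blast
  have cc: "continuous_curve T (Linf_sym G) (Linf_norm G) H"
    using sol by (simp add: weak_solution_def)
  have Gm: "G \<in> lmeasurable" using G by (intro lmeasurable_open)
  have sym_L2: "f \<in> L2_space G" if "f \<in> Linf_sym G" for f :: "real^'d \<Rightarrow> real^'d^'k^'d^'k"
    using that Linf_space_imp_L2[OF _ Gm] by (auto simp: Linf_sym_def)
  have curve: "L2_curve G T H"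
  proof
    fix t assume t: "t \<in> {0..T}"
    have Ht: "H s \<in> Linf_sym G" if "s \<in> {0..T}" for s using cc that by (simp add: continuous_curve_def)
    show "H t \<in> L2_space G" using sym_L2 Ht t by blast
    show "((\<lambda>s. L2_norm G (\<lambda>x. H s x - H t x)) \<longlongrightarrow> 0) (at t within {0..T})"
    proof (rule null_comparison_within)
      have "((\<lambda>s. Linf_norm G (\<lambda>x. H s x - H t x)) \<longlongrightarrow> 0) (at t within {0..T})"
        using cc t by (simp add: continuous_curve_def)
      then show "((\<lambda>s. Linf_norm G (\<lambda>x. H s x - H t x) * sqrt (measure lebesgue G)) \<longlongrightarrow> 0) (at t within {0..T})"
        by (rule tendsto_mult_left_zero)
      show "\<bar>L2_norm G (\<lambda>x. H s x - H t x)\<bar> \<le> Linf_norm G (\<lambda>x. H s x - H t x) * sqrt (measure lebesgue G)"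
        if s: "s \<in> {0..T}" for s
        using Linf_sym_linear[OF Ht[OF s] Ht[OF t], of 1 "-1"] G
        by (simp only: abs_of_nonneg[OF L2_norm_nonneg]) (intro Linf_L2_norm_le, auto simp: Linf_sym_def)
    qed
  qed (rule T)
  interpret L2_curve G T H by (rule curve)
  have func: "bounded_functional (Linf_sym G) (Linf_norm G) (\<lambda>f. L2_inner G f v) (sqrt (measure lebesgue G) * L2_norm G v + 1)"
    if v: "v \<in> L2_space G" for v :: "real^'d \<Rightarrow> real^'d^'k^'d^'k"
  proof
    fix f :: "real^'d \<Rightarrow> real^'d^'k^'d^'k" assume f: "f \<in> Linf_sym G"
    then have f': "f \<in> Linf_space G" by (simp add: Linf_sym_def)
    have "\<bar>L2_inner G f v\<bar> \<le> L2_norm G f * L2_norm G v" by (rule L2_Cauchy_Schwarz[OF sym_L2[OF f] v])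
    also have "\<dots> \<le> Linf_norm G f * sqrt (measure lebesgue G) * L2_norm G v"
      by (intro mult_right_mono Linf_L2_norm_le f' G L2_norm_nonneg)
    also have "\<dots> \<le> (sqrt (measure lebesgue G) * L2_norm G v + 1) * Linf_norm G f"
      using Linf_norm_nonneg[OF f' G(1,3)] by (simp add: algebra_simps)
    finally show "\<bar>L2_inner G f v\<bar> \<le> (sqrt (measure lebesgue G) * L2_norm G v + 1) * Linf_norm G f" .
  next
    have "0 \<le> sqrt (measure lebesgue G) * L2_norm G v" by (intro mult_nonneg_nonneg L2_norm_nonneg) simp
    then show "0 < sqrt (measure lebesgue G) * L2_norm G v + 1" by linarith
  qed (use Linf_sym_linear L2_inner_linear_left[OF sym_L2 sym_L2 v] in auto)
  show ?thesis
  proof (rule that[OF curve, of H'])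
    have "AE r in lebesgue_on {0<..<T}. H' r \<in> Linf_sym G"
      using H1 by (auto simp: bochner_H1_def bochner_L2_def strongly_measurable_def)
    then show "AE r in lebesgue_on {0<..<T}. H' r \<in> Linf_space G \<and>
      (AE x in lebesgue_on G. \<tau> *\<^sub>R H' r x = F (weak_jacobian G (u r) x) - H r x)"
      using eq
    proof eventually_elim
      case (elim r)
      from elim(2) have "AE x in lebesgue_on G. \<tau> *\<^sub>R H' r x = F (weak_jacobian G (u r) x) - H r x"
        by eventually_elim (simp add: algebra_simps)
      with elim(1) show ?case by (simp add: Linf_sym_def)
    qed
    show "tested_derivative G T (L2_space G) H (\<lambda>r. L2_inner G (H' r))"
      unfolding tested_derivative_def
    proof (intro ballI conjI allI impI)
      fix v :: "real^'d \<Rightarrow> real^'d^'k^'d^'k" assume v: "v \<in> L2_space G"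
      note thms = bochner_H1_functional[where \<Lambda> = "\<lambda>f. L2_inner G f v" and f = H,
          OF func[OF v] H1 inner_const_continuous[OF v]]
      show "integrable (lebesgue_on {0<..<T}) (\<lambda>r. L2_inner G (H' r) v)" by (rule thms(1))
      fix s t assume "0 \<le> s" "s \<le> t" "t \<le> T"
      then show "L2_inner G (H t) v - L2_inner G (H s) v = integral {s..t} (\<lambda>r. L2_inner G (H' r) v)"
        by (rule thms(2))
    qed
  qed
qed

section \<open>Gronwall's lemma and the pointwise estimate\<close>

lemma gronwall:
  fixes y :: "real \<Rightarrow> real"
  assumes y: "continuous_on {0..T} y" and b: "0 < b"
    and le: "\<And>t. t \<in> {0..T} \<Longrightarrow> y t \<le> a + b * integral {0..t} y"
    and t: "t \<in> {0..T}"
  shows "y t \<le> a * exp (b * t)"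
proof -
  define I where "I x = integral {0..x} y" for x
  \<comment> \<open>With the shift a / b the derivative of \<open>g\<close> is exp(-b x) (y x - b I
    x - a), which the assumed inequality makes nonpositive.\<close>
  define g where "g x = exp (- (b * x)) * (I x + a / b)" for x
  have I_cont: "continuous_on {0..T} I"
    unfolding I_def by (intro indefinite_integral_continuous_1 integrable_continuous_real y)
  have "g t \<le> g 0"
  proof (rule DERIV_nonpos_imp_decreasing_open[of 0 t g])
    show "0 \<le> t" using t by simp
    show "continuous_on {0..t} g"
      unfolding g_def by (intro continuous_intros continuous_on_subset[OF I_cont]) (use t in auto)
    fix x assume x: "0 < x" "x < t"
    have "(I has_real_derivative y x) (at x within {0..T})"
      unfolding I_def using x t by (intro integral_has_real_derivative[OF y]) auto
    moreover have "at x within {0..T} = at x"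
      using x t by (intro at_within_interior) auto
    ultimately have [derivative_intros]: "(I has_real_derivative y x) (at x)" by simp
    have "(g has_real_derivative exp (- (b * x)) * (y x - b * (I x + a / b))) (at x)"
      unfolding g_def by (auto intro!: derivative_eq_intros simp: algebra_simps)
    moreover have "y x - b * (I x + a / b) \<le> 0"
      using le[of x] x t b by (simp add: I_def algebra_simps)
    then have "exp (- (b * x)) * (y x - b * (I x + a / b)) \<le> 0"
      by (simp add: mult_nonneg_nonpos)
    ultimately show "\<exists>d. (g has_real_derivative d) (at x) \<and> d \<le> 0" by blast
  qed
  then have "exp (- (b * t)) * (I t + a / b) \<le> a / b" by (simp add: g_def I_def)
  then have "exp (b * t) * (exp (- (b * t)) * (I t + a / b)) \<le> exp (b * t) * (a / b)"
    by (intro mult_left_mono) auto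
  then have "I t + a / b \<le> exp (b * t) * (a / b)"
    by (simp add: exp_minus_inverse flip: mult.assoc)
  from mult_left_mono[OF this, of b] have "b * I t + a \<le> a * exp (b * t)"
    using b by (simp add: algebra_simps)
  then show ?thesis using le[OF t] by (simp add: I_def)
qed

text \<open>Coercivity of \<open>A1\<close> yields -\<kappa> |W|^2, and the bound on
  \<open>D2\<close> a mixed term. The relaxation terms yield a mixed term with factor L / \<tau> and
  a nonpositive multiple of |K|^2, which is dropped. Both mixed terms are multiples of |K| |W|, so
  that a single square completion absorbs them.\<close>

lemma monotonicity_estimate:
  fixes A1 A2 A1' A2' :: "real^'d^'k^'d^'k" and D1 D2 :: "real^'d^'k"
  assumes A1: "A1 \<in> sym_tensors_ge \<kappa>" and pos: "0 < \<kappa>" "0 < \<tau>"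
    and B: "\<And>(A::real^'d^'k^'d^'k) D. norm (tensor_app A D) \<le> norm A * norm D * B" and B0: "0 \<le> B"
    and D2: "norm D2 \<le> M" and L: "L-lipschitz_on UNIV F"
    and eq1: "\<tau> *\<^sub>R A1' = F D1 - A1" and eq2: "\<tau> *\<^sub>R A2' = F D2 - A2"
  shows "- (tensor_app A1 D1 \<bullet> (D1 - D2)) + tensor_app A2 D2 \<bullet> (D1 - D2)
      + (A1' \<bullet> (A1 - A2) - A2' \<bullet> (A1 - A2))
    \<le> (M * B + L / \<tau>)\<^sup>2 / (4 * \<kappa>) * (norm (A1 - A2))\<^sup>2"
proof -
  define W K where "W = D1 - D2" and "K = A1 - A2"
  define c where "c = M * B + L / \<tau>"
  have "tensor_app A1 D1 - tensor_app A2 D2 = tensor_app A1 W + tensor_app K D2"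
    by (simp add: W_def K_def tensor_app.diff_left tensor_app.diff_right)
  then have "- (tensor_app A1 D1 \<bullet> W) + tensor_app A2 D2 \<bullet> W =
      - (tensor_app A1 W \<bullet> W) - tensor_app K D2 \<bullet> W"
    by (metis (no_types, lifting) add.commute diff_conv_add_uminus inner_add_left inner_diff_left minus_add_distrib minus_diff_eq)
  also have "\<dots> \<le> - (\<kappa> * (norm W)\<^sup>2) + M * B * norm K * norm W"
  proof -
    have "\<kappa> * (norm W)\<^sup>2 \<le> tensor_app A1 W \<bullet> W"
      using A1 by (simp add: sym_tensors_ge_def power2_norm_eq_inner)
    moreover have "- (tensor_app K D2 \<bullet> W) \<le> norm (tensor_app K D2) * norm W"
      using Cauchy_Schwarz_ineq2[of "tensor_app K D2" W] by linarith
    moreover have "norm (tensor_app K D2) * norm W \<le> (norm K * M * B) * norm W"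
      by (intro mult_right_mono order_trans[OF B]) (auto intro!: mult_right_mono mult_left_mono D2 B0)
    moreover have "(norm K * M * B) * norm W = M * B * norm K * norm W" by (simp add: ac_simps)
    ultimately show ?thesis by linarith
  qed
  finally have est1: "- (tensor_app A1 D1 \<bullet> W) + tensor_app A2 D2 \<bullet> W
      \<le> - (\<kappa> * (norm W)\<^sup>2) + M * B * norm K * norm W" .
  have "\<tau> *\<^sub>R (A1' - A2') = (F D1 - F D2) - K"
    unfolding scaleR_diff_right eq1 eq2 K_def by simp
  then have "\<tau> * ((A1' - A2') \<bullet> K) = (F D1 - F D2) \<bullet> K - K \<bullet> K"
    by (metis inner_diff_left inner_scaleR_left)
  also have "\<dots> \<le> norm (F D1 - F D2) * norm K"
    using Cauchy_Schwarz_ineq2[of "F D1 - F D2" K] inner_ge_zero[of K] by linarith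
  also have "\<dots> \<le> (L * norm W) * norm K"
    using lipschitz_onD[OF L, of D1 D2] by (intro mult_right_mono) (auto simp: dist_norm W_def)
  finally have "(A1' - A2') \<bullet> K \<le> L / \<tau> * norm K * norm W"
    using pos by (simp add: field_simps)
  then have "- (tensor_app A1 D1 \<bullet> W) + tensor_app A2 D2 \<bullet> W + (A1' - A2') \<bullet> K
      \<le> - (\<kappa> * (norm W)\<^sup>2) + c * norm K * norm W"
    using est1 by (simp add: c_def algebra_simps)
  also have "\<dots> \<le> c\<^sup>2 / (4 * \<kappa>) * (norm K)\<^sup>2"
  proof -
    \<comment> \<open>Completing the square in |W|; this is the origin of 4 \<kappa> in the
      constant.\<close>
    have "0 \<le> (2 * \<kappa> * norm W - c * norm K)\<^sup>2" by simp
    then have "4 * \<kappa> * (- (\<kappa> * (norm W)\<^sup>2) + c * norm K * norm W) \<le> c\<^sup>2 * (norm K)\<^sup>2"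
      by (simp add: power2_eq_square algebra_simps)
    then show ?thesis using pos by (simp add: field_simps)
  qed
  finally show ?thesis
    unfolding W_def[symmetric] K_def[symmetric] c_def inner_diff_left .
qed

text \<open>Collects the bounds, uniform in time, that \<open>energy_inequality\<close> and the
  estimate of the flux difference ask for. They rest on the bounded gradient, on the linear growth
  of the Lipschitz function \<open>F\<close>, and on the uniform bound for \<open>H\<close>.\<close>

lemma weak_solution_bounds:
  fixes u :: "real \<Rightarrow> real^'d \<Rightarrow> real^'k"
  assumes sol: "weak_solution G F \<tau> T u0 H0 u H" and G: "open G" "bounded G" "G \<noteq> {}"
    and T: "0 < T" and tau: "0 < \<tau>" and L: "L-lipschitz_on UNIV F" and grad: "bounded_gradient G T u"
    and curve: "L2_curve G T u"
    and uV: "AE r in lebesgue_on {0<..<T}. u r \<in> space_V G"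
    and H': "AE r in lebesgue_on {0<..<T}. H' r \<in> Linf_space G \<and>
      (AE x in lebesgue_on G. \<tau> *\<^sub>R H' r x = F (weak_jacobian G (u r) x) - H r x)"
  obtains C where "0 \<le> C"
    "AE r in lebesgue_on {0<..<T}. AE x in lebesgue_on G. norm (weak_jacobian G (u r) x) \<le> C"
    "AE r in lebesgue_on {0<..<T}. (\<lambda>x. tensor_app (H r x) (weak_jacobian G (u r) x)) \<in> L2_space G"
    "AE r in lebesgue_on {0<..<T}. \<forall>v\<in>space_V G. \<bar>op_A G (H r) (u r) v\<bar> \<le> C * H1_norm G v"
    "AE r in lebesgue_on {0<..<T}. H1_norm G (u r) \<le> C"
    "AE r in lebesgue_on {0<..<T}. H' r \<in> L2_space G \<and> L2_norm G (H' r) \<le> C"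
proof -
  interpret L2_curve G T u by (rule curve)
  let ?M = "lebesgue_on {0<..<T}" and ?s = "sqrt (measure lebesgue G)"
  have Gm: "G \<in> lmeasurable" "G \<in> sets lebesgue" using G by (auto intro: lmeasurable_open simp: borel_open)
  obtain R where R: "\<And>t. t \<in> {0..T} \<Longrightarrow> L2_norm G (u t) \<le> R" "0 \<le> R" using norm_bounded by blast
  obtain Mu where Mu: "0 \<le> Mu" "AE r in ?M. AE x in lebesgue_on G. norm (weak_jacobian G (u r) x) \<le> Mu"
    using bounded_gradient_AE[OF grad G(1)] by blast
  have cc: "continuous_curve T (Linf_sym G) (Linf_norm G) H" using sol by (simp add: weak_solution_def)
  obtain MH where MH: "0 \<le> MH" "\<And>t. t \<in> {0..T} \<Longrightarrow> AE x in lebesgue_on G. norm (H t x) \<le> MH"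
    using continuous_curve_Linf_bounded[OF cc] by blast
  obtain B where B: "0 \<le> B" "\<And>(A::real^'d^'k^'d^'k) D. norm (tensor_app A D) \<le> norm A * norm D * B"
    using tensor_app.nonneg_bounded by blast
  \<comment> \<open>A sum of nonnegative bounds, in this order: for the gradient, for the L2 norm of
    the flux, for the H1 norm of \<open>u r\<close>, and for the L2 norm of \<open>H' r\<close>.
    Being a sum, it dominates each of them.\<close>
  define C where "C = Mu + MH * Mu * B * ?s + (R + Mu * ?s) + (norm (F 0) + L * Mu + MH) / \<tau> * ?s"
  have L0: "0 \<le> L" using L by (rule lipschitz_on_nonneg)
  have s0: "0 \<le> ?s" by simp
  have pos: "0 \<le> MH * Mu * B * ?s" "0 \<le> R + Mu * ?s" "0 \<le> (norm (F 0) + L * Mu + MH) / \<tau>"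
    "0 \<le> (norm (F 0) + L * Mu + MH) / \<tau> * ?s"
    using B(1) Mu(1) MH(1) R(2) L0 tau s0
    by (auto intro!: mult_nonneg_nonneg divide_nonneg_pos add_nonneg_nonneg simp del: real_sqrt_ge_0_iff)
  have C: "Mu \<le> C" "MH * Mu * B * ?s \<le> C" "R + Mu * ?s \<le> C" "(norm (F 0) + L * Mu + MH) / \<tau> * ?s \<le> C"
    using pos Mu(1) unfolding C_def by linarith+
  have flux: "AE r in ?M. (\<lambda>x. tensor_app (H r x) (weak_jacobian G (u r) x)) \<in> L2_space G \<and>
      L2_norm G (\<lambda>x. tensor_app (H r x) (weak_jacobian G (u r) x)) \<le> C"
    using uV Mu(2) AE_space
  proof eventually_elim
    case (elim r)
    then have r: "r \<in> {0..T}" by auto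
    have m: "(\<lambda>x. tensor_app (H r x) (weak_jacobian G (u r) x)) \<in> borel_measurable (lebesgue_on G)"
    proof (rule borel_measurable_bilinear[OF bilinear_tensor_app _ _ Gm(2)])
      show "H r \<in> borel_measurable (lebesgue_on G)"
        using cc r by (auto simp: continuous_curve_def Linf_sym_def Linf_space_def)
      show "weak_jacobian G (u r) \<in> borel_measurable (lebesgue_on G)"
        using space_V_D(3)[OF elim(1) G(1)] by (rule L2_spaceD)
    qed
    have ae: "AE x in lebesgue_on G. norm (tensor_app (H r x) (weak_jacobian G (u r) x)) \<le> MH * Mu * B"
      using MH(2)[OF r] elim(2)
    proof eventually_elim
      case (elim x)
      have "norm (tensor_app (H r x) (weak_jacobian G (u r) x)) \<le> norm (H r x) * norm (weak_jacobian G (u r) x) * B"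
        by (rule B(2))
      also have "\<dots> \<le> MH * Mu * B"
        using elim B(1) MH(1) by (intro mult_right_mono mult_mono) auto
      finally show ?case .
    qed
    have nn: "0 \<le> MH * Mu * B" using B(1) Mu(1) MH(1) by simp
    from bounded_measurable_L2[OF m ae nn Gm(1)] show ?case using C(2) by simp
  qed
  show ?thesis
  proof (rule that[of C])
    show "0 \<le> C" using C(1) Mu(1) by linarith
    show "AE r in ?M. AE x in lebesgue_on G. norm (weak_jacobian G (u r) x) \<le> C"
      using Mu(2)
    proof eventually_elim
      case (elim r)
      then show ?case by eventually_elim (use C(1) in linarith)
    qed
    show "AE r in ?M. (\<lambda>x. tensor_app (H r x) (weak_jacobian G (u r) x)) \<in> L2_space G"
      using flux by eventually_elim blast
    show "AE r in ?M. \<forall>v\<in>space_V G. \<bar>op_A G (H r) (u r) v\<bar> \<le> C * H1_norm G v"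
      using flux
    proof eventually_elim
      case (elim r)
      then show ?case unfolding op_A_def by (intro ballI space_V_integral_bound G) auto
    qed
    show "AE r in ?M. H1_norm G (u r) \<le> C"
      using uV Mu(2) AE_space
    proof eventually_elim
      case (elim r)
      have "L2_norm G (weak_jacobian G (u r)) \<le> Mu * ?s"
        using space_V_D(3)[OF elim(1) G(1)] elim(2) Mu(1) Gm(1)
        by (intro bounded_measurable_L2) (auto dest: L2_spaceD)
      moreover have "L2_norm G (u r) \<le> R" using R(1) elim(3) by auto
      moreover have "H1_norm G (u r) \<le> L2_norm G (u r) + L2_norm G (weak_jacobian G (u r))"
        unfolding H1_norm_def by (intro sqrt_sum_squares_le_sum L2_norm_nonneg)
      ultimately show ?case using C(3) by linarith
    qed
    show "AE r in ?M. H' r \<in> L2_space G \<and> L2_norm G (H' r) \<le> C"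
      using H' Mu(2) AE_space
    proof eventually_elim
      case (elim r)
      then have r: "r \<in> {0..T}" by auto
      have m: "H' r \<in> borel_measurable (lebesgue_on G)" using elim(1) by (simp add: Linf_space_def)
      from elim(1) have "AE x in lebesgue_on G. \<tau> *\<^sub>R H' r x = F (weak_jacobian G (u r) x) - H r x" by blast
      then have ae: "AE x in lebesgue_on G. norm (H' r x) \<le> (norm (F 0) + L * Mu + MH) / \<tau>"
        using MH(2)[OF r] elim(2)
      proof eventually_elim
        case (elim x)
        let ?D = "weak_jacobian G (u r) x"
        have "\<tau> * norm (H' r x) = norm (F ?D - H r x)"
          using arg_cong[OF elim(1), of norm] tau by simp
        also have "\<dots> \<le> norm (F ?D) + norm (H r x)" by (rule norm_triangle_ineq4)
        also have "norm (F ?D) \<le> norm (F 0) + norm (F ?D - F 0)" by (rule norm_triangle_sub)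
        also have "norm (F ?D - F 0) \<le> L * norm ?D"
          using lipschitz_onD[OF L, of ?D 0] by (simp add: dist_norm)
        also have "L * norm ?D \<le> L * Mu" using elim L0 by (intro mult_left_mono) auto
        finally have "\<tau> * norm (H' r x) \<le> norm (F 0) + L * Mu + MH" using elim by simp
        then show ?case using tau by (simp add: field_simps)
      qed
      from bounded_measurable_L2[OF m ae pos(3) Gm(1)] show ?case using C(4) by simp
    qed
  qed
qed

section \<open>Energy inequalities for the difference of two solutions\<close>

lemma parabolic_energy_inequality:
  fixes u1 u2 :: "real \<Rightarrow> real^'d \<Rightarrow> real^'k"
  assumes G: "open G" "bounded G" and C12: "0 \<le> C1" "0 \<le> C2"
    and curve: "L2_curve G T u1" "L2_curve G T u2"
    and sm: "strongly_measurable T (space_V G) (H1_norm G) u1" "strongly_measurable T (space_V G) (H1_norm G) u2"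
    and dual: "AE r in lebesgue_on {0<..<T}. u1' r \<in> dual_V G" "AE r in lebesgue_on {0<..<T}. u2' r \<in> dual_V G"
    and bound: "AE r in lebesgue_on {0<..<T}. \<forall>v\<in>space_V G. \<bar>u1' r v\<bar> \<le> C1 * H1_norm G v"
      "AE r in lebesgue_on {0<..<T}. \<forall>v\<in>space_V G. \<bar>u2' r v\<bar> \<le> C2 * H1_norm G v"
    and H1: "AE r in lebesgue_on {0<..<T}. H1_norm G (u1 r) \<le> C1" "AE r in lebesgue_on {0<..<T}. H1_norm G (u2 r) \<le> C2"
    and deriv: "tested_derivative G T (space_V G) u1 u1'" "tested_derivative G T (space_V G) u2 u2'"
  defines "w \<equiv> \<lambda>t x. u1 t x - u2 t x"
  shows "integrable (lebesgue_on {0<..<T}) (\<lambda>r. u1' r (w r) - u2' r (w r))"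
    and "t \<in> {0..T} \<Longrightarrow> (L2_norm G (w t))\<^sup>2 - (L2_norm G (w 0))\<^sup>2 \<le>
      2 * integral {0..t} (\<lambda>r. u1' r (w r) - u2' r (w r))"
proof -
  let ?M = "lebesgue_on {0<..<T}"
  define C where "C = C1 + C2"
  have C: "0 \<le> C" "C1 \<le> C" "C2 \<le> C" using C12 by (auto simp: C_def)
  interpret w: L2_curve G T w unfolding w_def by (rule L2_curve_diff[OF curve])
  have uV: "AE r in ?M. u1 r \<in> space_V G" "AE r in ?M. u2 r \<in> space_V G"
    using sm by (auto simp: strongly_measurable_def)
  obtain S1 where S1: "countable S1" "S1 \<subseteq> space_V G"
    "AE t in ?M. \<forall>\<epsilon>>0. \<exists>a\<in>S1. \<bar>H1_norm G (\<lambda>p. u1 t p - a p)\<bar> < \<epsilon>"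
    using strongly_measurable_separable[OF sm(1)] by blast
  obtain S2 where S2: "countable S2" "S2 \<subseteq> space_V G"
    "AE t in ?M. \<forall>\<epsilon>>0. \<exists>a\<in>S2. \<bar>H1_norm G (\<lambda>p. u2 t p - a p)\<bar> < \<epsilon>"
    using strongly_measurable_separable[OF sm(2)] by blast
  \<comment> \<open>Strong measurability gives a countable dense family for each solution
    separately; pairwise differences serve for \<open>w\<close>.\<close>
  define S where "S = (\<lambda>(a, b) x. a x - b x) ` (S1 \<times> S2)"
  have S: "countable S" "S \<subseteq> space_V G"
    using S1(1,2) S2(1,2) space_V_diff(1)[OF _ _ G] by (auto simp: S_def)
  have L_deriv: "tested_derivative G T (space_V G) w (\<lambda>r v. u1' r v - u2' r v)"
    unfolding w_def using space_V_D(1)[OF _ G(1)] by (intro tested_derivative_diff curve deriv) auto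
  have L_bound: "AE r in ?M. \<forall>v\<in>space_V G. \<bar>u1' r v - u2' r v\<bar> \<le> 2 * C * H1_norm G v"
    using bound
  proof eventually_elim
    case (elim r)
    show ?case
    proof
      fix v :: "real^'d \<Rightarrow> real^'k" assume v: "v \<in> space_V G"
      have "\<bar>u1' r v\<bar> \<le> C1 * H1_norm G v" "\<bar>u2' r v\<bar> \<le> C2 * H1_norm G v" using elim v by blast+
      then show "\<bar>u1' r v - u2' r v\<bar> \<le> 2 * C * H1_norm G v"
        using mult_right_mono[OF C(2) H1_norm_nonneg[of G v]] mult_right_mono[OF C(3) H1_norm_nonneg[of G v]]
        by linarith
    qed
  qed
  have dual_diff: "l (\<lambda>x. v x - z x) = l v - l z"
    if "l \<in> dual_V G" "v \<in> space_V G" "z \<in> space_V G" for l and v z :: "real^'d \<Rightarrow> real^'k"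
  proof -
    have add: "\<forall>v\<in>space_V G. \<forall>w\<in>space_V G. l (\<lambda>x. v x + w x) = l v + l w"
      and scale: "\<forall>a. \<forall>v\<in>space_V G. l (\<lambda>x. a *\<^sub>R v x) = a * l v"
      using that(1) by (simp_all add: dual_V_def)
    have "l (\<lambda>x. v x + (- 1) *\<^sub>R z x) = l v + l (\<lambda>x. (- 1) *\<^sub>R z x)"
      by (rule add[THEN bspec, OF that(2), THEN bspec, OF space_V_scaleR(1)[OF that(3) G]])
    also have "l (\<lambda>x. (- 1) *\<^sub>R z x) = (- 1) * l z"
      by (rule scale[THEN spec, THEN bspec, OF that(3)])
    finally show ?thesis by simp
  qed
  have L_diff: "AE r in ?M. \<forall>v\<in>space_V G. \<forall>z\<in>space_V G.
      u1' r (\<lambda>x. v x - z x) - u2' r (\<lambda>x. v x - z x) = u1' r v - u2' r v - (u1' r z - u2' r z)"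
    using dual
  proof eventually_elim
    case (elim r)
    show ?case
    proof (intro ballI)
      fix v z :: "real^'d \<Rightarrow> real^'k" assume vz: "v \<in> space_V G" "z \<in> space_V G"
      show "u1' r (\<lambda>x. v x - z x) - u2' r (\<lambda>x. v x - z x) = u1' r v - u2' r v - (u1' r z - u2' r z)"
        using dual_diff[OF elim(1) vz] dual_diff[OF elim(2) vz] by simp
    qed
  qed
  have wV: "AE r in ?M. w r \<in> space_V G \<and> H1_norm G (w r) \<le> 2 * C"
    using uV H1
  proof eventually_elim
    case (elim r)
    have "(H1_norm G (w r))\<^sup>2 \<le> 2 * (H1_norm G (u1 r))\<^sup>2 + 2 * (H1_norm G (u2 r))\<^sup>2"
      unfolding w_def by (rule H1_norm_diff_sq_le[OF elim(1,2) G])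
    also have "\<dots> \<le> 2 * C\<^sup>2 + 2 * C\<^sup>2"
      using elim(3,4) C by (intro add_mono mult_left_mono power_mono H1_norm_nonneg) auto
    also have "\<dots> = (2 * C)\<^sup>2" by (simp add: power_mult_distrib)
    finally have "H1_norm G (w r) \<le> 2 * C" by (rule power2_le_imp_le) (use C in simp)
    then show ?case using space_V_diff(1)[OF elim(1,2) G] by (simp add: w_def)
  qed
  have dense: "AE r in ?M. \<forall>\<epsilon>>0. \<exists>v\<in>S. H1_norm G (\<lambda>x. w r x - v x) < \<epsilon>"
    using uV S1(3) S2(3)
  proof eventually_elim
    case (elim r)
    show ?case
    proof (intro allI impI)
      fix \<epsilon> :: real assume \<epsilon>: "0 < \<epsilon>"
      \<comment> \<open>With two errors below \<epsilon> / 3 the squared inequality for the H1 norm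
        yields at most 2 \<epsilon> / 3, which is strictly below \<epsilon>.\<close>
      then have e3: "0 < \<epsilon> / 3" by simp
      obtain a where a: "a \<in> S1" "\<bar>H1_norm G (\<lambda>p. u1 r p - a p)\<bar> < \<epsilon> / 3" using elim(3) e3 by blast
      obtain b where b: "b \<in> S2" "\<bar>H1_norm G (\<lambda>p. u2 r p - b p)\<bar> < \<epsilon> / 3" using elim(4) e3 by blast
      have V: "(\<lambda>p. u1 r p - a p) \<in> space_V G" "(\<lambda>p. u2 r p - b p) \<in> space_V G"
        using a(1) b(1) S1(2) S2(2) elim(1,2) by (auto intro!: space_V_diff(1) G)
      have "(H1_norm G (\<lambda>x. (u1 r x - a x) - (u2 r x - b x)))\<^sup>2 \<le>
          2 * (H1_norm G (\<lambda>p. u1 r p - a p))\<^sup>2 + 2 * (H1_norm G (\<lambda>p. u2 r p - b p))\<^sup>2"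
        by (rule H1_norm_diff_sq_le[OF V G])
      also have "\<dots> \<le> 2 * (\<epsilon> / 3)\<^sup>2 + 2 * (\<epsilon> / 3)\<^sup>2"
        using a(2) b(2) by (intro add_mono mult_left_mono power_mono H1_norm_nonneg) auto
      also have "\<dots> = (2 * (\<epsilon> / 3))\<^sup>2" by (simp add: power2_eq_square)
      finally have "H1_norm G (\<lambda>x. (u1 r x - a x) - (u2 r x - b x)) \<le> 2 * (\<epsilon> / 3)"
        by (rule power2_le_imp_le) (use \<epsilon> in simp)
      moreover have "(\<lambda>x. (u1 r x - a x) - (u2 r x - b x)) = (\<lambda>x. w r x - (a x - b x))"
        by (simp add: fun_eq_iff w_def)
      ultimately have "H1_norm G (\<lambda>x. w r x - (a x - b x)) < \<epsilon>" using \<epsilon> by simp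
      moreover have "(\<lambda>x. a x - b x) \<in> S" using a(1) b(1) by (auto simp: S_def)
      ultimately show "\<exists>v\<in>S. H1_norm G (\<lambda>x. w r x - v x) < \<epsilon>" by (intro bexI)
    qed
  qed
  have M: "0 \<le> 2 * C" using C by simp
  note E = w.energy_inequality[where L = "\<lambda>r v. u1' r v - u2' r v" and nrm = "H1_norm G",
      OF S M space_V_diff(1)[OF _ _ G] L_deriv H1_norm_nonneg L_bound L_diff wV dense]
  show "integrable ?M (\<lambda>r. u1' r (w r) - u2' r (w r))" by (rule E(1))
  assume t: "t \<in> {0..T}"
  show "(L2_norm G (w t))\<^sup>2 - (L2_norm G (w 0))\<^sup>2 \<le> 2 * integral {0..t} (\<lambda>r. u1' r (w r) - u2' r (w r))"
    by (rule E(2)[of t]; (assumption | rule t))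
qed

text \<open>The parabolic argument with \<open>L2_norm\<close> in place of \<open>H1_norm\<close>:
  by the Cauchy-Schwarz inequality the time derivatives act as bounded functionals on all of
  L2.\<close>

lemma relaxation_energy_inequality:
  fixes H1 H2 :: "real \<Rightarrow> 'a::euclidean_space \<Rightarrow> 'b::euclidean_space"
  assumes C12: "0 \<le> C1" "0 \<le> C2"
    and curve: "L2_curve G T H1" "L2_curve G T H2"
    and bound: "AE r in lebesgue_on {0<..<T}. H1' r \<in> L2_space G \<and> L2_norm G (H1' r) \<le> C1"
      "AE r in lebesgue_on {0<..<T}. H2' r \<in> L2_space G \<and> L2_norm G (H2' r) \<le> C2"
    and deriv: "tested_derivative G T (L2_space G) H1 (\<lambda>r. L2_inner G (H1' r))"
      "tested_derivative G T (L2_space G) H2 (\<lambda>r. L2_inner G (H2' r))"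
  defines "K \<equiv> \<lambda>t x. H1 t x - H2 t x"
  shows "integrable (lebesgue_on {0<..<T}) (\<lambda>r. L2_inner G (H1' r) (K r) - L2_inner G (H2' r) (K r))"
    and "t \<in> {0..T} \<Longrightarrow> (L2_norm G (K t))\<^sup>2 - (L2_norm G (K 0))\<^sup>2 \<le>
      2 * integral {0..t} (\<lambda>r. L2_inner G (H1' r) (K r) - L2_inner G (H2' r) (K r))"
proof -
  let ?M = "lebesgue_on {0<..<T}"
  define C where "C = C1 + C2"
  have C: "0 \<le> C" "C1 \<le> C" "C2 \<le> C" using C12 by (auto simp: C_def)
  interpret K: L2_curve G T K unfolding K_def by (rule L2_curve_diff[OF curve])
  obtain R where R: "\<And>t. t \<in> {0..T} \<Longrightarrow> L2_norm G (K t) \<le> R" using K.norm_bounded by blast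
  \<comment> \<open>Since \<open>K\<close> is continuous in time, its values at rational times come
    arbitrarily close to every \<open>K r\<close>.\<close>
  define S where "S = K ` (\<rat> \<inter> {0..T})"
  have S: "countable S" "S \<subseteq> L2_space G"
    using countable_rat K.z_L2 by (auto simp: S_def)
  have L_deriv: "tested_derivative G T (L2_space G) K (\<lambda>r v. L2_inner G (H1' r) v - L2_inner G (H2' r) v)"
    unfolding K_def by (intro tested_derivative_diff curve deriv order_refl)
  have L_bound: "AE r in ?M. \<forall>v\<in>L2_space G. \<bar>L2_inner G (H1' r) v - L2_inner G (H2' r) v\<bar> \<le> 2 * C * L2_norm G v"
    using bound
  proof eventually_elim
    case (elim r)
    show ?case
    proof
      fix v :: "'a \<Rightarrow> 'b" assume v: "v \<in> L2_space G"
      have "\<bar>L2_inner G h v\<bar> \<le> C * L2_norm G v" if "h \<in> L2_space G \<and> L2_norm G h \<le> C" for h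
      proof -
        have "\<bar>L2_inner G h v\<bar> \<le> L2_norm G h * L2_norm G v" using that v by (intro L2_Cauchy_Schwarz) auto
        also have "\<dots> \<le> C * L2_norm G v" using that by (intro mult_right_mono L2_norm_nonneg) auto
        finally show ?thesis .
      qed
      from this[of "H1' r"] this[of "H2' r"] elim C(2,3)
      show "\<bar>L2_inner G (H1' r) v - L2_inner G (H2' r) v\<bar> \<le> 2 * C * L2_norm G v" by linarith
    qed
  qed
  have L_diff: "AE r in ?M. \<forall>v\<in>L2_space G. \<forall>z\<in>L2_space G.
      L2_inner G (H1' r) (\<lambda>x. v x - z x) - L2_inner G (H2' r) (\<lambda>x. v x - z x) =
      L2_inner G (H1' r) v - L2_inner G (H2' r) v - (L2_inner G (H1' r) z - L2_inner G (H2' r) z)"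
    using bound
  proof eventually_elim
    case (elim r)
    then show ?case by (intro ballI) (simp add: L2_inner_diff_right)
  qed
  have KV: "AE r in ?M. K r \<in> L2_space G \<and> L2_norm G (K r) \<le> R"
    using AE_space by eventually_elim (use K.z_L2 R in auto)
  have dense: "AE r in ?M. \<forall>\<epsilon>>0. \<exists>v\<in>S. L2_norm G (\<lambda>x. K r x - v x) < \<epsilon>"
    using AE_space
  proof eventually_elim
    case (elim r)
    then have r: "0 < r" "r < T" by auto
    show ?case
    proof (intro allI impI)
      fix \<epsilon> :: real assume \<epsilon>: "0 < \<epsilon>"
      have lim: "((\<lambda>s. L2_norm G (\<lambda>x. K s x - K r x)) \<longlongrightarrow> 0) (at r within {0..T})"
        using r by (intro K.z_cont) auto
      obtain d where d: "d > 0" "\<And>s. s \<in> {0..T} \<Longrightarrow> s \<noteq> r \<Longrightarrow> dist s r < d \<Longrightarrow> L2_norm G (\<lambda>x. K s x - K r x) < \<epsilon>"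
        using order_tendstoD(2)[OF lim \<epsilon>] unfolding eventually_at by blast
      \<comment> \<open>Taking q to the right of r excludes q = r, about which the punctured limit
        says nothing.\<close>
      obtain q where q: "q \<in> \<rat>" "r < q" "q < min T (r + d)"
        using Rats_dense_in_real[of r "min T (r + d)"] r d(1) by auto
      have "L2_norm G (\<lambda>x. K q x - K r x) < \<epsilon>"
        using q r by (intro d(2)) (auto simp: dist_real_def)
      moreover have "L2_norm G (\<lambda>x. K q x - K r x) = L2_norm G (\<lambda>x. K r x - K q x)"
        by (simp add: L2_norm_def norm_minus_commute)
      moreover have "K q \<in> S" using q r by (auto simp: S_def)
      ultimately show "\<exists>v\<in>S. L2_norm G (\<lambda>x. K r x - v x) < \<epsilon>" by (intro bexI) simp_all
    qed
  qed
  have M: "0 \<le> 2 * C" using C by simp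
  note E = K.energy_inequality[where L = "\<lambda>r v. L2_inner G (H1' r) v - L2_inner G (H2' r) v" and nrm = "L2_norm G",
      OF S M L2_space_diff L_deriv L2_norm_nonneg L_bound L_diff KV dense]
  show "integrable ?M (\<lambda>r. L2_inner G (H1' r) (K r) - L2_inner G (H2' r) (K r))" by (rule E(1))
  assume t: "t \<in> {0..T}"
  show "(L2_norm G (K t))\<^sup>2 - (L2_norm G (K 0))\<^sup>2 \<le>
      2 * integral {0..t} (\<lambda>r. L2_inner G (H1' r) (K r) - L2_inner G (H2' r) (K r))"
    by (rule E(2)[of t]; (assumption | rule t))
qed

text \<open>The pointwise estimate integrated over G, with the time derivatives of the parabolic
  equations expressed by \<open>op_A\<close>. The Jacobian chosen for the difference
  \<open>w\<close> is exchanged for the difference of the Jacobians off a null set.\<close>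

lemma flux_difference_estimate:
  fixes u1 u2 :: "real^'d \<Rightarrow> real^'k" and H1 H2 H1' H2' :: "real^'d \<Rightarrow> real^'d^'k^'d^'k"
  assumes G: "open G" "bounded G" and pos: "0 < \<kappa>" "0 < \<tau>"
    and B: "\<And>(A::real^'d^'k^'d^'k) D. norm (tensor_app A D) \<le> norm A * norm D * B" "0 \<le> B"
    and L: "L-lipschitz_on UNIV F"
    and u: "u1 \<in> space_V G" "u2 \<in> space_V G"
    and H: "H1 \<in> L2_space G" "H2 \<in> L2_space G" "H1' \<in> L2_space G" "H2' \<in> L2_space G"
    and flux: "(\<lambda>x. tensor_app (H1 x) (weak_jacobian G u1 x)) \<in> L2_space G"
      "(\<lambda>x. tensor_app (H2 x) (weak_jacobian G u2 x)) \<in> L2_space G"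
    and coercive: "AE x in lebesgue_on G. H1 x \<in> sym_tensors_ge \<kappa>"
    and D2: "AE x in lebesgue_on G. norm (weak_jacobian G u2 x) \<le> M"
    and eq: "AE x in lebesgue_on G. \<tau> *\<^sub>R H1' x = F (weak_jacobian G u1 x) - H1 x"
      "AE x in lebesgue_on G. \<tau> *\<^sub>R H2' x = F (weak_jacobian G u2 x) - H2 x"
  defines "w \<equiv> \<lambda>x. u1 x - u2 x" and "K \<equiv> \<lambda>x. H1 x - H2 x"
  shows "- op_A G H1 u1 w + op_A G H2 u2 w + (L2_inner G H1' K - L2_inner G H2' K)
    \<le> (M * B + L / \<tau>)\<^sup>2 / (4 * \<kappa>) * (L2_norm G K)\<^sup>2"
proof -
  let ?M = "lebesgue_on G" and ?c = "(M * B + L / \<tau>)\<^sup>2 / (4 * \<kappa>)"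
  have w: "w \<in> space_V G" unfolding w_def by (rule space_V_diff(1)[OF u G])
  have K: "K \<in> L2_space G" unfolding K_def by (intro L2_space_diff H)
  have W: "AE x in ?M. weak_jacobian G u1 x - weak_jacobian G u2 x = weak_jacobian G w x"
    unfolding w_def by (rule space_V_diff(2)[OF u G])
  define a1 a2 b1 b2 where "a1 x = tensor_app (H1 x) (weak_jacobian G u1 x) \<bullet> weak_jacobian G w x"
    and "a2 x = tensor_app (H2 x) (weak_jacobian G u2 x) \<bullet> weak_jacobian G w x"
    and "b1 x = H1' x \<bullet> K x" and "b2 x = H2' x \<bullet> K x" for x
  have int: "integrable ?M a1" "integrable ?M a2" "integrable ?M b1" "integrable ?M b2"
    unfolding a1_def a2_def b1_def b2_def
    by (intro L2_inner_integrable flux H K space_V_D(3)[OF w G(1)])+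
  have "- op_A G H1 u1 w + op_A G H2 u2 w + (L2_inner G H1' K - L2_inner G H2' K) =
      - (LINT x|?M. a1 x) + (LINT x|?M. a2 x) + ((LINT x|?M. b1 x) - (LINT x|?M. b2 x))"
    by (simp add: op_A_def L2_inner_def a1_def a2_def b1_def b2_def)
  also have "\<dots> = (LINT x|?M. - a1 x + a2 x + (b1 x - b2 x))"
    using int by simp
  also have "\<dots> \<le> (LINT x|?M. ?c * (norm (K x))\<^sup>2)"
  proof (rule integral_mono_AE)
    show "integrable ?M (\<lambda>x. - a1 x + a2 x + (b1 x - b2 x))" using int by simp
    show "integrable ?M (\<lambda>x. ?c * (norm (K x))\<^sup>2)"
      by (intro integrable_mult_right L2_spaceD(2) K)
    show "AE x in ?M. - a1 x + a2 x + (b1 x - b2 x) \<le> ?c * (norm (K x))\<^sup>2"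
      using W coercive D2 eq
    proof eventually_elim
      case (elim x)
      from monotonicity_estimate[OF elim(2) pos B elim(3) L elim(4,5)] show ?case
        by (simp add: a1_def a2_def b1_def b2_def K_def flip: elim(1))
    qed
  qed
  also have "\<dots> = ?c * (L2_norm G K)\<^sup>2" by (simp add: L2_norm_def)
  finally show ?thesis .
qed

text \<open>The maximum is expressed by a time \<open>t\<^sub>m\<close> at which it is attained;
  such a time exists because the energy is continuous on a compact interval. The constant found is
  exp(b T), with b the rate in Gronwall's lemma.\<close>

theorem corollary16:
  fixes G :: "(real^'d) set"
    and F :: "real^'d^'k \<Rightarrow> real^'d^'k^'d^'k"
    and \<tau> c T :: real
    and u\<^sub>1\<^sub>0 u\<^sub>2\<^sub>0 :: "real^'d \<Rightarrow> real^'k"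
    and H\<^sub>1\<^sub>0 H\<^sub>2\<^sub>0 :: "real^'d \<Rightarrow> real^'d^'k^'d^'k"
    and u\<^sub>1 u\<^sub>2 :: "real \<Rightarrow> real^'d \<Rightarrow> real^'k"
    and H\<^sub>1 H\<^sub>2 :: "real \<Rightarrow> real^'d \<Rightarrow> real^'d^'k^'d^'k"
  assumes domain: "open G" "connected G" "G \<noteq> {}" "bounded G"
    and tau: "\<tau> > 0"
    and F_range: "\<And>D. F D \<in> sym_tensors_ge 0"
    and c: "c > 0"
    and F_bounded: "AE D in lebesgue. norm (F D) \<le> c"
    and F_weakly_diff: "\<exists>J. is_weak_tensor_jacobian F J \<and> (AE D in lebesgue. norm (J D) \<le> c)"
    and F_lipschitz_representative: "\<exists>L. L-lipschitz_on UNIV F"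
    and T: "T > 0"
    and initial1: "u\<^sub>1\<^sub>0 \<in> space_H G" "H\<^sub>1\<^sub>0 \<in> Linf_sym G"
    and initial2: "u\<^sub>2\<^sub>0 \<in> space_H G" "H\<^sub>2\<^sub>0 \<in> Linf_sym G"
    and solution1: "weak_solution G F \<tau> T u\<^sub>1\<^sub>0 H\<^sub>1\<^sub>0 u\<^sub>1 H\<^sub>1"
    and solution2: "weak_solution G F \<tau> T u\<^sub>2\<^sub>0 H\<^sub>2\<^sub>0 u\<^sub>2 H\<^sub>2"
    and gradient1: "bounded_gradient G T u\<^sub>1"
    and gradient2: "bounded_gradient G T u\<^sub>2"
  shows "let E = (\<lambda>t. (L2_norm G (\<lambda>x. u\<^sub>1 t x - u\<^sub>2 t x))\<^sup>2
                    + (L2_norm G (\<lambda>x. H\<^sub>1 t x - H\<^sub>2 t x))\<^sup>2)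
         in \<exists>C>0. \<exists>t\<^sub>m\<in>{0..T}. (\<forall>t\<in>{0..T}. E t \<le> E t\<^sub>m) \<and> E t\<^sub>m \<le> C * E 0"
proof -
  let ?M = "lebesgue_on {0<..<T}"
  note G = \<open>open G\<close> \<open>bounded G\<close> and G' = \<open>open G\<close> \<open>bounded G\<close> \<open>G \<noteq> {}\<close>
  obtain L where L: "L-lipschitz_on UNIV F" using F_lipschitz_representative by blast
  obtain B where B: "0 \<le> B" "\<And>(A::real^'d^'k^'d^'k) D. norm (tensor_app A D) \<le> norm A * norm D * B"
    using tensor_app.nonneg_bounded by blast
  obtain u\<^sub>1' where u1: "L2_curve G T u\<^sub>1" "AE r in ?M. u\<^sub>1 r \<in> space_V G"
      "AE r in ?M. u\<^sub>1' r \<in> dual_V G \<and> (\<forall>v\<in>space_V G. u\<^sub>1' r v = - op_A G (H\<^sub>1 r) (u\<^sub>1 r) v)"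
      "tested_derivative G T (space_V G) u\<^sub>1 u\<^sub>1'"
    using weak_solution_u[OF solution1 G T] by blast
  obtain u\<^sub>2' where u2: "L2_curve G T u\<^sub>2" "AE r in ?M. u\<^sub>2 r \<in> space_V G"
      "AE r in ?M. u\<^sub>2' r \<in> dual_V G \<and> (\<forall>v\<in>space_V G. u\<^sub>2' r v = - op_A G (H\<^sub>2 r) (u\<^sub>2 r) v)"
      "tested_derivative G T (space_V G) u\<^sub>2 u\<^sub>2'"
    using weak_solution_u[OF solution2 G T] by blast
  obtain H\<^sub>1' where H1: "L2_curve G T H\<^sub>1"
      "AE r in ?M. H\<^sub>1' r \<in> Linf_space G \<and> (AE x in lebesgue_on G. \<tau> *\<^sub>R H\<^sub>1' r x = F (weak_jacobian G (u\<^sub>1 r) x) - H\<^sub>1 r x)"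
      "tested_derivative G T (L2_space G) H\<^sub>1 (\<lambda>r. L2_inner G (H\<^sub>1' r))"
    using weak_solution_H[OF solution1 G' T] by blast
  obtain H\<^sub>2' where H2: "L2_curve G T H\<^sub>2"
      "AE r in ?M. H\<^sub>2' r \<in> Linf_space G \<and> (AE x in lebesgue_on G. \<tau> *\<^sub>R H\<^sub>2' r x = F (weak_jacobian G (u\<^sub>2 r) x) - H\<^sub>2 r x)"
      "tested_derivative G T (L2_space G) H\<^sub>2 (\<lambda>r. L2_inner G (H\<^sub>2' r))"
    using weak_solution_H[OF solution2 G' T] by blast
  obtain C\<^sub>1 where C1: "0 \<le> C\<^sub>1"
    "AE r in ?M. AE x in lebesgue_on G. norm (weak_jacobian G (u\<^sub>1 r) x) \<le> C\<^sub>1"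
    "AE r in ?M. (\<lambda>x. tensor_app (H\<^sub>1 r x) (weak_jacobian G (u\<^sub>1 r) x)) \<in> L2_space G"
    "AE r in ?M. \<forall>v\<in>space_V G. \<bar>op_A G (H\<^sub>1 r) (u\<^sub>1 r) v\<bar> \<le> C\<^sub>1 * H1_norm G v"
    "AE r in ?M. H1_norm G (u\<^sub>1 r) \<le> C\<^sub>1"
    "AE r in ?M. H\<^sub>1' r \<in> L2_space G \<and> L2_norm G (H\<^sub>1' r) \<le> C\<^sub>1"
    by (rule weak_solution_bounds[OF solution1 G' T tau L gradient1 u1(1,2) H1(2)])
  obtain C\<^sub>2 where C2: "0 \<le> C\<^sub>2"
    "AE r in ?M. AE x in lebesgue_on G. norm (weak_jacobian G (u\<^sub>2 r) x) \<le> C\<^sub>2"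
    "AE r in ?M. (\<lambda>x. tensor_app (H\<^sub>2 r x) (weak_jacobian G (u\<^sub>2 r) x)) \<in> L2_space G"
    "AE r in ?M. \<forall>v\<in>space_V G. \<bar>op_A G (H\<^sub>2 r) (u\<^sub>2 r) v\<bar> \<le> C\<^sub>2 * H1_norm G v"
    "AE r in ?M. H1_norm G (u\<^sub>2 r) \<le> C\<^sub>2"
    "AE r in ?M. H\<^sub>2' r \<in> L2_space G \<and> L2_norm G (H\<^sub>2' r) \<le> C\<^sub>2"
    by (rule weak_solution_bounds[OF solution2 G' T tau L gradient2 u2(1,2) H2(2)])
  obtain \<kappa> where \<kappa>: "0 < \<kappa>" "AE r in ?M. AE x in lebesgue_on G. H\<^sub>1 r x \<in> sym_tensors_ge \<kappa>"
    using solution1 unfolding weak_solution_def by blast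
  have sm: "strongly_measurable T (space_V G) (H1_norm G) u\<^sub>1" "strongly_measurable T (space_V G) (H1_norm G) u\<^sub>2"
    using solution1 solution2 by (auto simp: weak_solution_def bochner_L2_def)
  have dual1: "AE r in ?M. u\<^sub>1' r \<in> dual_V G" using u1(3) by eventually_elim blast
  have dual2: "AE r in ?M. u\<^sub>2' r \<in> dual_V G" using u2(3) by eventually_elim blast
  have bound1: "AE r in ?M. \<forall>v\<in>space_V G. \<bar>u\<^sub>1' r v\<bar> \<le> C\<^sub>1 * H1_norm G v"
    using u1(3) C1(4) by eventually_elim simp
  have bound2: "AE r in ?M. \<forall>v\<in>space_V G. \<bar>u\<^sub>2' r v\<bar> \<le> C\<^sub>2 * H1_norm G v"
    using u2(3) C2(4) by eventually_elim simp
  define w where "w = (\<lambda>t x. u\<^sub>1 t x - u\<^sub>2 t x)"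
  define K where "K = (\<lambda>t x. H\<^sub>1 t x - H\<^sub>2 t x)"
  interpret w: L2_curve G T w unfolding w_def by (rule L2_curve_diff[OF u1(1) u2(1)])
  interpret K: L2_curve G T K unfolding K_def by (rule L2_curve_diff[OF H1(1) H2(1)])
  define p where "p r = u\<^sub>1' r (w r) - u\<^sub>2' r (w r)" for r
  define m where "m r = L2_inner G (H\<^sub>1' r) (K r) - L2_inner G (H\<^sub>2' r) (K r)" for r
  note thms_u = G C1(1) C2(1) u1(1) u2(1) sm dual1 dual2 bound1 bound2 C1(5) C2(5) u1(4) u2(4)
  have Eu: "integrable ?M p"
    "\<And>t. t \<in> {0..T} \<Longrightarrow> (L2_norm G (w t))\<^sup>2 - (L2_norm G (w 0))\<^sup>2 \<le> 2 * integral {0..t} p"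
    unfolding p_def[abs_def] w_def by (rule parabolic_energy_inequality[OF thms_u]; assumption)+
  note thms_H = C1(1) C2(1) H1(1) H2(1) C1(6) C2(6) H1(3) H2(3)
  have EH: "integrable ?M m"
    "\<And>t. t \<in> {0..T} \<Longrightarrow> (L2_norm G (K t))\<^sup>2 - (L2_norm G (K 0))\<^sup>2 \<le> 2 * integral {0..t} m"
    unfolding m_def[abs_def] K_def by (rule relaxation_energy_inequality[OF thms_H]; assumption)+
  define E where "E t = (L2_norm G (w t))\<^sup>2 + (L2_norm G (K t))\<^sup>2" for t
  \<comment> \<open>Twice the constant of \<open>flux_difference_estimate\<close>, as the energy
    inequalities carry a factor 2. Adding 1 makes \<open>b\<close> positive, because
    \<open>gronwall\<close> divides by it.\<close>
  define b where "b = 2 * ((C\<^sub>2 * B + L / \<tau>)\<^sup>2 / (4 * \<kappa>)) + 1"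
  have b: "0 < b" using \<kappa>(1) by (auto simp: b_def intro!: add_nonneg_pos)
  have E_cont: "continuous_on {0..T} E"
    unfolding E_def by (intro continuous_on_add continuous_on_power w.norm_continuous K.norm_continuous)
  have E_int: "integrable ?M (\<lambda>r. b / 2 * E r)"
  proof -
    have "set_integrable lebesgue {0..T} (\<lambda>r. b / 2 * E r)"
      by (intro absolutely_integrable_continuous_real continuous_on_mult continuous_on_const E_cont)
    then have "set_integrable lebesgue {0<..<T} (\<lambda>r. b / 2 * E r)"
      by (rule set_integrable_subset) auto
    then show ?thesis by (simp add: integrable_lebesgue_on_iff)
  qed
  \<comment> \<open>The two energy rates are added before they are estimated: the coercivity of the
    parabolic part has to absorb the mixed terms of both equations.\<close>
  have rate: "AE r in ?M. p r + m r \<le> b / 2 * E r"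
    using u1(2) u2(2) u1(3) u2(3) H1(2) H2(2) C1(3) C2(3) C1(6) C2(6) \<kappa>(2) C2(2) AE_space
  proof eventually_elim
    case (elim r)
    then have r: "r \<in> {0..T}" by auto
    interpret H1: L2_curve G T H\<^sub>1 by (rule H1(1))
    interpret H2: L2_curve G T H\<^sub>2 by (rule H2(1))
    have "w r \<in> space_V G" unfolding w_def by (rule space_V_diff(1)[OF elim(1,2) G])
    then have "p r + m r = - op_A G (H\<^sub>1 r) (u\<^sub>1 r) (w r) + op_A G (H\<^sub>2 r) (u\<^sub>2 r) (w r) + m r"
      using elim(3,4) by (simp add: p_def)
    also have "\<dots> \<le> (C\<^sub>2 * B + L / \<tau>)\<^sup>2 / (4 * \<kappa>) * (L2_norm G (K r))\<^sup>2"
      unfolding m_def w_def K_def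
      by (rule flux_difference_estimate[OF G \<kappa>(1) tau B(2,1) L elim(1,2) H1.z_L2[OF r] H2.z_L2[OF r]])
         (use elim in auto)
    also have "\<dots> \<le> b / 2 * E r"
      by (rule mult_mono) (use b in \<open>auto simp: b_def E_def\<close>)
    finally show ?case .
  qed
  have gron: "E t \<le> E 0 + b * integral {0..t} E" if t: "t \<in> {0..T}" for t
  proof -
    have "E t - E 0 \<le> 2 * (integral {0..t} p + integral {0..t} m)"
      using Eu(2)[OF t] EH(2)[OF t] by (simp add: E_def)
    also have "integral {0..t} p + integral {0..t} m = integral {0..t} (\<lambda>r. p r + m r)"
      using t integrable_on_Icc_if_Ioo[OF Eu(1), of 0 t] integrable_on_Icc_if_Ioo[OF EH(1), of 0 t] by (simp add: Henstock_Kurzweil_Integration.integral_add)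
    also have "\<dots> \<le> integral {0..t} (\<lambda>r. b / 2 * E r)"
      using t by (intro integral_AE_mono[OF Bochner_Integration.integrable_add[OF Eu(1) EH(1)] E_int rate]) auto
    also have "\<dots> = b / 2 * integral {0..t} E" by simp
    finally show ?thesis by simp
  qed
  obtain t\<^sub>m where tm: "t\<^sub>m \<in> {0..T}" "\<And>t. t \<in> {0..T} \<Longrightarrow> E t \<le> E t\<^sub>m"
    using continuous_attains_sup[OF compact_Icc _ E_cont] T by fastforce
  have "E t\<^sub>m \<le> E 0 * exp (b * t\<^sub>m)" by (rule gronwall[OF E_cont b gron tm(1)])
  \<comment> \<open>As \<open>E 0\<close> is nonnegative, replacing the maximiser by T in the
    exponent can only increase the bound and makes the constant explicit.\<close>
  also have "\<dots> \<le> E 0 * exp (b * T)"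
    using b tm(1) by (intro mult_left_mono) (auto simp: E_def)
  finally have "E t\<^sub>m \<le> exp (b * T) * E 0" by (simp add: mult.commute)
  with tm have "\<exists>C>0. \<exists>t\<^sub>m\<in>{0..T}. (\<forall>t\<in>{0..T}. E t \<le> E t\<^sub>m) \<and> E t\<^sub>m \<le> C * E 0"
    by (intro exI[of _ "exp (b * T)"] conjI bexI[of _ t\<^sub>m] ballI exp_gt_zero)
  then show ?thesis by (simp add: Let_def E_def w_def K_def)
qed

end
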